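(* Let $\mathcal{C}$ be a proto-abelian category. The simplicial groupoid $\mathcal{S}_{\bullet} = \mathcal{S}_\bullet(\mathcal{C})$ of flags in $\mathcal{C}$ is $2$-Segal.
   Context: Monomorphisms are denoted $\hookrightarrow$ and epimorphisms $\twoheadrightarrow$. A category $\mathcal{C}$ is called proto-abelian if: (1) $\mathcal{C}$ is pointed (has a zero object). (2)(a) Every diagram $C \twoheadleftarrow A \hookrightarrow B$ can be completed to a pushout square with $A\hookrightarrow B$, $A \twoheadrightarrow C$, $B \twoheadrightarrow D$, $C \hookrightarrow D$. (b) Every diagram $C \hookrightarrow D \twoheadleftarrow B$ can be completed to a pullback square with $A\hookrightarrow B$, $A \twoheadrightarrow C$, $B \twoheadrightarrow D$, $C \hookrightarrow D$. (3) A commutative square with $A\hookrightarrow B$, $A \twoheadrightarrow C$, $B \twoheadrightarrow D$, $C \hookrightarrow D$ is a pushout square if and only if it is a pullback square; such a square is called biCartesian. Groupoid of flags. Fix a zero object $0$ of $\mathcal{C}$. $\mathcal{S}_n=\mathcal{S}_n(\mathcal{C})$ is the maximal groupoid (same objects, only isomorphisms) in the category of commutative triangular diagrams in $\mathcal{C}$ consisting of objects $A_{i,j}$, $0\le i\le j\le n$, with $A_{i,i}=0$, monomorphisms $A_{i,j}\hookrightarrow A_{i,j+1}$ and epimorphisms $A_{i,j}\twoheadrightarrow A_{i+1,j}$, such that all squares (with corners $A_{i,j},A_{i,j+1},A_{i+1,j},A_{i+1,j+1}$) are biCartesian. The face functor $\partial_k:\mathcal{S}_n\to\mathcal{S}_{n-1}$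 omits the objects in the $k$-th row and $k$-th column and composes the remaining morphisms; the degeneracy $\sigma_k:\mathcal{S}_n\to\mathcal{S}_{n+1}$ replaces the $k$-th row by two rows connected via identity maps and the $k$-th column by two columns connected via identity maps. This makes $\mathcal{S}_\bullet$ a functor from $\Delta^{\mathrm{op}}$ to the category of groupoids. For a simplicial object $\mathcal{X}_\bullet$ and a finite nonempty linearly ordered set $I$ one writes $\mathcal{X}_I$ for $\mathcal{X}_{|I|-1}$ via the unique order isomorphism $I\cong[|I|-1]$. $2$-pullbacks. For functors of groupoids $F:\mathcal{A}\to\mathcal{C}'$, $G:\mathcal{B}\to\mathcal{C}'$, the $2$-pullback $\mathcal{A}\times^{(2)}_{\mathcal{C}'}\mathcal{B}$ has objects $(a,b,\varphi)$ with $a\in\mathcal{A}$, $b\in\mathcal{B}$, $\varphi:F(a)\cong G(b)$, and morphisms $(a,b,\varphi)\to(a',b',\varphi')$ the pairs $(f:a\to a',g:b\to b')$ with $\varphi' F(f)=G(g)\varphi$. A commutative square with functors $G':\mathcal{X}\to\mathcal{A}$, $F':\mathcal{X}\to\mathcal{B}$, $FG'=GF'$ is a $2$-pullback square if $\mathcal{X}\to\mathcal{A}\times^{(2)}_{\mathcal{C}'}\mathcal{B}$, $x\mapsto(G'(x),F'(x),\mathrm{id})$, is an equivalence. $2$-Segal. A simplicial groupoid $\mathcal{X}_\bullet$ is called $2$-Segal if the following hold. (1) For every planar $(n+1)$-gon with vertices labelled cyclically by $\{0,1,\dots,n\}$ and every diagonal with vertices $i<j$, which subdivides it into polygons with vertices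 $\{0,\dots,i,j,j+1,\dots,n\}$ and $\{i,i+1,\dots,j\}$, the commutative square with corners $\mathcal{X}_{\{0,\dots,n\}}$, $\mathcal{X}_{\{0,\dots,i,j,\dots,n\}}$, $\mathcal{X}_{\{i,\dots,j\}}$, $\mathcal{X}_{\{i,j\}}$ and maps induced by the inclusions of vertex sets is a $2$-pullback square, i.e. exhibits $\mathcal{X}_{\{0,\dots,n\}}$ as the $2$-pullback of the other three. (2) For every $0\le i<n$, the commutative square with top map $\mathcal{X}_{\{0,\dots,n-1\}}\to\mathcal{X}_{\{i\}}$ induced by inclusion, left map the $i$-th degeneracy $\sigma_i:\mathcal{X}_{\{0,\dots,n-1\}}\to\mathcal{X}_{\{0,\dots,n\}}$, bottom map $\mathcal{X}_{\{0,\dots,n\}}\to\mathcal{X}_{\{i,i+1\}}$ induced by inclusion, and right map the degeneracy $\mathcal{X}_{\{i\}}\to\mathcal{X}_{\{i,i+1\}}$, is a $2$-pullback square. *)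

theory Defs
  imports "HOL-Library.FuncSet"
begin

section \<open>Categories\<close>

text \<open>The fields are only meaningful on the carriers \<open>Obj\<close> and \<open>Arr\<close>; \<open>g \<cdot> f\<close> is
  ``first \<open>f\<close>, then \<open>g\<close>''.\<close>

record ('o, 'm) category =
  Obj :: "'o set"
  Arr :: "'m set"
  Dom :: "'m \<Rightarrow> 'o"
  Cod :: "'m \<Rightarrow> 'o"
  Ident :: "'o \<Rightarrow> 'm"
  Comp :: "'m \<Rightarrow> 'm \<Rightarrow> 'm" (infixr "\<cdot>\<index>" 70)

definition hom :: "('o, 'm) category \<Rightarrow> 'o \<Rightarrow> 'o \<Rightarrow> 'm set" where
  "hom C a b = {f \<in> Arr C. Dom C f = a \<and> Cod C f = b}"

locale category =
  fixes C :: "('o, 'm) category" (structure)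
  assumes Dom_in [simp]: "f \<in> Arr C \<Longrightarrow> Dom C f \<in> Obj C"
    and Cod_in [simp]: "f \<in> Arr C \<Longrightarrow> Cod C f \<in> Obj C"
    and Ident_in: "a \<in> Obj C \<Longrightarrow> Ident C a \<in> hom C a a"
    and Comp_in: "f \<in> hom C a b \<Longrightarrow> g \<in> hom C b c \<Longrightarrow> g \<cdot> f \<in> hom C a c"
    and Ident_left: "f \<in> hom C a b \<Longrightarrow> Ident C b \<cdot> f = f"
    and Ident_right: "f \<in> hom C a b \<Longrightarrow> f \<cdot> Ident C a = f"
    and Comp_assoc:
      "f \<in> hom C a b \<Longrightarrow> g \<in> hom C b c \<Longrightarrow> h \<in> hom C c d \<Longrightarrow> (h \<cdot> g) \<cdot> f = h \<cdot> (g \<cdot> f)"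

definition is_mono :: "('o, 'm) category \<Rightarrow> 'm \<Rightarrow> bool" where
  "is_mono C f \<longleftrightarrow> f \<in> Arr C \<and>
     (\<forall>g \<in> Arr C. \<forall>h \<in> Arr C. Cod C g = Dom C f \<longrightarrow> Cod C h = Dom C f \<longrightarrow>
        f \<cdot>\<^bsub>C\<^esub> g = f \<cdot>\<^bsub>C\<^esub> h \<longrightarrow> Dom C g = Dom C h \<longrightarrow> g = h)"

definition is_epi :: "('o, 'm) category \<Rightarrow> 'm \<Rightarrow> bool" where
  "is_epi C f \<longleftrightarrow> f \<in> Arr C \<and>
     (\<forall>g \<in> Arr C. \<forall>h \<in> Arr C. Dom C g = Cod C f \<longrightarrow> Dom C h = Cod C f \<longrightarrow>
        g \<cdot>\<^bsub>C\<^esub> f = h \<cdot>\<^bsub>C\<^esub> f \<longrightarrow> Cod C g = Cod C h \<longrightarrow> g = h)"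

definition is_iso :: "('o, 'm) category \<Rightarrow> 'm \<Rightarrow> bool" where
  "is_iso C f \<longleftrightarrow> f \<in> Arr C \<and>
     (\<exists>g \<in> hom C (Cod C f) (Dom C f).
        g \<cdot>\<^bsub>C\<^esub> f = Ident C (Dom C f) \<and> f \<cdot>\<^bsub>C\<^esub> g = Ident C (Cod C f))"

locale groupoid = category +
  assumes all_iso: "f \<in> Arr C \<Longrightarrow> is_iso C f"

text \<open>The maximal groupoid in a category.\<close>

definition core :: "('o, 'm) category \<Rightarrow> ('o, 'm) category" where
  "core C = C\<lparr>Arr := {f. is_iso C f}\<rparr>"

definition zero_object :: "('o, 'm) category \<Rightarrow> 'o \<Rightarrow> bool" where
  "zero_object C z \<longleftrightarrow> z \<in> Obj C \<and>
     (\<forall>a \<in> Obj C. (\<exists>!f. f \<in> hom C z a) \<and> (\<exists>!f. f \<in> hom C a z))"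

section \<open>Proto-abelian categories\<close>

text \<open>In the square predicates the arguments \<open>f g h k\<close> are placed as follows:
  \<open>f : A \<rightarrow> B\<close> (top), \<open>g : A \<rightarrow> C\<close> (left), \<open>h : B \<rightarrow> D\<close> (right), \<open>k : C \<rightarrow> D\<close> (bottom).\<close>

definition comm_square :: "('o, 'm) category \<Rightarrow> 'm \<Rightarrow> 'm \<Rightarrow> 'm \<Rightarrow> 'm \<Rightarrow> bool" where
  "comm_square C f g h k \<longleftrightarrow>
     f \<in> Arr C \<and> g \<in> Arr C \<and> h \<in> Arr C \<and> k \<in> Arr C \<and>
     Dom C f = Dom C g \<and> Cod C f = Dom C h \<and> Cod C g = Dom C k \<and> Cod C h = Cod C k \<and>
     h \<cdot>\<^bsub>C\<^esub> f = k \<cdot>\<^bsub>C\<^esub> g"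

definition pushout_square :: "('o, 'm) category \<Rightarrow> 'm \<Rightarrow> 'm \<Rightarrow> 'm \<Rightarrow> 'm \<Rightarrow> bool" where
  "pushout_square C f g h k \<longleftrightarrow> comm_square C f g h k \<and>
     (\<forall>u v. comm_square C f g u v \<longrightarrow>
        (\<exists>!w. w \<in> hom C (Cod C h) (Cod C u) \<and> w \<cdot>\<^bsub>C\<^esub> h = u \<and> w \<cdot>\<^bsub>C\<^esub> k = v))"

definition pullback_square :: "('o, 'm) category \<Rightarrow> 'm \<Rightarrow> 'm \<Rightarrow> 'm \<Rightarrow> 'm \<Rightarrow> bool" where
  "pullback_square C f g h k \<longleftrightarrow> comm_square C f g h k \<and>
     (\<forall>u v. comm_square C u v h k \<longrightarrow>
        (\<exists>!w. w \<in> hom C (Dom C u) (Dom C f) \<and> f \<cdot>\<^bsub>C\<^esub> w = u \<and> g \<cdot>\<^bsub>C\<^esub> w = v))"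

locale proto_abelian = category +
  assumes pointed: "\<exists>z. zero_object C z"
    and pushout_exists:
      "is_mono C f \<Longrightarrow> is_epi C g \<Longrightarrow> Dom C f = Dom C g \<Longrightarrow>
        \<exists>h k. is_epi C h \<and> is_mono C k \<and> pushout_square C f g h k"
    and pullback_exists:
      "is_epi C h \<Longrightarrow> is_mono C k \<Longrightarrow> Cod C h = Cod C k \<Longrightarrow>
        \<exists>f g. is_mono C f \<and> is_epi C g \<and> pullback_square C f g h k"
    and pushout_iff_pullback:
      "comm_square C f g h k \<Longrightarrow> is_mono C f \<Longrightarrow> is_epi C g \<Longrightarrow> is_epi C h \<Longrightarrow> is_mono C k \<Longrightarrow>
        pushout_square C f g h k \<longleftrightarrow> pullback_square C f g h k"

definition bicartesian :: "('o, 'm) category \<Rightarrow> 'm \<Rightarrow> 'm \<Rightarrow> 'm \<Rightarrow> 'm \<Rightarrow> bool" where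
  "bicartesian C f g h k \<longleftrightarrow>
     is_mono C f \<and> is_epi C g \<and> is_epi C h \<and> is_mono C k \<and>
     pushout_square C f g h k \<and> pullback_square C f g h k"

section \<open>Functors and equivalences\<close>

record ('o, 'm, 'p, 'q) funct =
  on_obj :: "'o \<Rightarrow> 'p"
  on_arr :: "'m \<Rightarrow> 'q"

definition is_functor ::
  "('o, 'm) category \<Rightarrow> ('p, 'q) category \<Rightarrow> ('o, 'm, 'p, 'q) funct \<Rightarrow> bool" where
  "is_functor A B F \<longleftrightarrow>
     (\<forall>x \<in> Obj A. on_obj F x \<in> Obj B) \<and>
     (\<forall>x y. \<forall>f \<in> hom A x y. on_arr F f \<in> hom B (on_obj F x) (on_obj F y)) \<and>
     (\<forall>x \<in> Obj A. on_arr F (Ident A x) = Ident B (on_obj F x)) \<and>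
     (\<forall>x y z. \<forall>f \<in> hom A x y. \<forall>g \<in> hom A y z.
        on_arr F (g \<cdot>\<^bsub>A\<^esub> f) = on_arr F g \<cdot>\<^bsub>B\<^esub> on_arr F f)"

definition id_functor :: "('o, 'm, 'o, 'm) funct" where
  "id_functor = \<lparr>on_obj = (\<lambda>x. x), on_arr = (\<lambda>f. f)\<rparr>"

definition comp_functor ::
  "('p, 'q, 'r, 's) funct \<Rightarrow> ('o, 'm, 'p, 'q) funct \<Rightarrow> ('o, 'm, 'r, 's) funct" where
  "comp_functor G F = \<lparr>on_obj = on_obj G \<circ> on_obj F, on_arr = on_arr G \<circ> on_arr F\<rparr>"

text \<open>Strict equality of functors with source \<open>A\<close>, i.e. equality on the carriers of \<open>A\<close>.\<close>

definition functor_eq ::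
  "('o, 'm) category \<Rightarrow> ('o, 'm, 'p, 'q) funct \<Rightarrow> ('o, 'm, 'p, 'q) funct \<Rightarrow> bool" where
  "functor_eq A F G \<longleftrightarrow>
     (\<forall>x \<in> Obj A. on_obj F x = on_obj G x) \<and> (\<forall>f \<in> Arr A. on_arr F f = on_arr G f)"

definition nat_iso ::
  "('o, 'm) category \<Rightarrow> ('p, 'q) category \<Rightarrow> ('o, 'm, 'p, 'q) funct \<Rightarrow>
   ('o, 'm, 'p, 'q) funct \<Rightarrow> ('o \<Rightarrow> 'q) \<Rightarrow> bool" where
  "nat_iso A B F G \<eta> \<longleftrightarrow>
     (\<forall>x \<in> Obj A. \<eta> x \<in> hom B (on_obj F x) (on_obj G x) \<and> is_iso B (\<eta> x)) \<and>
     (\<forall>x y. \<forall>f \<in> hom A x y. \<eta> y \<cdot>\<^bsub>B\<^esub> on_arr F f = on_arr G f \<cdot>\<^bsub>B\<^esub> \<eta> x)"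

definition is_equivalence ::
  "('o, 'm) category \<Rightarrow> ('p, 'q) category \<Rightarrow> ('o, 'm, 'p, 'q) funct \<Rightarrow> bool" where
  "is_equivalence A B F \<longleftrightarrow> is_functor A B F \<and>
     (\<exists>G. is_functor B A G \<and>
        (\<exists>\<eta>. nat_iso A A id_functor (comp_functor G F) \<eta>) \<and>
        (\<exists>\<epsilon>. nat_iso B B (comp_functor F G) id_functor \<epsilon>))"

section \<open>2-pullbacks\<close>

text \<open>A morphism of the 2-pullback is a pair \<open>(f, g)\<close>; it is stored together with its source
  and target, which it does not determine.\<close>

definition two_pullback ::
  "('a, 'am) category \<Rightarrow> ('b, 'bm) category \<Rightarrow> ('c, 'cm) category \<Rightarrow>
   ('a, 'am, 'c, 'cm) funct \<Rightarrow> ('b, 'bm, 'c, 'cm) funct \<Rightarrow>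
   ('a \<times> 'b \<times> 'cm, ('a \<times> 'b \<times> 'cm) \<times> ('a \<times> 'b \<times> 'cm) \<times> 'am \<times> 'bm) category" where
  "two_pullback A B C F G =
    (let objs = {(a, b, \<phi>). a \<in> Obj A \<and> b \<in> Obj B \<and>
                   \<phi> \<in> hom C (on_obj F a) (on_obj G b) \<and> is_iso C \<phi>}
     in \<lparr>Obj = objs,
         Arr = {((a, b, \<phi>), (a', b', \<phi>'), (f, g)).
                  (a, b, \<phi>) \<in> objs \<and> (a', b', \<phi>') \<in> objs \<and>
                  f \<in> hom A a a' \<and> g \<in> hom B b b' \<and>
                  \<phi>' \<cdot>\<^bsub>C\<^esub> on_arr F f = on_arr G g \<cdot>\<^bsub>C\<^esub> \<phi>},
         Dom = (\<lambda>(x, y, f, g). x),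
         Cod = (\<lambda>(x, y, f, g). y),
         Ident = (\<lambda>(a, b, \<phi>). ((a, b, \<phi>), (a, b, \<phi>), (Ident A a, Ident B b))),
         Comp = (\<lambda>(y', z, f', g') (x, y, f, g). (x, z, (f' \<cdot>\<^bsub>A\<^esub> f, g' \<cdot>\<^bsub>B\<^esub> g)))\<rparr>)"

text \<open>\<open>two_pullback_square X A B C P Q F G\<close> concerns the square with \<open>P : X \<rightarrow> A\<close>, \<open>Q : X \<rightarrow> B\<close>,
  \<open>F : A \<rightarrow> C\<close>, \<open>G : B \<rightarrow> C\<close>, which has to commute strictly.\<close>

definition comparison ::
  "('x, 'xm) category \<Rightarrow> ('c, 'cm) category \<Rightarrow>
   ('x, 'xm, 'a, 'am) funct \<Rightarrow> ('x, 'xm, 'b, 'bm) funct \<Rightarrow> ('a, 'am, 'c, 'cm) funct \<Rightarrow>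
   ('x, 'xm, 'a \<times> 'b \<times> 'cm,
     ('a \<times> 'b \<times> 'cm) \<times> ('a \<times> 'b \<times> 'cm) \<times> 'am \<times> 'bm) funct" where
  "comparison X C P Q F =
    (let ob = (\<lambda>x. (on_obj P x, on_obj Q x, Ident C (on_obj F (on_obj P x))))
     in \<lparr>on_obj = ob,
         on_arr = (\<lambda>f. (ob (Dom X f), ob (Cod X f), (on_arr P f, on_arr Q f)))\<rparr>)"

definition two_pullback_square ::
  "('x, 'xm) category \<Rightarrow> ('a, 'am) category \<Rightarrow> ('b, 'bm) category \<Rightarrow> ('c, 'cm) category \<Rightarrow>
   ('x, 'xm, 'a, 'am) funct \<Rightarrow> ('x, 'xm, 'b, 'bm) funct \<Rightarrow>
   ('a, 'am, 'c, 'cm) funct \<Rightarrow> ('b, 'bm, 'c, 'cm) funct \<Rightarrow> bool" where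
  "two_pullback_square X A B C P Q F G \<longleftrightarrow>
     is_functor X A P \<and> is_functor X B Q \<and> is_functor A C F \<and> is_functor B C G \<and>
     functor_eq X (comp_functor F P) (comp_functor G Q) \<and>
     is_equivalence X (two_pullback A B C F G) (comparison X C P Q F)"

section \<open>Simplicial groupoids\<close>

text \<open>\<open>Delta m n\<close> is the set of morphisms \<open>[m] \<rightarrow> [n]\<close> of the simplex category.\<close>

definition Delta :: "nat \<Rightarrow> nat \<Rightarrow> (nat \<Rightarrow> nat) set" where
  "Delta m n = {\<alpha> \<in> {..m} \<rightarrow>\<^sub>E {..n}. mono_on {..m} \<alpha>}"

text \<open>For \<open>\<alpha> \<in> Delta m n\<close>, \<open>act X m n \<alpha>\<close> is the induced functor \<open>cells X n \<rightarrow> cells X m\<close>.\<close>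

record ('o, 'm) simplicial =
  cells :: "nat \<Rightarrow> ('o, 'm) category"
  act :: "nat \<Rightarrow> nat \<Rightarrow> (nat \<Rightarrow> nat) \<Rightarrow> ('o, 'm, 'o, 'm) funct"

locale simplicial_groupoid =
  fixes X :: "('o, 'm) simplicial"
  assumes cells_groupoid: "groupoid (cells X n)"
    and act_functor: "\<alpha> \<in> Delta m n \<Longrightarrow> is_functor (cells X n) (cells X m) (act X m n \<alpha>)"
    and act_id: "functor_eq (cells X n) (act X n n (\<lambda>k\<in>{..n}. k)) id_functor"
    and act_comp: "\<alpha> \<in> Delta l m \<Longrightarrow> \<beta> \<in> Delta m n \<Longrightarrow>
      functor_eq (cells X n) (act X l n (compose {..l} \<beta> \<alpha>))
        (comp_functor (act X l m \<alpha>) (act X m n \<beta>))"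

text \<open>For a finite nonempty \<open>I\<close>, \<open>enum_set I\<close> restricts to the order isomorphism from
  \<open>[card I - 1]\<close> to \<open>I\<close>; for \<open>I \<subseteq> J\<close>, \<open>incl I J\<close> is the inclusion transported along these
  isomorphisms.\<close>

definition enum_set :: "nat set \<Rightarrow> nat \<Rightarrow> nat" where
  "enum_set I k = sorted_list_of_set I ! k"

definition incl :: "nat set \<Rightarrow> nat set \<Rightarrow> nat \<Rightarrow> nat" where
  "incl I J = (\<lambda>k \<in> {..card I - 1}. inv_into {..card J - 1} (enum_set J) (enum_set I k))"

definition cells_on :: "('o, 'm) simplicial \<Rightarrow> nat set \<Rightarrow> ('o, 'm) category" where
  "cells_on X I = cells X (card I - 1)"

definition res :: "('o, 'm) simplicial \<Rightarrow> nat set \<Rightarrow> nat set \<Rightarrow> ('o, 'm, 'o, 'm) funct" where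
  "res X J I = act X (card I - 1) (card J - 1) (incl I J)"

definition codegen :: "nat \<Rightarrow> nat \<Rightarrow> nat \<Rightarrow> nat" where
  "codegen n i = (\<lambda>k \<in> {..Suc n}. if k \<le> i then k else k - 1)"

text \<open>The degeneracy \<open>\<sigma>\<^sub>i : X\<^sub>n \<rightarrow> X\<^sub>n\<^sub>+\<^sub>1\<close>.\<close>

definition degeneracy :: "('o, 'm) simplicial \<Rightarrow> nat \<Rightarrow> nat \<Rightarrow> ('o, 'm, 'o, 'm) funct" where
  "degeneracy X n i = act X (Suc n) n (codegen n i)"

text \<open>In \<open>polygon\<close>, the conditions on \<open>i, j\<close> say that \<open>i < j\<close> are non-adjacent vertices of the
  polygon with cyclically ordered vertices \<open>0, \<dots>, n\<close>.\<close>

locale two_segal = simplicial_groupoid +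
  assumes polygon:
    "i + 2 \<le> j \<Longrightarrow> j \<le> n \<Longrightarrow> (i, j) \<noteq> (0, n) \<Longrightarrow>
      two_pullback_square
        (cells_on X {0..n}) (cells_on X ({0..i} \<union> {j..n})) (cells_on X {i..j}) (cells_on X {i, j})
        (res X {0..n} ({0..i} \<union> {j..n})) (res X {0..n} {i..j})
        (res X ({0..i} \<union> {j..n}) {i, j}) (res X {i..j} {i, j})"
    and unital:
    "i < n \<Longrightarrow>
      two_pullback_square
        (cells_on X {0..n - 1}) (cells_on X {0..n}) (cells_on X {i}) (cells_on X {i, i + 1})
        (degeneracy X (n - 1) i) (res X {0..n - 1} {i})
        (res X {0..n} {i, i + 1}) (degeneracy X 0 0)"

section \<open>Groupoids of flags\<close>

text \<open>A triangular diagram: \<open>hor A i j : ob A i j \<rightarrow> ob A i (j + 1)\<close> for \<open>i \<le> j < n\<close> and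
  \<open>ver A i j : ob A i j \<rightarrow> ob A (i + 1) j\<close> for \<open>i < j \<le> n\<close>.  Outside these ranges, and for
  \<open>ob\<close> outside \<open>i \<le> j \<le> n\<close>, the values are \<open>undefined\<close>, so that equality of
  records is equality of diagrams.\<close>

record ('o, 'm) triangle =
  ob :: "nat \<Rightarrow> nat \<Rightarrow> 'o"
  hor :: "nat \<Rightarrow> nat \<Rightarrow> 'm"
  ver :: "nat \<Rightarrow> nat \<Rightarrow> 'm"

definition flags :: "('o, 'm) category \<Rightarrow> 'o \<Rightarrow> nat \<Rightarrow> ('o, 'm) triangle set" where
  "flags C z n = {A.
     (\<forall>i j. i \<le> j \<and> j \<le> n \<longrightarrow> ob A i j \<in> Obj C) \<and>
     (\<forall>i \<le> n. ob A i i = z) \<and>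
     (\<forall>i j. i \<le> j \<and> j < n \<longrightarrow>
        hor A i j \<in> hom C (ob A i j) (ob A i (j + 1)) \<and> is_mono C (hor A i j)) \<and>
     (\<forall>i j. i < j \<and> j \<le> n \<longrightarrow>
        ver A i j \<in> hom C (ob A i j) (ob A (i + 1) j) \<and> is_epi C (ver A i j)) \<and>
     (\<forall>i j. i < j \<and> j < n \<longrightarrow>
        bicartesian C (hor A i j) (ver A i j) (ver A i (j + 1)) (hor A (i + 1) j)) \<and>
     (\<forall>i j. \<not> (i \<le> j \<and> j \<le> n) \<longrightarrow> ob A i j = undefined) \<and>
     (\<forall>i j. \<not> (i \<le> j \<and> j < n) \<longrightarrow> hor A i j = undefined) \<and>
     (\<forall>i j. \<not> (i < j \<and> j \<le> n) \<longrightarrow> ver A i j = undefined)}"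

type_synonym ('o, 'm) triangle_map =
  "('o, 'm) triangle \<times> ('o, 'm) triangle \<times> (nat \<Rightarrow> nat \<Rightarrow> 'm)"

text \<open>Families of morphisms indexed by \<open>i \<le> j \<le> n\<close>, again \<open>undefined\<close> elsewhere.\<close>

definition tri_fam :: "nat \<Rightarrow> (nat \<Rightarrow> nat \<Rightarrow> 'm) \<Rightarrow> nat \<Rightarrow> nat \<Rightarrow> 'm" where
  "tri_fam n f = (\<lambda>i j. if i \<le> j \<and> j \<le> n then f i j else undefined)"

definition flag_category ::
  "('o, 'm) category \<Rightarrow> 'o \<Rightarrow> nat \<Rightarrow> (('o, 'm) triangle, ('o, 'm) triangle_map) category" where
  "flag_category C z n =
    \<lparr>Obj = flags C z n,
     Arr = {(A, B, f). A \<in> flags C z n \<and> B \<in> flags C z n \<and>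
              (\<forall>i j. i \<le> j \<and> j \<le> n \<longrightarrow> f i j \<in> hom C (ob A i j) (ob B i j)) \<and>
              (\<forall>i j. i \<le> j \<and> j < n \<longrightarrow> hor B i j \<cdot>\<^bsub>C\<^esub> f i j = f i (j + 1) \<cdot>\<^bsub>C\<^esub> hor A i j) \<and>
              (\<forall>i j. i < j \<and> j \<le> n \<longrightarrow> ver B i j \<cdot>\<^bsub>C\<^esub> f i j = f (i + 1) j \<cdot>\<^bsub>C\<^esub> ver A i j) \<and>
              (\<forall>i j. \<not> (i \<le> j \<and> j \<le> n) \<longrightarrow> f i j = undefined)},
     Dom = (\<lambda>(A, B, f). A),
     Cod = (\<lambda>(A, B, f). B),
     Ident = (\<lambda>A. (A, A, tri_fam n (\<lambda>i j. Ident C (ob A i j)))),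
     Comp = (\<lambda>(B', D, g) (A, B, f). (A, D, tri_fam n (\<lambda>i j. g i j \<cdot>\<^bsub>C\<^esub> f i j)))\<rparr>"

text \<open>The composites \<open>A\<^sub>i\<^sub>,\<^sub>j \<rightarrow> A\<^sub>i\<^sub>,\<^sub>j\<^sub>+\<^sub>d\<close> and \<open>A\<^sub>i\<^sub>,\<^sub>j \<rightarrow> A\<^sub>i\<^sub>+\<^sub>d\<^sub>,\<^sub>j\<close>.\<close>

primrec hor_path ::
  "('o, 'm) category \<Rightarrow> ('o, 'm) triangle \<Rightarrow> nat \<Rightarrow> nat \<Rightarrow> nat \<Rightarrow> 'm" where
  "hor_path C A i j 0 = Ident C (ob A i j)"
| "hor_path C A i j (Suc d) = hor A i (j + d) \<cdot>\<^bsub>C\<^esub> hor_path C A i j d"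

primrec ver_path ::
  "('o, 'm) category \<Rightarrow> ('o, 'm) triangle \<Rightarrow> nat \<Rightarrow> nat \<Rightarrow> nat \<Rightarrow> 'm" where
  "ver_path C A i j 0 = Ident C (ob A i j)"
| "ver_path C A i j (Suc d) = ver A (i + d) j \<cdot>\<^bsub>C\<^esub> ver_path C A i j d"

text \<open>The diagram \<open>(i, j) \<mapsto> A\<^sub>\<alpha>\<^sub>(\<^sub>i\<^sub>)\<^sub>,\<^sub>\<alpha>\<^sub>(\<^sub>j\<^sub>)\<close> for \<open>\<alpha> : [m] \<rightarrow> [n]\<close>.  For \<open>\<alpha>\<close> the injection
  omitting \<open>k\<close>, this omits the \<open>k\<close>-th row and column and composes the remaining morphisms; for
  \<open>\<alpha>\<close> the surjection hitting \<open>k\<close> twice, it repeats the \<open>k\<close>-th row and column, with identities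
  in between.  The lemmas \<open>hor_coface\<close> to \<open>ver_codegen\<close> below spell this out.\<close>

definition tri_pull ::
  "('o, 'm) category \<Rightarrow> nat \<Rightarrow> (nat \<Rightarrow> nat) \<Rightarrow> ('o, 'm) triangle \<Rightarrow> ('o, 'm) triangle" where
  "tri_pull C m \<alpha> A =
    \<lparr>ob = (\<lambda>i j. if i \<le> j \<and> j \<le> m then ob A (\<alpha> i) (\<alpha> j) else undefined),
     hor = (\<lambda>i j. if i \<le> j \<and> j < m
              then hor_path C A (\<alpha> i) (\<alpha> j) (\<alpha> (j + 1) - \<alpha> j) else undefined),
     ver = (\<lambda>i j. if i < j \<and> j \<le> m
              then ver_path C A (\<alpha> i) (\<alpha> j) (\<alpha> (i + 1) - \<alpha> i) else undefined)\<rparr>"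

definition flag_pull ::
  "('o, 'm) category \<Rightarrow> nat \<Rightarrow> (nat \<Rightarrow> nat) \<Rightarrow>
   (('o, 'm) triangle, ('o, 'm) triangle_map, ('o, 'm) triangle, ('o, 'm) triangle_map) funct" where
  "flag_pull C m \<alpha> =
    \<lparr>on_obj = tri_pull C m \<alpha>,
     on_arr = (\<lambda>(A, B, f).
       (tri_pull C m \<alpha> A, tri_pull C m \<alpha> B, tri_fam m (\<lambda>i j. f (\<alpha> i) (\<alpha> j))))\<rparr>"

definition flag_simplicial ::
  "('o, 'm) category \<Rightarrow> 'o \<Rightarrow> (('o, 'm) triangle, ('o, 'm) triangle_map) simplicial" where
  "flag_simplicial C z =
    \<lparr>cells = (\<lambda>n. core (flag_category C z n)),
     act = (\<lambda>m n \<alpha>. flag_pull C m \<alpha>)\<rparr>"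

definition coface :: "nat \<Rightarrow> nat \<Rightarrow> nat \<Rightarrow> nat" where
  "coface n k = (\<lambda>i \<in> {..n}. if i < k then i else i + 1)"

context category
begin

lemma hor_coface:
  assumes "A \<in> flags C z (Suc n)" "k \<le> Suc n" "i \<le> j" "j < n"
  defines "i' \<equiv> coface n k i"
  shows "hor (tri_pull C n (coface n k) A) i j =
    (if j + 1 < k then hor A i' j
     else if j + 1 = k then hor A i' (j + 1) \<cdot> hor A i' j
     else hor A i' (j + 1))"
proof -
  have h: "hor A p q \<in> hom C (ob A p q) (ob A p (Suc q))" if "p \<le> q" "q < Suc n" for p q
    using assms(1) that by (auto simp: flags_def)
  have *: "hor A p q \<cdot> Ident C (ob A p q) = hor A p q" if "p \<le> q" "q < Suc n" for p q
    using Ident_right h that by blast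
  show ?thesis
    using assms(2-4) by (auto simp: i'_def tri_pull_def coface_def numeral_2_eq_2 *)
qed

lemma ver_coface:
  assumes "A \<in> flags C z (Suc n)" "k \<le> Suc n" "i < j" "j \<le> n"
  defines "j' \<equiv> coface n k j"
  shows "ver (tri_pull C n (coface n k) A) i j =
    (if i + 1 < k then ver A i j'
     else if i + 1 = k then ver A (i + 1) j' \<cdot> ver A i j'
     else ver A (i + 1) j')"
proof -
  have v: "ver A p q \<in> hom C (ob A p q) (ob A (Suc p) q)" if "p < q" "q \<le> Suc n" for p q
    using assms(1) that by (auto simp: flags_def)
  have *: "ver A p q \<cdot> Ident C (ob A p q) = ver A p q" if "p < q" "q \<le> Suc n" for p q
    using Ident_right v that by blast
  show ?thesis
    using assms(2-4) by (auto simp: j'_def tri_pull_def coface_def numeral_2_eq_2 *)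
qed

lemma hor_codegen:
  assumes "A \<in> flags C z n" "k \<le> n" "i \<le> j" "j < Suc n"
  defines "i' \<equiv> codegen n k i"
  shows "hor (tri_pull C (Suc n) (codegen n k) A) i j =
    (if j < k then hor A i' j else if j = k then Ident C (ob A i' j) else hor A i' (j - 1))"
proof -
  have h: "hor A p q \<in> hom C (ob A p q) (ob A p (Suc q))" if "p \<le> q" "q < n" for p q
    using assms(1) that by (auto simp: flags_def)
  have *: "hor A p q \<cdot> Ident C (ob A p q) = hor A p q" if "p \<le> q" "q < n" for p q
    using Ident_right h that by blast
  have **: "j - (j - Suc 0) = Suc 0" if "j > k"
    using that by simp
  show ?thesis
    using assms(2-4) by (auto simp: i'_def tri_pull_def codegen_def * **)
qed

lemma ver_codegen:
  assumes "A \<in> flags C z n" "k \<le> n" "i < j" "j \<le> Suc n"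
  defines "j' \<equiv> codegen n k j"
  shows "ver (tri_pull C (Suc n) (codegen n k) A) i j =
    (if i < k then ver A i j' else if i = k then Ident C (ob A i j') else ver A (i - 1) j')"
proof -
  have v: "ver A p q \<in> hom C (ob A p q) (ob A (Suc p) q)" if "p < q" "q \<le> n" for p q
    using assms(1) that by (auto simp: flags_def)
  have *: "ver A p q \<cdot> Ident C (ob A p q) = ver A p q" if "p < q" "q \<le> n" for p q
    using Ident_right v that by blast
  have **: "i - (i - Suc 0) = Suc 0" if "i > k"
    using that by simp
  show ?thesis
    using assms(2-4) by (auto simp: j'_def tri_pull_def codegen_def * **)
qed

end

end

theory Submission
  imports Defs
begin

text \<open>
  A flag is a functor on the poset of pairs \<open>i \<le> j \<le> n\<close> under which all rectangles are bicartesian.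
  Such a functor is determined by its largest object \<open>A\<^sub>0\<^sub>,\<^sub>n\<close> with the filtration by the monomorphisms
  \<open>A\<^sub>0\<^sub>,\<^sub>k \<hookrightarrow> A\<^sub>0\<^sub>,\<^sub>n\<close>: the object \<open>A\<^sub>i\<^sub>,\<^sub>j\<close> is the pushout of \<open>0 \<twoheadleftarrow> A\<^sub>0\<^sub>,\<^sub>i \<hookrightarrow> A\<^sub>0\<^sub>,\<^sub>j\<close>, every
  filtration starting at \<open>0\<close> arises, and maps of flags are the maps of largest objects that respect
  the filtrations.  Cutting the polygon along \<open>i < j\<close> forgets the steps \<open>A\<^sub>0\<^sub>,\<^sub>k\<close> with \<open>i < k < j\<close>,
  which are recovered as the pullbacks of \<open>A\<^sub>i\<^sub>,\<^sub>k \<hookrightarrow> A\<^sub>i\<^sub>,\<^sub>j \<twoheadleftarrow> A\<^sub>0\<^sub>,\<^sub>j\<close>.  In the unital squares the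
  object \<open>A\<^sub>i\<^sub>,\<^sub>i\<^sub>+\<^sub>1\<close> vanishes up to isomorphism, so \<open>A\<^sub>0\<^sub>,\<^sub>i \<hookrightarrow> A\<^sub>0\<^sub>,\<^sub>i\<^sub>+\<^sub>1\<close> is invertible and the flag is
  degenerate.
\<close>

text \<open>There is no additive structure, and universal properties are available only for squares
  with monomorphisms in one direction and epimorphisms in the other. In such squares induced maps
  are automatically unique: maps out of the last corner are tested on an epimorphism, maps into the
  first one on a monomorphism. Axiom (3) allows one half of the bicartesian property to be checked
  and both to be used: quotients and maps out of them come from pushouts, preimages and maps into
  them from pullbacks. The delicate point in passing from filtrations to flags is that a quotient
  \<open>X l / X k\<close> embeds in \<open>X l' / X k\<close>; this rests on an auxiliary pushout.
  The other obstacle is strictness. A flag has the chosen zero object itself on its diagonal, and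
  its top row has to be the given filtration on the nose, while pushouts and pullbacks exist only up
  to isomorphism. So the chosen quotients and preimages are prescribed in their boundary cases. A
  genuine isomorphism enters in essential surjectivity, where the two flags to be glued agree on
  their common edge only up to a given isomorphism.\<close>

section \<open>Bicartesian squares\<close>

context category
begin

section \<open>Cancellation and composition of monomorphisms, epimorphisms and isomorphisms\<close>

lemma hom_obj: "f \<in> hom C a b \<Longrightarrow> a \<in> Obj C" "f \<in> hom C a b \<Longrightarrow> b \<in> Obj C"
  by (auto simp: hom_def)

lemma mono_cancel:
  "is_mono C f \<Longrightarrow> f \<in> hom C a b \<Longrightarrow> g \<in> hom C x a \<Longrightarrow> h \<in> hom C x a \<Longrightarrow> f \<cdot> g = f \<cdot> h \<Longrightarrow> g = h"
  by (auto simp: is_mono_def hom_def)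

lemma epi_cancel:
  "is_epi C f \<Longrightarrow> f \<in> hom C a b \<Longrightarrow> g \<in> hom C b x \<Longrightarrow> h \<in> hom C b x \<Longrightarrow> g \<cdot> f = h \<cdot> f \<Longrightarrow> g = h"
  by (auto simp: is_epi_def hom_def)

lemma monoI:
  assumes "f \<in> hom C a b"
    and "\<And>x g h. g \<in> hom C x a \<Longrightarrow> h \<in> hom C x a \<Longrightarrow> f \<cdot> g = f \<cdot> h \<Longrightarrow> g = h"
  shows "is_mono C f"
  using assms by (auto simp: is_mono_def hom_def)

lemma epiI:
  assumes "f \<in> hom C a b"
    and "\<And>x g h. g \<in> hom C b x \<Longrightarrow> h \<in> hom C b x \<Longrightarrow> g \<cdot> f = h \<cdot> f \<Longrightarrow> g = h"
  shows "is_epi C f"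
  using assms by (auto simp: is_epi_def hom_def)

lemma mono_comp:
  assumes "is_mono C f" "is_mono C g" "f \<in> hom C a b" "g \<in> hom C b c"
  shows "is_mono C (g \<cdot> f)"
proof (rule monoI)
  show "g \<cdot> f \<in> hom C a c" using assms Comp_in by blast
  fix x u v assume uv: "u \<in> hom C x a" "v \<in> hom C x a" and "(g \<cdot> f) \<cdot> u = (g \<cdot> f) \<cdot> v"
  then have "g \<cdot> (f \<cdot> u) = g \<cdot> (f \<cdot> v)" using assms Comp_assoc by metis
  then have "f \<cdot> u = f \<cdot> v" using mono_cancel assms uv Comp_in by meson
  then show "u = v" using mono_cancel assms uv by meson
qed

lemma epi_comp:
  assumes "is_epi C f" "is_epi C g" "f \<in> hom C a b" "g \<in> hom C b c"
  shows "is_epi C (g \<cdot> f)"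
proof (rule epiI)
  show "g \<cdot> f \<in> hom C a c" using assms Comp_in by blast
  fix x u v assume uv: "u \<in> hom C c x" "v \<in> hom C c x" and "u \<cdot> (g \<cdot> f) = v \<cdot> (g \<cdot> f)"
  then have "(u \<cdot> g) \<cdot> f = (v \<cdot> g) \<cdot> f" using assms Comp_assoc by metis
  then have "u \<cdot> g = v \<cdot> g" using epi_cancel assms uv Comp_in by meson
  then show "u = v" using epi_cancel assms uv by meson
qed

lemma mono_of_comp:
  assumes "is_mono C (g \<cdot> f)" "f \<in> hom C a b" "g \<in> hom C b c"
  shows "is_mono C f"
proof (rule monoI)
  show "f \<in> hom C a b" by fact
  fix x u v assume uv: "u \<in> hom C x a" "v \<in> hom C x a" and "f \<cdot> u = f \<cdot> v"
  then have "(g \<cdot> f) \<cdot> u = (g \<cdot> f) \<cdot> v" using assms Comp_assoc by metis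
  then show "u = v" using mono_cancel assms uv Comp_in by meson
qed

lemma epi_of_comp:
  assumes "is_epi C (g \<cdot> f)" "f \<in> hom C a b" "g \<in> hom C b c"
  shows "is_epi C g"
proof (rule epiI)
  show "g \<in> hom C b c" by fact
  fix x u v assume uv: "u \<in> hom C c x" "v \<in> hom C c x" and "u \<cdot> g = v \<cdot> g"
  then have "u \<cdot> (g \<cdot> f) = v \<cdot> (g \<cdot> f)"
    using Comp_assoc[OF assms(2,3) uv(1)] Comp_assoc[OF assms(2,3) uv(2)] by simp
  then show "u = v" using epi_cancel assms uv Comp_in by meson
qed

lemma mono_Ident: "a \<in> Obj C \<Longrightarrow> is_mono C (Ident C a)"
  by (rule monoI[OF Ident_in]) (auto simp: Ident_left)

lemma epi_Ident: "a \<in> Obj C \<Longrightarrow> is_epi C (Ident C a)"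
  by (rule epiI[OF Ident_in]) (auto simp: Ident_right)

lemma is_iso_iff:
  assumes "f \<in> hom C a b"
  shows "is_iso C f \<longleftrightarrow> (\<exists>g \<in> hom C b a. g \<cdot> f = Ident C a \<and> f \<cdot> g = Ident C b)"
  using assms by (auto simp: is_iso_def hom_def)

lemma iso_mono: assumes "is_iso C f" "f \<in> hom C a b" shows "is_mono C f"
proof -
  obtain g where "g \<in> hom C b a" "g \<cdot> f = Ident C a" using assms is_iso_iff by blast
  then show ?thesis using mono_of_comp mono_Ident hom_obj(1) assms(2) by metis
qed

lemma iso_epi: assumes "is_iso C f" "f \<in> hom C a b" shows "is_epi C f"
proof -
  obtain g where "g \<in> hom C b a" "f \<cdot> g = Ident C b" using assms is_iso_iff by blast
  then show ?thesis using epi_of_comp epi_Ident hom_obj(2) assms(2) by metis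
qed

lemma iso_Ident: "a \<in> Obj C \<Longrightarrow> is_iso C (Ident C a)"
  using is_iso_iff[OF Ident_in] Ident_in Ident_left by blast

lemma iso_comp:
  assumes f: "is_iso C f" "f \<in> hom C a b" and g: "is_iso C g" "g \<in> hom C b c"
  shows "is_iso C (g \<cdot> f)"
proof -
  obtain f' where f': "f' \<in> hom C b a" "f' \<cdot> f = Ident C a" "f \<cdot> f' = Ident C b"
    using f is_iso_iff by blast
  obtain g' where g': "g' \<in> hom C c b" "g' \<cdot> g = Ident C b" "g \<cdot> g' = Ident C c"
    using g is_iso_iff by blast
  have gf: "g \<cdot> f \<in> hom C a c" using f g Comp_in by blast
  have "(f' \<cdot> g') \<cdot> (g \<cdot> f) = f' \<cdot> ((g' \<cdot> g) \<cdot> f)"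
    using Comp_assoc[OF gf g'(1) f'(1)] Comp_assoc[OF f(2) g(2) g'(1)] by simp
  moreover have "(g \<cdot> f) \<cdot> (f' \<cdot> g') = g \<cdot> ((f \<cdot> f') \<cdot> g')"
    using Comp_assoc[OF Comp_in[OF g'(1) f'(1)] f(2) g(2)] Comp_assoc[OF g'(1) f'(1) f(2)] by simp
  ultimately show ?thesis
    using is_iso_iff[OF gf] f' g' f g Ident_left Comp_in by metis
qed

section \<open>Squares with prescribed corners\<close>

lemma comm_square_iff:
  assumes "f \<in> hom C a b" "g \<in> hom C a c"
  shows "comm_square C f g h k \<longleftrightarrow> (\<exists>d. h \<in> hom C b d \<and> k \<in> hom C c d \<and> h \<cdot> f = k \<cdot> g)"
  using assms by (auto simp: comm_square_def hom_def)

lemma comm_square_iff':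
  assumes "h \<in> hom C b d" "k \<in> hom C c d"
  shows "comm_square C f g h k \<longleftrightarrow> (\<exists>a. f \<in> hom C a b \<and> g \<in> hom C a c \<and> h \<cdot> f = k \<cdot> g)"
  using assms by (auto simp: comm_square_def hom_def)

lemma pushout_square_iff:
  assumes "f \<in> hom C a b" "g \<in> hom C a c" "h \<in> hom C b d" "k \<in> hom C c d"
  shows "pushout_square C f g h k \<longleftrightarrow> h \<cdot> f = k \<cdot> g \<and>
    (\<forall>x u v. u \<in> hom C b x \<longrightarrow> v \<in> hom C c x \<longrightarrow> u \<cdot> f = v \<cdot> g \<longrightarrow>
      (\<exists>!w. w \<in> hom C d x \<and> w \<cdot> h = u \<and> w \<cdot> k = v))"
proof -
  have cs: "comm_square C f g h k \<longleftrightarrow> h \<cdot> f = k \<cdot> g"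
    using assms by (auto simp: comm_square_def hom_def)
  have dom: "Cod C h = d" using assms by (simp add: hom_def)
  \<comment> \<open>Proved for arbitrary \<open>Q\<close>, so that the change of quantifiers leaves
    the unique existence inside untouched.\<close>
  have "(\<forall>u v. comm_square C f g u v \<longrightarrow> Q u v (Cod C u)) \<longleftrightarrow>
      (\<forall>x u v. u \<in> hom C b x \<longrightarrow> v \<in> hom C c x \<longrightarrow> u \<cdot> f = v \<cdot> g \<longrightarrow> Q u v x)" for Q
    unfolding comm_square_iff[OF assms(1,2)] by (auto simp: hom_def)
  from this[of "\<lambda>u v x. \<exists>!w. w \<in> hom C d x \<and> w \<cdot> h = u \<and> w \<cdot> k = v"]
  show ?thesis
    unfolding pushout_square_def using cs dom by simp
qed

lemma pullback_square_iff:
  assumes "f \<in> hom C a b" "g \<in> hom C a c" "h \<in> hom C b d" "k \<in> hom C c d"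
  shows "pullback_square C f g h k \<longleftrightarrow> h \<cdot> f = k \<cdot> g \<and>
    (\<forall>x u v. u \<in> hom C x b \<longrightarrow> v \<in> hom C x c \<longrightarrow> h \<cdot> u = k \<cdot> v \<longrightarrow>
      (\<exists>!w. w \<in> hom C x a \<and> f \<cdot> w = u \<and> g \<cdot> w = v))"
proof -
  have cs: "comm_square C f g h k \<longleftrightarrow> h \<cdot> f = k \<cdot> g"
    using assms by (auto simp: comm_square_def hom_def)
  have dom: "Dom C f = a" using assms by (simp add: hom_def)
  have "(\<forall>u v. comm_square C u v h k \<longrightarrow> Q u v (Dom C u)) \<longleftrightarrow>
      (\<forall>x u v. u \<in> hom C x b \<longrightarrow> v \<in> hom C x c \<longrightarrow> h \<cdot> u = k \<cdot> v \<longrightarrow> Q u v x)" for Q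
    unfolding comm_square_iff'[OF assms(3,4)] by (auto simp: hom_def)
  from this[of "\<lambda>u v x. \<exists>!w. w \<in> hom C x a \<and> f \<cdot> w = u \<and> g \<cdot> w = v"]
  show ?thesis
    unfolding pullback_square_def using cs dom by simp
qed

text \<open>Two commuting squares glued along \<open>h\<close>. The same rule serves for rows, for
  columns (after swapping the roles of the sides) and for naturality squares.\<close>

lemma comm_paste:
  assumes "f \<in> hom C a b" "f' \<in> hom C b b'" "g \<in> hom C a c" "h \<in> hom C b d" "h' \<in> hom C b' d'"
    and "k \<in> hom C c d" "k' \<in> hom C d d'"
    and "h \<cdot> f = k \<cdot> g" "h' \<cdot> f' = k' \<cdot> h"
  shows "h' \<cdot> f' \<cdot> f = (k' \<cdot> k) \<cdot> g"
  using Comp_assoc[OF assms(1,2,5)] Comp_assoc[OF assms(1,4,7)] Comp_assoc[OF assms(3,6,7)] assms(8,9)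
  by metis

text \<open>The corners are arguments, so that pasting rules match common corners by unification and
  every side comes with its hom set.\<close>

definition bic ::
  "'o \<Rightarrow> 'o \<Rightarrow> 'o \<Rightarrow> 'o \<Rightarrow> 'm \<Rightarrow> 'm \<Rightarrow> 'm \<Rightarrow> 'm \<Rightarrow> bool" where
  "bic a b c d f g h k \<longleftrightarrow>
    f \<in> hom C a b \<and> g \<in> hom C a c \<and> h \<in> hom C b d \<and> k \<in> hom C c d \<and> bicartesian C f g h k"

lemma bic_hom:
  assumes "bic a b c d f g h k"
  shows "f \<in> hom C a b" "g \<in> hom C a c" "h \<in> hom C b d" "k \<in> hom C c d"
    and "is_mono C f" "is_epi C g" "is_epi C h" "is_mono C k" "h \<cdot> f = k \<cdot> g"
  using assms by (auto simp: bic_def bicartesian_def pushout_square_def comm_square_def)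

lemma bic_push:
  assumes "bic a b c d f g h k" "u \<in> hom C b x" "v \<in> hom C c x" "u \<cdot> f = v \<cdot> g"
  obtains w where "w \<in> hom C d x" "w \<cdot> h = u" "w \<cdot> k = v"
proof -
  have "pushout_square C f g h k" using assms(1) by (auto simp: bic_def bicartesian_def)
  then show ?thesis
    using that assms(2-4) pushout_square_iff[OF bic_hom(1-4)[OF assms(1)]] by blast
qed

lemma bic_pull:
  assumes "bic a b c d f g h k" "u \<in> hom C x b" "v \<in> hom C x c" "h \<cdot> u = k \<cdot> v"
  obtains w where "w \<in> hom C x a" "f \<cdot> w = u" "g \<cdot> w = v"
proof -
  have "pullback_square C f g h k" using assms(1) by (auto simp: bic_def bicartesian_def)
  then show ?thesis
    using that assms(2-4) pullback_square_iff[OF bic_hom(1-4)[OF assms(1)]] by blast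
qed

end

section \<open>Bicartesian squares in a proto-abelian category\<close>

context proto_abelian
begin

text \<open>Existence of induced maps suffices: they are unique because \<open>h\<close> is an
  epimorphism, and the pullback half is supplied by \<open>pushout_iff_pullback\<close>. The next
  lemma is the dual, with \<open>f\<close> as the monomorphism that gives uniqueness.\<close>

lemma bic_pushI:
  assumes hom: "f \<in> hom C a b" "g \<in> hom C a c" "h \<in> hom C b d" "k \<in> hom C c d"
    and me: "is_mono C f" "is_epi C g" "is_epi C h" "is_mono C k"
    and comm: "h \<cdot> f = k \<cdot> g"
    and push: "\<And>x u v. u \<in> hom C b x \<Longrightarrow> v \<in> hom C c x \<Longrightarrow> u \<cdot> f = v \<cdot> g \<Longrightarrow>
      \<exists>w \<in> hom C d x. w \<cdot> h = u \<and> w \<cdot> k = v"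
  shows "bic a b c d f g h k"
proof -
  have "pushout_square C f g h k"
    unfolding pushout_square_iff[OF hom]
  proof (intro conjI allI impI comm)
    fix x u v assume "u \<in> hom C b x" "v \<in> hom C c x" "u \<cdot> f = v \<cdot> g"
    then obtain w where w: "w \<in> hom C d x" "w \<cdot> h = u" "w \<cdot> k = v" using push by blast
    then show "\<exists>!w. w \<in> hom C d x \<and> w \<cdot> h = u \<and> w \<cdot> k = v"
      using epi_cancel[OF me(3) hom(3)] by (intro ex1I[of _ w]) auto
  qed
  moreover have "comm_square C f g h k" using hom comm by (auto simp: comm_square_def hom_def)
  ultimately show ?thesis
    using hom me pushout_iff_pullback by (auto simp: bic_def bicartesian_def)
qed

lemma bic_pullI:
  assumes hom: "f \<in> hom C a b" "g \<in> hom C a c" "h \<in> hom C b d" "k \<in> hom C c d"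
    and me: "is_mono C f" "is_epi C g" "is_epi C h" "is_mono C k"
    and comm: "h \<cdot> f = k \<cdot> g"
    and pull: "\<And>x u v. u \<in> hom C x b \<Longrightarrow> v \<in> hom C x c \<Longrightarrow> h \<cdot> u = k \<cdot> v \<Longrightarrow>
      \<exists>w \<in> hom C x a. f \<cdot> w = u \<and> g \<cdot> w = v"
  shows "bic a b c d f g h k"
proof -
  have "pullback_square C f g h k"
    unfolding pullback_square_iff[OF hom]
  proof (intro conjI allI impI comm)
    fix x u v assume "u \<in> hom C x b" "v \<in> hom C x c" "h \<cdot> u = k \<cdot> v"
    then obtain w where w: "w \<in> hom C x a" "f \<cdot> w = u" "g \<cdot> w = v" using pull by blast
    then show "\<exists>!w. w \<in> hom C x a \<and> f \<cdot> w = u \<and> g \<cdot> w = v"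
      using mono_cancel[OF me(1) hom(1)] by (intro ex1I[of _ w]) auto
  qed
  moreover have "comm_square C f g h k" using hom comm by (auto simp: comm_square_def hom_def)
  ultimately show ?thesis
    using hom me pushout_iff_pullback by (auto simp: bic_def bicartesian_def)
qed

lemma bic_pushout_exists:
  assumes "f \<in> hom C a b" "g \<in> hom C a c" "is_mono C f" "is_epi C g"
  obtains d h k where "bic a b c d f g h k"
proof -
  obtain h k where *: "is_epi C h" "is_mono C k" "pushout_square C f g h k"
    using pushout_exists assms by (metis (mono_tags, lifting) hom_def mem_Collect_eq)
  then have cs: "comm_square C f g h k" by (simp add: pushout_square_def)
  then have "bic a b c (Cod C h) f g h k"
    using assms * pushout_iff_pullback[OF cs]
    by (auto simp: bic_def bicartesian_def comm_square_def hom_def)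
  then show ?thesis using that by blast
qed

lemma bic_pullback_exists:
  assumes "h \<in> hom C b d" "k \<in> hom C c d" "is_epi C h" "is_mono C k"
  obtains a f g where "bic a b c d f g h k"
proof -
  obtain f g where *: "is_mono C f" "is_epi C g" "pullback_square C f g h k"
    using pullback_exists assms by (metis (mono_tags, lifting) hom_def mem_Collect_eq)
  then have cs: "comm_square C f g h k" by (simp add: pullback_square_def)
  then have "bic (Dom C f) b c d f g h k"
    using assms * pushout_iff_pullback[OF cs]
    by (auto simp: bic_def bicartesian_def comm_square_def hom_def)
  then show ?thesis using that by blast
qed

lemma bic_id_hor:
  assumes "g \<in> hom C a c" "is_epi C g"
  shows "bic a a c c (Ident C a) g g (Ident C c)"
proof -
  have o: "a \<in> Obj C" "c \<in> Obj C" using assms hom_obj by auto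
  show ?thesis
    by (rule bic_pushI)
      (use o assms Ident_in mono_Ident Ident_right Ident_left in auto)
qed

lemma bic_id_ver:
  assumes "f \<in> hom C a b" "is_mono C f"
  shows "bic a b a b f (Ident C a) (Ident C b) f"
proof -
  have o: "a \<in> Obj C" "b \<in> Obj C" using assms hom_obj by auto
  show ?thesis
    by (rule bic_pushI)
      (use o assms Ident_in epi_Ident Ident_right Ident_left in auto)
qed

section \<open>Pasting and cancelling bicartesian squares\<close>

lemma bic_paste_hor:
  assumes 1: "bic a b c d f g h k" and 2: "bic b b' d d' f' h h' k'"
  shows "bic a b' c d' (f' \<cdot> f) g h' (k' \<cdot> k)"
proof (rule bic_pushI)
  note t = bic_hom[OF 1] bic_hom[OF 2]
  show "f' \<cdot> f \<in> hom C a b'" "k' \<cdot> k \<in> hom C c d'" using t Comp_in by blast+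
  show "g \<in> hom C a c" "h' \<in> hom C b' d'" "is_epi C g" "is_epi C h'" using t by auto
  show "is_mono C (f' \<cdot> f)" "is_mono C (k' \<cdot> k)" using t mono_comp by blast+
  show "h' \<cdot> f' \<cdot> f = (k' \<cdot> k) \<cdot> g"
    using comm_paste[OF t(1) t(10) t(2) t(3) t(12) t(4) t(13) t(9) t(18)] .
  fix x u v assume u: "u \<in> hom C b' x" and v: "v \<in> hom C c x" and "u \<cdot> f' \<cdot> f = v \<cdot> g"
  then have "(u \<cdot> f') \<cdot> f = v \<cdot> g" using t Comp_assoc by metis
  then obtain w1 where w1: "w1 \<in> hom C d x" "w1 \<cdot> h = u \<cdot> f'" "w1 \<cdot> k = v"
    using bic_push[OF 1 _ v] u t Comp_in by metis
  obtain w2 where w2: "w2 \<in> hom C d' x" "w2 \<cdot> h' = u" "w2 \<cdot> k' = w1"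
    using bic_push[OF 2 u w1(1)] w1 by metis
  then have "w2 \<cdot> k' \<cdot> k = v" using w1 t Comp_assoc by metis
  with w2 show "\<exists>w \<in> hom C d' x. w \<cdot> h' = u \<and> w \<cdot> k' \<cdot> k = v" by blast
qed

lemma bic_paste_ver:
  assumes 1: "bic a b c d f g h k" and 2: "bic c d c' d' k g' h' k'"
  shows "bic a b c' d' f (g' \<cdot> g) (h' \<cdot> h) k'"
proof (rule bic_pushI)
  note t = bic_hom[OF 1] bic_hom[OF 2]
  show "g' \<cdot> g \<in> hom C a c'" "h' \<cdot> h \<in> hom C b d'" using t Comp_in by blast+
  show "f \<in> hom C a b" "k' \<in> hom C c' d'" "is_mono C f" "is_mono C k'" using t by auto
  show "is_epi C (g' \<cdot> g)" "is_epi C (h' \<cdot> h)" using t epi_comp by blast+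
  show "(h' \<cdot> h) \<cdot> f = k' \<cdot> g' \<cdot> g"
    using comm_paste[OF t(2) t(11) t(1) t(4) t(13) t(3) t(12) t(9)[symmetric] t(18)[symmetric]] by simp
  fix x u v assume u: "u \<in> hom C b x" and v: "v \<in> hom C c' x" and "u \<cdot> f = v \<cdot> g' \<cdot> g"
  then have "u \<cdot> f = (v \<cdot> g') \<cdot> g" using t Comp_assoc by metis
  then obtain w1 where w1: "w1 \<in> hom C d x" "w1 \<cdot> h = u" "w1 \<cdot> k = v \<cdot> g'"
    using bic_push[OF 1 u] v t Comp_in by metis
  obtain w2 where w2: "w2 \<in> hom C d' x" "w2 \<cdot> h' = w1" "w2 \<cdot> k' = v"
    using bic_push[OF 2 w1(1) v] w1 by metis
  then have "w2 \<cdot> h' \<cdot> h = u" using w1 t Comp_assoc by metis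
  with w2 show "\<exists>w \<in> hom C d' x. w \<cdot> h' \<cdot> h = u \<and> w \<cdot> k' = v" by blast
qed

text \<open>A cocone \<open>u\<close>, \<open>v\<close> on the lower square gives the cocone
  \<open>u \<cdot> h\<close>, \<open>v\<close> on the rectangle. The map \<open>w\<close> induced by
  it satisfies \<open>w \<cdot> h' = u\<close> because both sides agree after the epimorphism
  \<open>h\<close>.\<close>

lemma bic_cancel_top:
  assumes 1: "bic a b c d f g h k" and 2: "bic a b c' d' f (g' \<cdot> g) (h' \<cdot> h) k'"
    and g': "g' \<in> hom C c c'" "is_epi C g'" and h': "h' \<in> hom C d d'" "is_epi C h'"
    and comm: "h' \<cdot> k = k' \<cdot> g'"
  shows "bic c d c' d' k g' h' k'"
proof (rule bic_pushI)
  note t = bic_hom[OF 1] bic_hom[OF 2]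
  show "k \<in> hom C c d" "k' \<in> hom C c' d'" "is_mono C k" "is_mono C k'" using t by auto
  show "g' \<in> hom C c c'" "h' \<in> hom C d d'" "is_epi C g'" "is_epi C h'" "h' \<cdot> k = k' \<cdot> g'" by fact+
  fix x u v assume u: "u \<in> hom C d x" and v: "v \<in> hom C c' x" and eq: "u \<cdot> k = v \<cdot> g'"
  have "(u \<cdot> h) \<cdot> f = (u \<cdot> k) \<cdot> g" using t u Comp_assoc by metis
  also have "\<dots> = v \<cdot> g' \<cdot> g" using eq t g' v Comp_assoc by metis
  finally obtain w where w: "w \<in> hom C d' x" "w \<cdot> h' \<cdot> h = u \<cdot> h" "w \<cdot> k' = v"
    using bic_push[OF 2 _ v] u t Comp_in by metis
  then have "(w \<cdot> h') \<cdot> h = u \<cdot> h" using Comp_assoc[OF t(3) h'(1) w(1)] by simp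
  then have "w \<cdot> h' = u" using epi_cancel[OF t(7) t(3) Comp_in[OF h'(1) w(1)] u] by simp
  with w show "\<exists>w \<in> hom C d' x. w \<cdot> h' = u \<and> w \<cdot> k' = v" by blast
qed

text \<open>A cocone \<open>u\<close>, \<open>v\<close> on the right square gives the cocone
  \<open>u\<close>, \<open>v \<cdot> k\<close> on the rectangle. That the induced map restricts to
  \<open>v\<close> is tested on the epimorphism \<open>h\<close>, where both sides become
  \<open>u \<cdot> f'\<close>.\<close>

lemma bic_cancel_left:
  assumes 1: "bic a b c d f g h k" and 2: "bic a b' c d' (f' \<cdot> f) g h' (k' \<cdot> k)"
    and f': "f' \<in> hom C b b'" "is_mono C f'" and k': "k' \<in> hom C d d'" "is_mono C k'"
    and comm: "h' \<cdot> f' = k' \<cdot> h"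
  shows "bic b b' d d' f' h h' k'"
proof (rule bic_pushI)
  note t = bic_hom[OF 1] bic_hom[OF 2]
  show "f' \<in> hom C b b'" "k' \<in> hom C d d'" "is_mono C f'" "is_mono C k'" "h' \<cdot> f' = k' \<cdot> h" by fact+
  show "h \<in> hom C b d" "h' \<in> hom C b' d'" "is_epi C h" "is_epi C h'" using t by auto
  fix x u v assume u: "u \<in> hom C b' x" and v: "v \<in> hom C d x" and eq: "u \<cdot> f' = v \<cdot> h"
  have "u \<cdot> f' \<cdot> f = (u \<cdot> f') \<cdot> f" using t u f' Comp_assoc by metis
  also have "\<dots> = (v \<cdot> k) \<cdot> g"
    using eq t(9) Comp_assoc[OF t(1) t(3) v] Comp_assoc[OF t(2) t(4) v] by simp
  finally obtain w where w: "w \<in> hom C d' x" "w \<cdot> h' = u" "w \<cdot> k' \<cdot> k = v \<cdot> k"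
    using bic_push[OF 2 u] v t Comp_in by metis
  have "(w \<cdot> k') \<cdot> h = v \<cdot> h"
    using w(2) eq comm Comp_assoc[OF t(3) k'(1) w(1)] Comp_assoc[OF f'(1) t(12) w(1)] by simp
  then have "w \<cdot> k' = v" using epi_cancel[OF t(7) t(3) Comp_in[OF k'(1) w(1)] v] by simp
  with w show "\<exists>w \<in> hom C d' x. w \<cdot> h' = u \<and> w \<cdot> k' = v" by blast
qed

text \<open>The left square is recovered through pullbacks: a cone \<open>u\<close>,
  \<open>v\<close> on it gives the cone \<open>f' \<cdot> u\<close>, \<open>v\<close> on the
  rectangle, and \<open>f'\<close> is cancelled afterwards. The maps \<open>f\<close> and
  \<open>k\<close> are monomorphisms as first factors of monomorphisms.\<close>

lemma bic_cancel_right: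
  assumes 1: "bic b b' d d' f' h h' k'" and 2: "bic a b' c d' (f' \<cdot> f) g h' (k' \<cdot> k)"
    and f: "f \<in> hom C a b" and k: "k \<in> hom C c d" and comm: "h \<cdot> f = k \<cdot> g"
  shows "bic a b c d f g h k"
proof (rule bic_pullI)
  note t = bic_hom[OF 1] bic_hom[OF 2]
  show "f \<in> hom C a b" "k \<in> hom C c d" "h \<cdot> f = k \<cdot> g" by fact+
  show "g \<in> hom C a c" "h \<in> hom C b d" "is_epi C g" "is_epi C h" using t by auto
  show "is_mono C f" "is_mono C k" using t f k mono_of_comp by blast+
  fix x u v assume u: "u \<in> hom C x b" and v: "v \<in> hom C x c" and eq: "h \<cdot> u = k \<cdot> v"
  have "h' \<cdot> f' \<cdot> u = (k' \<cdot> k) \<cdot> v"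
    using comm_paste[OF u t(1) v t(2) t(3) k t(4) eq t(9)] .
  then obtain w where w: "w \<in> hom C x a" "(f' \<cdot> f) \<cdot> w = f' \<cdot> u" "g \<cdot> w = v"
    using bic_pull[OF 2 _ v] u t Comp_in by metis
  then have "f' \<cdot> f \<cdot> w = f' \<cdot> u" using Comp_assoc[OF w(1) f t(1)] by simp
  then have "f \<cdot> w = u" using mono_cancel[OF t(5) t(1) Comp_in[OF w(1) f] u] by simp
  with w show "\<exists>w \<in> hom C x a. f \<cdot> w = u \<and> g \<cdot> w = v" by blast
qed

lemma bic_iso_corner:
  assumes 1: "bic a b c d f g h k" and i: "i \<in> hom C d d'" "is_iso C i"
  shows "bic a b c d' f g (i \<cdot> h) (i \<cdot> k)"
proof (rule bic_pullI)
  note t = bic_hom[OF 1]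
  show "f \<in> hom C a b" "g \<in> hom C a c" "is_mono C f" "is_epi C g" using t by auto
  show "i \<cdot> h \<in> hom C b d'" "i \<cdot> k \<in> hom C c d'" using Comp_in[OF t(3) i(1)] Comp_in[OF t(4) i(1)] by auto
  show "is_epi C (i \<cdot> h)" using epi_comp[OF t(7) iso_epi[OF i(2,1)] t(3) i(1)] .
  show "is_mono C (i \<cdot> k)" using mono_comp[OF t(8) iso_mono[OF i(2,1)] t(4) i(1)] .
  show "(i \<cdot> h) \<cdot> f = (i \<cdot> k) \<cdot> g"
    using Comp_assoc[OF t(1) t(3) i(1)] Comp_assoc[OF t(2) t(4) i(1)] t(9) by simp
  fix x u v assume u: "u \<in> hom C x b" and v: "v \<in> hom C x c" and "(i \<cdot> h) \<cdot> u = (i \<cdot> k) \<cdot> v"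
  then have "i \<cdot> h \<cdot> u = i \<cdot> k \<cdot> v"
    using Comp_assoc[OF u t(3) i(1)] Comp_assoc[OF v t(4) i(1)] by simp
  then have "h \<cdot> u = k \<cdot> v"
    using mono_cancel[OF iso_mono[OF i(2,1)] i(1) Comp_in[OF u t(3)] Comp_in[OF v t(4)]] by simp
  from bic_pull[OF 1 u v this] show "\<exists>w \<in> hom C x a. f \<cdot> w = u \<and> g \<cdot> w = v" by metis
qed

text \<open>The identity of \<open>b\<close> and the composite of \<open>h\<close> with the inverse
  of \<open>k\<close> form a cone, so the pullback property gives a section of \<open>f\<close>. A
  monomorphism with a section is invertible.\<close>

lemma bic_iso_top:
  assumes "bic a b c d f g h k" "is_iso C k"
  shows "is_iso C f"
proof -
  note t = bic_hom[OF assms(1)]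
  obtain k' where k': "k' \<in> hom C d c" "k' \<cdot> k = Ident C c" "k \<cdot> k' = Ident C d"
    using assms(2) is_iso_iff t by blast
  have b: "b \<in> Obj C" using t hom_obj by blast
  have k'h: "k' \<cdot> h \<in> hom C b c" using Comp_in[OF t(3) k'(1)] .
  have "k \<cdot> k' \<cdot> h = h \<cdot> Ident C b"
    using Comp_assoc[OF t(3) k'(1) t(4)] k' Ident_left Ident_right t by metis
  then obtain w where w: "w \<in> hom C b a" "f \<cdot> w = Ident C b"
    using bic_pull[OF assms(1) Ident_in[OF b] k'h] by metis
  have "f \<cdot> (w \<cdot> f) = f \<cdot> Ident C a"
    using Comp_assoc[OF t(1) w(1) t(1)] w Ident_left Ident_right t by metis
  then have "w \<cdot> f = Ident C a"
    using mono_cancel[OF t(5) t(1)] Comp_in[OF t(1) w(1)] Ident_in hom_obj(1)[OF t(1)] by blast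
  then show ?thesis using is_iso_iff t w by blast
qed

text \<open>Both squares are pushouts of the same span, so there is also a map back from
  \<open>d'\<close> to \<open>d\<close> under \<open>b\<close>. The two composites are identities
  because \<open>h\<close> and \<open>h'\<close> are epimorphisms.\<close>

lemma bic_same_corner_iso:
  assumes 1: "bic a b c d f g h k" and 2: "bic a b c d' f g h' k'"
    and w: "w \<in> hom C d d'" "w \<cdot> h = h'"
  shows "is_iso C w"
proof -
  note t = bic_hom[OF 1] bic_hom[OF 2]
  obtain w' where w': "w' \<in> hom C d' d" "w' \<cdot> h' = h"
    using bic_push[OF 2 t(3) t(4)] t by metis
  have "(w' \<cdot> w) \<cdot> h = Ident C d \<cdot> h"
    using Comp_assoc[OF t(3) w(1) w'(1)] w w' Ident_left t by metis
  then have 3: "w' \<cdot> w = Ident C d"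
    using epi_cancel[OF t(7) t(3)] Comp_in[OF w(1) w'(1)] Ident_in hom_obj(2)[OF t(3)] by blast
  have "(w \<cdot> w') \<cdot> h' = Ident C d' \<cdot> h'"
    using Comp_assoc[OF t(12) w'(1) w(1)] w w' Ident_left t by metis
  then have "w \<cdot> w' = Ident C d'"
    using epi_cancel[OF t(16) t(12)] Comp_in[OF w'(1) w(1)] Ident_in hom_obj(2)[OF t(12)] by blast
  with 3 show ?thesis using is_iso_iff w w' by blast
qed

end

section \<open>Flags as functors on pairs\<close>

context category
begin

text \<open>The value of the functor at \<open>(i, j) \<le> (k, l)\<close>. The path runs along row
  \<open>i\<close> first, since its turning point \<open>(i, l)\<close> always lies in the triangle,
  whereas \<open>(k, j)\<close> is below the diagonal if \<open>j < k\<close>.\<close>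

definition tri_map :: "('o, 'm) triangle \<Rightarrow> nat \<Rightarrow> nat \<Rightarrow> nat \<Rightarrow> nat \<Rightarrow> 'm" where
  "tri_map A i j k l = ver_path C A i l (k - i) \<cdot> hor_path C A i j (l - j)"

text \<open>Only the unit steps of \<open>M\<close> are stored; for a functor all other values are
  composites of these, see \<open>tri_map_mk_flag\<close>. The \<open>undefined\<close> entries are
  those that \<open>flags\<close> demands.\<close>

definition mk_flag ::
  "nat \<Rightarrow> (nat \<Rightarrow> nat \<Rightarrow> 'o) \<Rightarrow> (nat \<Rightarrow> nat \<Rightarrow> nat \<Rightarrow> nat \<Rightarrow> 'm) \<Rightarrow> ('o, 'm) triangle" where
  "mk_flag n X M =
    \<lparr>ob = (\<lambda>i j. if i \<le> j \<and> j \<le> n then X i j else undefined),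
     hor = (\<lambda>i j. if i \<le> j \<and> j < n then M i j i (j + 1) else undefined),
     ver = (\<lambda>i j. if i < j \<and> j \<le> n then M i j (i + 1) j else undefined)\<rparr>"

end

locale pointed_proto_abelian = proto_abelian +
  fixes z
  assumes zero: "zero_object C z"
begin

lemma to_zero_exists: "a \<in> Obj C \<Longrightarrow> \<exists>f. f \<in> hom C a z"
  using zero by (auto simp: zero_object_def)

lemma to_zero_unique: "f \<in> hom C a z \<Longrightarrow> g \<in> hom C a z \<Longrightarrow> f = g"
  using zero hom_obj(1)[of f a z] by (auto simp: zero_object_def)

lemma from_zero_unique: "f \<in> hom C z a \<Longrightarrow> g \<in> hom C z a \<Longrightarrow> f = g"
  using zero hom_obj(2)[of f z a] by (auto simp: zero_object_def)

lemma to_zero_epi: "f \<in> hom C a z \<Longrightarrow> is_epi C f"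
  by (rule epiI) (auto dest: from_zero_unique)

text \<open>In this form, restriction of a flag along a monotone map is mere reindexing.\<close>

definition tri_diag ::
  "nat \<Rightarrow> (nat \<Rightarrow> nat \<Rightarrow> 'a) \<Rightarrow> (nat \<Rightarrow> nat \<Rightarrow> nat \<Rightarrow> nat \<Rightarrow> 'b) \<Rightarrow> bool" where
  "tri_diag n X M \<longleftrightarrow>
    (\<forall>i \<le> n. X i i = z) \<and>
    (\<forall>i j. i \<le> j \<and> j \<le> n \<longrightarrow> X i j \<in> Obj C \<and> M i j i j = Ident C (X i j)) \<and>
    (\<forall>i j k l. i \<le> j \<and> k \<le> l \<and> i \<le> k \<and> j \<le> l \<and> l \<le> n \<longrightarrow> M i j k l \<in> hom C (X i j) (X k l)) \<and>
    (\<forall>i j k l p q. i \<le> j \<and> k \<le> l \<and> i \<le> k \<and> j \<le> l \<and> p \<le> q \<and> k \<le> p \<and> l \<le> q \<and> q \<le> n \<longrightarrow>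
      M k l p q \<cdot> M i j k l = M i j p q) \<and>
    (\<forall>i j k l. i \<le> k \<and> k \<le> j \<and> j \<le> l \<and> l \<le> n \<longrightarrow>
      bic (X i j) (X i l) (X k j) (X k l) (M i j i l) (M i j k j) (M i l k l) (M k j k l))"

lemma tri_diagD:
  assumes "tri_diag n X M"
  shows "i \<le> n \<Longrightarrow> X i i = z"
    and "i \<le> j \<Longrightarrow> j \<le> n \<Longrightarrow> X i j \<in> Obj C"
    and "i \<le> j \<Longrightarrow> j \<le> n \<Longrightarrow> M i j i j = Ident C (X i j)"
    and "i \<le> j \<Longrightarrow> k \<le> l \<Longrightarrow> i \<le> k \<Longrightarrow> j \<le> l \<Longrightarrow> l \<le> n \<Longrightarrow> M i j k l \<in> hom C (X i j) (X k l)"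
    and "i \<le> j \<Longrightarrow> k \<le> l \<Longrightarrow> i \<le> k \<Longrightarrow> j \<le> l \<Longrightarrow> p \<le> q \<Longrightarrow> k \<le> p \<Longrightarrow> l \<le> q \<Longrightarrow> q \<le> n \<Longrightarrow>
      M k l p q \<cdot> M i j k l = M i j p q"
    and "i \<le> k \<Longrightarrow> k \<le> j \<Longrightarrow> j \<le> l \<Longrightarrow> l \<le> n \<Longrightarrow>
      bic (X i j) (X i l) (X k j) (X k l) (M i j i l) (M i j k j) (M i l k l) (M k j k l)"
  using assms unfolding tri_diag_def by simp_all

lemma tri_diag_mono:
  "tri_diag n X M \<Longrightarrow> i \<le> j \<Longrightarrow> j \<le> l \<Longrightarrow> l \<le> n \<Longrightarrow> is_mono C (M i j i l)"
  using tri_diagD(6)[of n X M i i j l] bic_hom(5) by blast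

lemma tri_diag_epi:
  "tri_diag n X M \<Longrightarrow> i \<le> k \<Longrightarrow> k \<le> j \<Longrightarrow> j \<le> n \<Longrightarrow> is_epi C (M i j k j)"
  using tri_diagD(6)[of n X M i k j j] bic_hom(6) by blast

section \<open>Composites along the rows and columns of a flag\<close>

lemma flagsD:
  assumes "A \<in> flags C z n"
  shows "i \<le> j \<Longrightarrow> j \<le> n \<Longrightarrow> ob A i j \<in> Obj C"
    and "i \<le> n \<Longrightarrow> ob A i i = z"
    and "i \<le> j \<Longrightarrow> j < n \<Longrightarrow> hor A i j \<in> hom C (ob A i j) (ob A i (j + 1))"
    and "i \<le> j \<Longrightarrow> j < n \<Longrightarrow> is_mono C (hor A i j)"
    and "i < j \<Longrightarrow> j \<le> n \<Longrightarrow> ver A i j \<in> hom C (ob A i j) (ob A (i + 1) j)"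
    and "i < j \<Longrightarrow> j \<le> n \<Longrightarrow> is_epi C (ver A i j)"
    and "i < j \<Longrightarrow> j < n \<Longrightarrow>
      bic (ob A i j) (ob A i (j + 1)) (ob A (i + 1) j) (ob A (i + 1) (j + 1))
        (hor A i j) (ver A i j) (ver A i (j + 1)) (hor A (i + 1) j)"
  using assms unfolding flags_def bic_def by auto

lemma hor_path_in:
  assumes A: "A \<in> flags C z n" and "i \<le> j" "j + d \<le> n"
  shows "hor_path C A i j d \<in> hom C (ob A i j) (ob A i (j + d))"
    and "is_mono C (hor_path C A i j d)"
  using assms(2,3)
proof (induction d)
  case 0
  { case 1 show ?case using flagsD(1)[OF A] 1 by (simp add: Ident_in) }
  { case 2 show ?case using flagsD(1)[OF A] 2 by (simp add: mono_Ident) }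
next
  case (Suc d)
  have h: "hor A i (j + d) \<in> hom C (ob A i (j + d)) (ob A i (j + d + 1))"
    "is_mono C (hor A i (j + d))" if "i \<le> j" "j + Suc d \<le> n"
    using flagsD(3,4)[OF A, of i "j + d"] that by auto
  { case 1 show ?case using Comp_in[OF Suc.IH(1) h(1)] 1 by simp }
  { case 2 show ?case using mono_comp[OF Suc.IH(2) h(2) Suc.IH(1) h(1)] 2 by simp }
qed

lemma ver_path_in:
  assumes A: "A \<in> flags C z n" and "i + e \<le> j" "j \<le> n"
  shows "ver_path C A i j e \<in> hom C (ob A i j) (ob A (i + e) j)"
    and "is_epi C (ver_path C A i j e)"
  using assms(2,3)
proof (induction e)
  case 0
  { case 1 show ?case using flagsD(1)[OF A] 1 by (simp add: Ident_in) }
  { case 2 show ?case using flagsD(1)[OF A] 2 by (simp add: epi_Ident) }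
next
  case (Suc e)
  have h: "ver A (i + e) j \<in> hom C (ob A (i + e) j) (ob A (i + e + 1) j)"
    "is_epi C (ver A (i + e) j)" if "i + Suc e \<le> j" "j \<le> n"
    using flagsD(5,6)[OF A, of "i + e" j] that by auto
  { case 1 show ?case using Comp_in[OF Suc.IH(1) h(1)] 1 by simp }
  { case 2 show ?case using epi_comp[OF Suc.IH(2) h(2) Suc.IH(1) h(1)] 2 by simp }
qed

lemma hor_path_add:
  assumes A: "A \<in> flags C z n" and "i \<le> j" "j + d + e \<le> n"
  shows "hor_path C A i j (d + e) = hor_path C A i (j + d) e \<cdot> hor_path C A i j d"
  using assms(3)
proof (induction e)
  case 0
  then show ?case using Ident_left[OF hor_path_in(1)[OF A, of i j d]] assms by simp
next
  case (Suc e)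
  have "hor A i (j + d + e) \<in> hom C (ob A i (j + d + e)) (ob A i (j + d + e + 1))"
    using flagsD(3)[OF A] assms Suc by simp
  then show ?case
    using Comp_assoc[OF hor_path_in(1)[OF A, of i j d] hor_path_in(1)[OF A, of i "j + d" e]] Suc assms
    by (simp add: add.assoc)
qed

lemma ver_path_add:
  assumes A: "A \<in> flags C z n" and "i + d + e \<le> j" "j \<le> n"
  shows "ver_path C A i j (d + e) = ver_path C A (i + d) j e \<cdot> ver_path C A i j d"
  using assms(2)
proof (induction e)
  case 0
  then show ?case using Ident_left[OF ver_path_in(1)[OF A, of i d j]] assms by simp
next
  case (Suc e)
  have "ver A (i + d + e) j \<in> hom C (ob A (i + d + e) j) (ob A (i + d + e + 1) j)"
    using flagsD(5)[OF A] assms Suc by simp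
  then show ?case
    using Comp_assoc[OF ver_path_in(1)[OF A, of i d j] ver_path_in(1)[OF A, of "i + d" e j]] Suc assms
    by (simp add: add.assoc)
qed

lemma bic_hor_path:
  assumes A: "A \<in> flags C z n" and "i < j" "j + d \<le> n"
  shows "bic (ob A i j) (ob A i (j + d)) (ob A (i + 1) j) (ob A (i + 1) (j + d))
    (hor_path C A i j d) (ver A i j) (ver A i (j + d)) (hor_path C A (i + 1) j d)"
  using assms(3)
proof (induction d)
  case 0
  show ?case using bic_id_hor[OF flagsD(5,6)[OF A]] assms 0 by simp
next
  case (Suc d)
  show ?case using bic_paste_hor[OF Suc.IH flagsD(7)[OF A]] Suc.prems assms by simp
qed

text \<open>The unit squares of a flag paste to strips of height one by \<open>bic_hor_path\<close>,
  and the strips paste to rectangles. The bound \<open>i + e \<le> j\<close> keeps the lower left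
  corner inside the triangle.\<close>

lemma bic_paths:
  assumes A: "A \<in> flags C z n" and "i + e \<le> j" "j + d \<le> n"
  shows "bic (ob A i j) (ob A i (j + d)) (ob A (i + e) j) (ob A (i + e) (j + d))
    (hor_path C A i j d) (ver_path C A i j e) (ver_path C A i (j + d) e) (hor_path C A (i + e) j d)"
  using assms(2)
proof (induction e)
  case 0
  show ?case using bic_id_ver[OF hor_path_in[OF A]] assms 0 by simp
next
  case (Suc e)
  show ?case using bic_paste_ver[OF Suc.IH bic_hor_path[OF A]] Suc.prems assms by simp
qed

lemma tri_map_hor:
  assumes "A \<in> flags C z n" "i \<le> j" "j \<le> l" "l \<le> n"
  shows "tri_map A i j i l = hor_path C A i j (l - j)"
  using Ident_left[OF hor_path_in(1)[OF assms(1), of i j "l - j"]] assms by (simp add: tri_map_def)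

lemma tri_map_ver:
  assumes "A \<in> flags C z n" "i \<le> k" "k \<le> j" "j \<le> n"
  shows "tri_map A i j k j = ver_path C A i j (k - i)"
  using Ident_right[OF ver_path_in(1)[OF assms(1), of i "k - i" j]] assms by (simp add: tri_map_def)

lemma tri_map_bic:
  assumes "A \<in> flags C z n" "i \<le> k" "k \<le> j" "j \<le> l" "l \<le> n"
  shows "bic (ob A i j) (ob A i l) (ob A k j) (ob A k l)
    (tri_map A i j i l) (tri_map A i j k j) (tri_map A i l k l) (tri_map A k j k l)"
  using bic_paths[OF assms(1), of i "k - i" j "l - j"] assms
  by (simp add: tri_map_hor tri_map_ver)

text \<open>The composite turns twice: right, down, right, down. The commuting rectangle with
  corners \<open>(i, l)\<close>, \<open>(i, q)\<close>, \<open>(k, l)\<close>, \<open>(k, q)\<close>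
  exchanges the two middle parts, after which rows and columns compose separately.\<close>

lemma tri_map_comp:
  assumes A: "A \<in> flags C z n"
    and ij: "i \<le> j" "k \<le> l" "i \<le> k" "j \<le> l" "p \<le> q" "k \<le> p" "l \<le> q" "q \<le> n"
  shows "tri_map A k l p q \<cdot> tri_map A i j k l = tri_map A i j p q"
proof -
  let ?H = "\<lambda>i j l. hor_path C A i j (l - j)" and ?V = "\<lambda>i l k. ver_path C A i l (k - i)"
  have H: "?H i j l \<in> hom C (ob A i j) (ob A i l)" "?H k l q \<in> hom C (ob A k l) (ob A k q)"
    "?H i l q \<in> hom C (ob A i l) (ob A i q)"
    using hor_path_in(1)[OF A, of i j "l - j"] hor_path_in(1)[OF A, of k l "q - l"]
      hor_path_in(1)[OF A, of i l "q - l"] ij by simp_all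
  have V: "?V k q p \<in> hom C (ob A k q) (ob A p q)" "?V i l k \<in> hom C (ob A i l) (ob A k l)"
    "?V i q k \<in> hom C (ob A i q) (ob A k q)"
    using ver_path_in(1)[OF A, of k "p - k" q] ver_path_in(1)[OF A, of i "k - i" l]
      ver_path_in(1)[OF A, of i "k - i" q] ij by simp_all
  have comm: "?V i q k \<cdot> ?H i l q = ?H k l q \<cdot> ?V i l k"
    using bic_hom(9)[OF bic_paths[OF A, of i "k - i" l "q - l"]] ij by simp
  have "(?V k q p \<cdot> ?H k l q) \<cdot> (?V i l k \<cdot> ?H i j l) = ?V k q p \<cdot> ((?H k l q \<cdot> ?V i l k) \<cdot> ?H i j l)"
    using Comp_assoc[OF Comp_in[OF H(1) V(2)] H(2) V(1)] Comp_assoc[OF H(1) V(2) H(2)] by simp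
  also have "\<dots> = (?V k q p \<cdot> ?V i q k) \<cdot> (?H i l q \<cdot> ?H i j l)"
    unfolding comm[symmetric]
    using Comp_assoc[OF H(1) H(3) V(3)] Comp_assoc[OF Comp_in[OF H(1) H(3)] V(3) V(1)] by simp
  also have "?V k q p \<cdot> ?V i q k = ?V i q p"
    using ver_path_add[OF A, of i "k - i" "p - k" q] ij by simp
  also have "?H i l q \<cdot> ?H i j l = ?H i j q"
    using hor_path_add[OF A, of i j "l - j" "q - l"] ij by simp
  finally show ?thesis by (simp add: tri_map_def)
qed

lemma tri_map_in:
  assumes A: "A \<in> flags C z n" and ij: "i \<le> j" "k \<le> l" "i \<le> k" "j \<le> l" "l \<le> n"
  shows "tri_map A i j k l \<in> hom C (ob A i j) (ob A k l)"
proof -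
  have "hor_path C A i j (l - j) \<in> hom C (ob A i j) (ob A i l)"
    using hor_path_in(1)[OF A, of i j "l - j"] ij by simp
  moreover have "ver_path C A i l (k - i) \<in> hom C (ob A i l) (ob A k l)"
    using ver_path_in(1)[OF A, of i "k - i" l] ij by simp
  ultimately show ?thesis using Comp_in by (simp add: tri_map_def)
qed

section \<open>Translation between flags and functors on pairs\<close>

lemma tri_diag_flag:
  assumes A: "A \<in> flags C z n"
  shows "tri_diag n (ob A) (tri_map A)"
proof -
  have "tri_map A i j i j = Ident C (ob A i j)" if "i \<le> j" "j \<le> n" for i j
    using Ident_left[OF Ident_in[OF flagsD(1)[OF A that]]] by (simp add: tri_map_def)
  then show ?thesis
    unfolding tri_diag_def
    using flagsD(1,2)[OF A] tri_map_in[OF A] tri_map_comp[OF A] tri_map_bic[OF A] by simp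
qed

lemma flag_hor:
  assumes "A \<in> flags C z n" "i \<le> j" "j < n"
  shows "hor A i j = tri_map A i j i (Suc j)"
  using tri_map_hor[of A n i j "Suc j"] Ident_right[OF flagsD(3)[of A n i j]] assms by simp

lemma flag_ver:
  assumes "A \<in> flags C z n" "i < j" "j \<le> n"
  shows "ver A i j = tri_map A i j (Suc i) j"
  using tri_map_ver[of A n i "Suc i" j] Ident_right[OF flagsD(5)[of A n i j]] assms by simp

lemma flag_eqI:
  assumes A: "A \<in> flags C z n" and B: "B \<in> flags C z n"
    and ob: "\<And>i j. i \<le> j \<Longrightarrow> j \<le> n \<Longrightarrow> ob A i j = ob B i j"
    and tri_map: "\<And>i j k l. i \<le> j \<Longrightarrow> k \<le> l \<Longrightarrow> i \<le> k \<Longrightarrow> j \<le> l \<Longrightarrow> l \<le> n \<Longrightarrow>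
      tri_map A i j k l = tri_map B i j k l"
  shows "A = B"
proof -
  have "ob A i j = ob B i j" for i j
    using A B ob by (cases "i \<le> j \<and> j \<le> n") (auto simp: flags_def)
  moreover have "hor A i j = hor B i j" for i j
  proof (cases "i \<le> j \<and> j < n")
    case True
    then show ?thesis using flag_hor A B tri_map by simp
  qed (use A B in \<open>simp add: flags_def\<close>)
  moreover have "ver A i j = ver B i j" for i j
  proof (cases "i < j \<and> j \<le> n")
    case True
    then show ?thesis using flag_ver A B tri_map by simp
  qed (use A B in \<open>simp add: flags_def\<close>)
  ultimately show ?thesis by (simp add: fun_eq_iff)
qed

lemma mk_flag_in:
  assumes D: "tri_diag n X M"
  shows "mk_flag n X M \<in> flags C z n"
proof -
  have "bicartesian C (M i j i (j + 1)) (M i j (i + 1) j) (M i (j + 1) (i + 1) (j + 1))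
    (M (i + 1) j (i + 1) (j + 1))" if "i < j" "j < n" for i j
    using tri_diagD(6)[OF D, of i "i + 1" j "j + 1"] that by (simp add: bic_def)
  then show ?thesis
    using tri_diagD(1-4)[OF D] tri_diag_mono[OF D] tri_diag_epi[OF D]
    by (auto simp: flags_def mk_flag_def)
qed

text \<open>\<open>mk_flag\<close> forgets all but the unit steps; functoriality of \<open>M\<close>
  rebuilds first the row and column composites and then the general value.\<close>

lemma tri_map_mk_flag:
  assumes D: "tri_diag n X M" and ij: "i \<le> j" "k \<le> l" "i \<le> k" "j \<le> l" "l \<le> n"
  shows "tri_map (mk_flag n X M) i j k l = M i j k l"
proof -
  have H: "hor_path C (mk_flag n X M) i j d = M i j i (j + d)" if "i \<le> j" "j + d \<le> n" for i j d
    using that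
  proof (induction d)
    case 0
    then show ?case using tri_diagD(3)[OF D] by (simp add: mk_flag_def)
  next
    case (Suc d)
    then show ?case
      using tri_diagD(5)[OF D, of i j i "j + d" i "j + d + 1"] by (simp add: mk_flag_def)
  qed
  have V: "ver_path C (mk_flag n X M) i j d = M i j (i + d) j" if "i + d \<le> j" "j \<le> n" for i j d
    using that
  proof (induction d)
    case 0
    then show ?case using tri_diagD(3)[OF D] by (simp add: mk_flag_def)
  next
    case (Suc d)
    then show ?case
      using tri_diagD(5)[OF D, of i j "i + d" j "i + d + 1" j] by (simp add: mk_flag_def)
  qed
  show ?thesis
    using H[of i j "l - j"] V[of i "k - i" l] tri_diagD(5)[OF D, of i j i l k l] ij
    by (simp add: tri_map_def)
qed

lemma ob_mk_flag: "i \<le> j \<Longrightarrow> j \<le> n \<Longrightarrow> ob (mk_flag n X M) i j = X i j"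
  by (simp add: mk_flag_def)

section \<open>Reindexing along monotone maps\<close>

lemma Delta_mono: "\<alpha> \<in> Delta m n \<Longrightarrow> i \<le> j \<Longrightarrow> j \<le> m \<Longrightarrow> \<alpha> i \<le> \<alpha> j"
  by (auto simp: Delta_def mono_on_def)

lemma Delta_le: "\<alpha> \<in> Delta m n \<Longrightarrow> i \<le> m \<Longrightarrow> \<alpha> i \<le> n"
  by (auto simp: Delta_def)

text \<open>All inequalities in \<open>tri_diag\<close> are weak, so every clause at
  \<open>\<alpha>\<close> is an instance of the same clause for \<open>M\<close>, also when \<alpha>
  repeats values.\<close>

lemma tri_diag_reindex:
  assumes D: "tri_diag n X M" and a: "\<alpha> \<in> Delta m n"
  shows "tri_diag m (\<lambda>i j. X (\<alpha> i) (\<alpha> j)) (\<lambda>i j k l. M (\<alpha> i) (\<alpha> j) (\<alpha> k) (\<alpha> l))"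
  unfolding tri_diag_def
  using Delta_mono[OF a] Delta_le[OF a] tri_diagD[OF D] by (intro conjI allI impI) auto

text \<open>Composed with \<open>tri_map_mk_flag\<close>, this turns the path composites in
  \<open>tri_pull\<close> into plain substitution of indices; the simplicial identities then need no
  further computation with paths.\<close>

lemma tri_pull_mk_flag:
  assumes A: "A \<in> flags C z n" and a: "\<alpha> \<in> Delta m n"
  shows "tri_pull C m \<alpha> A =
    mk_flag m (\<lambda>i j. ob A (\<alpha> i) (\<alpha> j)) (\<lambda>i j k l. tri_map A (\<alpha> i) (\<alpha> j) (\<alpha> k) (\<alpha> l))"
  using Delta_mono[OF a] Delta_le[OF a]
  by (simp add: tri_pull_def mk_flag_def fun_eq_iff tri_map_hor[OF A] tri_map_ver[OF A])

lemma tri_pull_in: "A \<in> flags C z n \<Longrightarrow> \<alpha> \<in> Delta m n \<Longrightarrow> tri_pull C m \<alpha> A \<in> flags C z m"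
  using mk_flag_in[OF tri_diag_reindex[OF tri_diag_flag]] by (simp add: tri_pull_mk_flag)

lemma ob_tri_pull: "i \<le> j \<Longrightarrow> j \<le> m \<Longrightarrow> ob (tri_pull C m \<alpha> A) i j = ob A (\<alpha> i) (\<alpha> j)"
  by (simp add: tri_pull_def)

lemma tri_map_tri_pull:
  assumes "A \<in> flags C z n" "\<alpha> \<in> Delta m n" "i \<le> j" "k \<le> l" "i \<le> k" "j \<le> l" "l \<le> m"
  shows "tri_map (tri_pull C m \<alpha> A) i j k l = tri_map A (\<alpha> i) (\<alpha> j) (\<alpha> k) (\<alpha> l)"
  using tri_pull_mk_flag[OF assms(1,2)]
    tri_map_mk_flag[OF tri_diag_reindex[OF tri_diag_flag[OF assms(1)] assms(2)] assms(3-)] by simp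

text \<open>Naturality on unit steps extends along a row and then down a column by pasting squares,
  as in the definition of \<open>tri_map\<close>. In this form a map of flags can be reindexed like
  the flags themselves.\<close>

lemma flag_arr_iff:
  "(A, B, f) \<in> Arr (flag_category C z n) \<longleftrightarrow> A \<in> flags C z n \<and> B \<in> flags C z n \<and>
    (\<forall>i j. i \<le> j \<and> j \<le> n \<longrightarrow> f i j \<in> hom C (ob A i j) (ob B i j)) \<and>
    (\<forall>i j k l. i \<le> j \<and> k \<le> l \<and> i \<le> k \<and> j \<le> l \<and> l \<le> n \<longrightarrow>
      tri_map B i j k l \<cdot> f i j = f k l \<cdot> tri_map A i j k l) \<and>
    (\<forall>i j. \<not> (i \<le> j \<and> j \<le> n) \<longrightarrow> f i j = undefined)" (is "?L \<longleftrightarrow> ?R")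
proof
  assume ?R
  then show ?L by (auto simp: flag_category_def flag_hor flag_ver)
next
  assume L: ?L
  then have A: "A \<in> flags C z n" and B: "B \<in> flags C z n"
    and f: "\<And>i j. i \<le> j \<Longrightarrow> j \<le> n \<Longrightarrow> f i j \<in> hom C (ob A i j) (ob B i j)"
    and h: "\<And>i j. i \<le> j \<Longrightarrow> j < n \<Longrightarrow> hor B i j \<cdot> f i j = f i (j + 1) \<cdot> hor A i j"
    and v: "\<And>i j. i < j \<Longrightarrow> j \<le> n \<Longrightarrow> ver B i j \<cdot> f i j = f (i + 1) j \<cdot> ver A i j"
    by (auto simp: flag_category_def)
  have H: "hor_path C B i j d \<cdot> f i j = f i (j + d) \<cdot> hor_path C A i j d"
    if "i \<le> j" "j + d \<le> n" for i j d
    using that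
  proof (induction d)
    case 0
    then show ?case using Ident_left[OF f] Ident_right[OF f] by simp
  next
    case (Suc d)
    have p: "f i j \<in> hom C (ob A i j) (ob B i j)"
      "hor_path C A i j d \<in> hom C (ob A i j) (ob A i (j + d))"
      "hor_path C B i j d \<in> hom C (ob B i j) (ob B i (j + d))"
      "f i (j + d) \<in> hom C (ob A i (j + d)) (ob B i (j + d))"
      "hor A i (j + d) \<in> hom C (ob A i (j + d)) (ob A i (j + d + 1))"
      "hor B i (j + d) \<in> hom C (ob B i (j + d)) (ob B i (j + d + 1))"
      "f i (j + d + 1) \<in> hom C (ob A i (j + d + 1)) (ob B i (j + d + 1))"
      using f hor_path_in(1)[OF A] hor_path_in(1)[OF B] flagsD(3)[OF A] flagsD(3)[OF B] Suc.prems
      by simp_all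
    show ?case
      using comm_paste[OF p(2) p(5) p(1) p(4) p(7) p(3) p(6) Suc.IH[symmetric] h[symmetric]] Suc.prems
      by simp
  qed
  have V: "ver_path C B i j d \<cdot> f i j = f (i + d) j \<cdot> ver_path C A i j d"
    if "i + d \<le> j" "j \<le> n" for i j d
    using that
  proof (induction d)
    case 0
    then show ?case using Ident_left[OF f] Ident_right[OF f] by simp
  next
    case (Suc d)
    have p: "f i j \<in> hom C (ob A i j) (ob B i j)"
      "ver_path C A i j d \<in> hom C (ob A i j) (ob A (i + d) j)"
      "ver_path C B i j d \<in> hom C (ob B i j) (ob B (i + d) j)"
      "f (i + d) j \<in> hom C (ob A (i + d) j) (ob B (i + d) j)"
      "ver A (i + d) j \<in> hom C (ob A (i + d) j) (ob A (i + d + 1) j)"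
      "ver B (i + d) j \<in> hom C (ob B (i + d) j) (ob B (i + d + 1) j)"
      "f (i + d + 1) j \<in> hom C (ob A (i + d + 1) j) (ob B (i + d + 1) j)"
      using f ver_path_in(1)[OF A] ver_path_in(1)[OF B] flagsD(5)[OF A] flagsD(5)[OF B] Suc.prems
      by simp_all
    show ?case
      using comm_paste[OF p(2) p(5) p(1) p(4) p(7) p(3) p(6) Suc.IH[symmetric] v[symmetric]] Suc.prems
      by simp
  qed
  have "tri_map B i j k l \<cdot> f i j = f k l \<cdot> tri_map A i j k l"
    if ij: "i \<le> j" "k \<le> l" "i \<le> k" "j \<le> l" "l \<le> n" for i j k l
  proof -
    have p: "f i j \<in> hom C (ob A i j) (ob B i j)" "f i l \<in> hom C (ob A i l) (ob B i l)"
      "f k l \<in> hom C (ob A k l) (ob B k l)"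
      using f ij by simp_all
    note q = tri_map_in[OF A, of i j i l] tri_map_in[OF B, of i j i l]
      tri_map_in[OF A, of i l k l] tri_map_in[OF B, of i l k l]
    have "f i l \<cdot> tri_map A i j i l = tri_map B i j i l \<cdot> f i j"
      "f k l \<cdot> tri_map A i l k l = tri_map B i l k l \<cdot> f i l"
      using H[of i j "l - j"] V[of i "k - i" l] ij
      by (simp_all add: tri_map_hor[OF A] tri_map_hor[OF B] tri_map_ver[OF A] tri_map_ver[OF B])
    from comm_paste[OF q(1) q(3) p(1) p(2) p(3) q(2) q(4) this] show ?thesis
      using tri_map_comp[OF A, of i j i l k l] tri_map_comp[OF B, of i j i l k l] ij by simp
  qed
  with A B f L show ?R by (auto simp: flag_category_def)
qed

end

section \<open>The simplicial groupoid of flags\<close>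

lemma hom_core: "hom (core K) a b = {f \<in> hom K a b. is_iso K f}"
  by (auto simp: core_def hom_def is_iso_def)

lemma core_simps [simp]:
  "Obj (core K) = Obj K" "Ident (core K) = Ident K" "Comp (core K) = Comp K"
  "Dom (core K) = Dom K" "Cod (core K) = Cod K"
  by (simp_all add: core_def)

lemma Arr_core: "f \<in> Arr (core K) \<longleftrightarrow> is_iso K f"
  by (simp add: core_def)

context category
begin

lemma core_category: "category (core C)"
proof
  fix f assume "f \<in> Arr (core C)"
  then have "f \<in> Arr C" by (simp add: Arr_core is_iso_def)
  then show "Dom (core C) f \<in> Obj (core C)" "Cod (core C) f \<in> Obj (core C)" by auto
next
  fix a assume "a \<in> Obj (core C)"
  then show "Ident (core C) a \<in> hom (core C) a a"
    using Ident_in iso_Ident by (simp add: hom_core)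
next
  fix f g a b c assume "f \<in> hom (core C) a b" "g \<in> hom (core C) b c"
  then show "g \<cdot>\<^bsub>core C\<^esub> f \<in> hom (core C) a c"
    using Comp_in iso_comp by (auto simp: hom_core)
qed (auto simp: hom_core Ident_left Ident_right Comp_assoc)

lemma core_groupoid: "groupoid (core C)"
proof -
  interpret core: category "core C" by (rule core_category)
  show ?thesis
  proof
    fix f assume "f \<in> Arr (core C)"
    then have f: "is_iso C f" "f \<in> hom C (Dom C f) (Cod C f)"
      by (auto simp: Arr_core is_iso_def hom_def)
    then obtain g where g: "g \<in> hom C (Cod C f) (Dom C f)"
      "g \<cdot> f = Ident C (Dom C f)" "f \<cdot> g = Ident C (Cod C f)"
      by (auto simp: is_iso_def)
    then have "is_iso C g" using is_iso_iff f by blast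
    with f g show "is_iso (core C) f"
      by (auto simp: is_iso_def hom_core Arr_core)
  qed
qed

end

lemma functor_iso:
  assumes "category A" "is_functor A B F" "is_iso A f" "f \<in> hom A x y"
  shows "is_iso B (on_arr F f)"
proof -
  interpret A: category A by fact
  obtain g where g: "g \<in> hom A y x" "g \<cdot>\<^bsub>A\<^esub> f = Ident A x" "f \<cdot>\<^bsub>A\<^esub> g = Ident A y"
    using assms A.is_iso_iff by blast
  have xy: "x \<in> Obj A" "y \<in> Obj A" using A.hom_obj assms(4) by auto
  have 1: "on_arr F f \<in> hom B (on_obj F x) (on_obj F y)" "on_arr F g \<in> hom B (on_obj F y) (on_obj F x)"
    using assms g by (auto simp: is_functor_def)
  have "on_arr F (g \<cdot>\<^bsub>A\<^esub> f) = on_arr F g \<cdot>\<^bsub>B\<^esub> on_arr F f"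
    "on_arr F (f \<cdot>\<^bsub>A\<^esub> g) = on_arr F f \<cdot>\<^bsub>B\<^esub> on_arr F g"
    using assms(2,4) g(1) unfolding is_functor_def by blast+
  moreover have "on_arr F (Ident A x) = Ident B (on_obj F x)"
    "on_arr F (Ident A y) = Ident B (on_obj F y)"
    using xy assms(2) by (auto simp: is_functor_def)
  ultimately have 2: "on_arr F g \<cdot>\<^bsub>B\<^esub> on_arr F f = Ident B (on_obj F x)"
    "on_arr F f \<cdot>\<^bsub>B\<^esub> on_arr F g = Ident B (on_obj F y)"
    using g by simp_all
  have "on_arr F f \<in> Arr B" "Dom B (on_arr F f) = on_obj F x" "Cod B (on_arr F f) = on_obj F y"
    using 1 by (auto simp: hom_def)
  with 1 2 show ?thesis by (auto simp: is_iso_def)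
qed

lemma functor_core:
  assumes "category A" "is_functor A B F"
  shows "is_functor (core A) (core B) F"
  using assms(2) functor_iso[OF assms] by (auto simp: is_functor_def hom_core)

context pointed_proto_abelian
begin

section \<open>The category of flags\<close>

definition flag_map ::
  "nat \<Rightarrow> ('a, 'b) triangle \<Rightarrow> ('a, 'b) triangle \<Rightarrow> (nat \<Rightarrow> nat \<Rightarrow> 'b) \<Rightarrow> bool" where
  "flag_map n A B f \<longleftrightarrow> (A, B, f) \<in> Arr (flag_category C z n)"

lemma flag_mapD:
  assumes "flag_map n A B f"
  shows "A \<in> flags C z n" "B \<in> flags C z n"
    and "i \<le> j \<Longrightarrow> j \<le> n \<Longrightarrow> f i j \<in> hom C (ob A i j) (ob B i j)"
    and "i \<le> j \<Longrightarrow> k \<le> l \<Longrightarrow> i \<le> k \<Longrightarrow> j \<le> l \<Longrightarrow> l \<le> n \<Longrightarrow>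
      tri_map B i j k l \<cdot> f i j = f k l \<cdot> tri_map A i j k l"
    and "\<not> (i \<le> j \<and> j \<le> n) \<Longrightarrow> f i j = undefined"
  using assms unfolding flag_map_def flag_arr_iff by simp_all

lemma flag_mapI:
  assumes "A \<in> flags C z n" "B \<in> flags C z n"
    and "\<And>i j. i \<le> j \<Longrightarrow> j \<le> n \<Longrightarrow> f i j \<in> hom C (ob A i j) (ob B i j)"
    and "\<And>i j k l. i \<le> j \<Longrightarrow> k \<le> l \<Longrightarrow> i \<le> k \<Longrightarrow> j \<le> l \<Longrightarrow> l \<le> n \<Longrightarrow>
      tri_map B i j k l \<cdot> f i j = f k l \<cdot> tri_map A i j k l"
  shows "flag_map n A B (tri_fam n f)"
  using assms unfolding flag_map_def flag_arr_iff by (simp add: tri_fam_def)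

lemma flag_map_ext:
  assumes "flag_map n A B f" "flag_map n A' B' g"
    and "\<And>i j. i \<le> j \<Longrightarrow> j \<le> n \<Longrightarrow> f i j = g i j"
  shows "f = g"
proof (intro ext)
  fix i j show "f i j = g i j"
    using flag_mapD(5)[OF assms(1)] flag_mapD(5)[OF assms(2)] assms(3) by metis
qed

lemma tri_fam_apply: "i \<le> j \<Longrightarrow> j \<le> n \<Longrightarrow> tri_fam n f i j = f i j"
  by (simp add: tri_fam_def)

lemma flag_map_id:
  assumes A: "A \<in> flags C z n"
  shows "flag_map n A A (tri_fam n (\<lambda>i j. Ident C (ob A i j)))"
proof (rule flag_mapI)
  show "A \<in> flags C z n" "A \<in> flags C z n" by fact+
  show "Ident C (ob A i j) \<in> hom C (ob A i j) (ob A i j)" if "i \<le> j" "j \<le> n" for i j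
    using Ident_in flagsD(1)[OF A] that by simp
  show "tri_map A i j k l \<cdot> Ident C (ob A i j) = Ident C (ob A k l) \<cdot> tri_map A i j k l"
    if "i \<le> j" "k \<le> l" "i \<le> k" "j \<le> l" "l \<le> n" for i j k l
    using Ident_left[OF tri_map_in[OF A that]] Ident_right[OF tri_map_in[OF A that]] by simp
qed

lemma flag_map_comp:
  assumes f: "flag_map n A B f" and g: "flag_map n B D g"
  shows "flag_map n A D (tri_fam n (\<lambda>i j. g i j \<cdot> f i j))"
proof (rule flag_mapI)
  show "A \<in> flags C z n" "D \<in> flags C z n" using flag_mapD f g by blast+
  show "g i j \<cdot> f i j \<in> hom C (ob A i j) (ob D i j)" if "i \<le> j" "j \<le> n" for i j
    using Comp_in[OF flag_mapD(3)[OF f that] flag_mapD(3)[OF g that]] .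
  fix i j k l assume ij: "i \<le> j" "k \<le> l" "i \<le> k" "j \<le> l" "l \<le> n"
  have b: "i \<le> j" "j \<le> n" "k \<le> l" "l \<le> n" using ij by auto
  show "tri_map D i j k l \<cdot> g i j \<cdot> f i j = (g k l \<cdot> f k l) \<cdot> tri_map A i j k l"
    by (rule comm_paste[OF flag_mapD(3)[OF f b(1,2)] flag_mapD(3)[OF g b(1,2)]
        tri_map_in[OF flag_mapD(1)[OF f] ij] tri_map_in[OF flag_mapD(2)[OF f] ij]
        tri_map_in[OF flag_mapD(2)[OF g] ij]
        flag_mapD(3)[OF f b(3,4)] flag_mapD(3)[OF g b(3,4)]
        flag_mapD(4)[OF f ij] flag_mapD(4)[OF g ij]])
qed

lemma hom_flag_category: "F \<in> hom (flag_category C z n) A B \<longleftrightarrow> (\<exists>f. F = (A, B, f) \<and> flag_map n A B f)"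
  unfolding hom_def flag_map_def by (auto simp: flag_category_def)

lemma flag_category_simps [simp]:
  "Obj (flag_category C z n) = flags C z n"
  "Dom (flag_category C z n) (A, B, f) = A"
  "Cod (flag_category C z n) (A, B, f) = B"
  "Ident (flag_category C z n) A = (A, A, tri_fam n (\<lambda>i j. Ident C (ob A i j)))"
  "(B', D, g) \<cdot>\<^bsub>flag_category C z n\<^esub> (A, B, f) = (A, D, tri_fam n (\<lambda>i j. g i j \<cdot> f i j))"
  by (simp_all add: flag_category_def)

lemma category_flag_category: "category (flag_category C z n)"
proof
  fix F assume "F \<in> Arr (flag_category C z n)"
  then obtain A B f where "F = (A, B, f)" "flag_map n A B f"
    by (cases F) (auto simp: flag_map_def)
  then show "Dom (flag_category C z n) F \<in> Obj (flag_category C z n)"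
    "Cod (flag_category C z n) F \<in> Obj (flag_category C z n)"
    using flag_mapD(1,2) by auto
next
  fix A assume "A \<in> Obj (flag_category C z n)"
  then show "Ident (flag_category C z n) A \<in> hom (flag_category C z n) A A"
    using flag_map_id by (simp add: hom_flag_category)
next
  fix F G A B D
  assume "F \<in> hom (flag_category C z n) A B" "G \<in> hom (flag_category C z n) B D"
  then show "G \<cdot>\<^bsub>flag_category C z n\<^esub> F \<in> hom (flag_category C z n) A D"
    using flag_map_comp by (auto simp: hom_flag_category)
next
  fix F A B assume "F \<in> hom (flag_category C z n) A B"
  then obtain f where F: "F = (A, B, f)" and f: "flag_map n A B f"
    by (auto simp: hom_flag_category)
  have "tri_fam n (\<lambda>i j. tri_fam n (\<lambda>i j. Ident C (ob B i j)) i j \<cdot> f i j) = f"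
    by (rule flag_map_ext[OF flag_map_comp[OF f flag_map_id[OF flag_mapD(2)[OF f]]] f])
      (simp add: tri_fam_apply Ident_left[OF flag_mapD(3)[OF f]])
  then show "Ident (flag_category C z n) B \<cdot>\<^bsub>flag_category C z n\<^esub> F = F" by (simp add: F)
  have "tri_fam n (\<lambda>i j. f i j \<cdot> tri_fam n (\<lambda>i j. Ident C (ob A i j)) i j) = f"
    by (rule flag_map_ext[OF flag_map_comp[OF flag_map_id[OF flag_mapD(1)[OF f]] f] f])
      (simp add: tri_fam_apply Ident_right[OF flag_mapD(3)[OF f]])
  then show "F \<cdot>\<^bsub>flag_category C z n\<^esub> Ident (flag_category C z n) A = F" by (simp add: F)
next
  fix F G H A B D E
  assume "F \<in> hom (flag_category C z n) A B" "G \<in> hom (flag_category C z n) B D"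
    "H \<in> hom (flag_category C z n) D E"
  then obtain f g h where F: "F = (A, B, f)" and G: "G = (B, D, g)" and H: "H = (D, E, h)"
    and f: "flag_map n A B f" and g: "flag_map n B D g" and h: "flag_map n D E h"
    by (auto simp: hom_flag_category)
  have "tri_fam n (\<lambda>i j. tri_fam n (\<lambda>i j. h i j \<cdot> g i j) i j \<cdot> f i j) =
      tri_fam n (\<lambda>i j. h i j \<cdot> tri_fam n (\<lambda>i j. g i j \<cdot> f i j) i j)"
    by (rule flag_map_ext[OF flag_map_comp[OF f flag_map_comp[OF g h]]
          flag_map_comp[OF flag_map_comp[OF f g] h]])
      (simp add: tri_fam_apply Comp_assoc[OF flag_mapD(3)[OF f] flag_mapD(3)[OF g] flag_mapD(3)[OF h]])
  then show "(H \<cdot>\<^bsub>flag_category C z n\<^esub> G) \<cdot>\<^bsub>flag_category C z n\<^esub> F =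
      H \<cdot>\<^bsub>flag_category C z n\<^esub> G \<cdot>\<^bsub>flag_category C z n\<^esub> F"
    by (simp add: F G H)
qed

lemma flag_isoI:
  assumes f: "flag_map n A B f" and g: "flag_map n B A g"
    and gf: "\<And>i j. i \<le> j \<Longrightarrow> j \<le> n \<Longrightarrow> g i j \<cdot> f i j = Ident C (ob A i j)"
    and fg: "\<And>i j. i \<le> j \<Longrightarrow> j \<le> n \<Longrightarrow> f i j \<cdot> g i j = Ident C (ob B i j)"
  shows "is_iso (flag_category C z n) (A, B, f)"
proof -
  interpret K: category "flag_category C z n" by (rule category_flag_category)
  have "tri_fam n (\<lambda>i j. g i j \<cdot> f i j) = tri_fam n (\<lambda>i j. Ident C (ob A i j))"
    "tri_fam n (\<lambda>i j. f i j \<cdot> g i j) = tri_fam n (\<lambda>i j. Ident C (ob B i j))"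
    using gf fg by (auto simp: tri_fam_def fun_eq_iff)
  moreover have "(A, B, f) \<in> hom (flag_category C z n) A B" "(B, A, g) \<in> hom (flag_category C z n) B A"
    using f g by (auto simp: hom_flag_category)
  ultimately show ?thesis
    using K.is_iso_iff by fastforce
qed

lemma flag_isoE:
  assumes f: "is_iso (flag_category C z n) (A, B, f)"
  obtains g where "flag_map n A B f" "flag_map n B A g"
    "\<And>i j. i \<le> j \<Longrightarrow> j \<le> n \<Longrightarrow> g i j \<cdot> f i j = Ident C (ob A i j)"
    "\<And>i j. i \<le> j \<Longrightarrow> j \<le> n \<Longrightarrow> f i j \<cdot> g i j = Ident C (ob B i j)"
proof -
  interpret K: category "flag_category C z n" by (rule category_flag_category)
  have fm: "flag_map n A B f" using f by (simp add: is_iso_def flag_map_def)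
  have "(A, B, f) \<in> hom (flag_category C z n) A B" using fm by (auto simp: hom_flag_category)
  with f obtain G where "G \<in> hom (flag_category C z n) B A"
    "G \<cdot>\<^bsub>flag_category C z n\<^esub> (A, B, f) = Ident (flag_category C z n) A"
    "(A, B, f) \<cdot>\<^bsub>flag_category C z n\<^esub> G = Ident (flag_category C z n) B"
    using K.is_iso_iff by blast
  then obtain g where g: "flag_map n B A g"
    and gf: "tri_fam n (\<lambda>i j. g i j \<cdot> f i j) = tri_fam n (\<lambda>i j. Ident C (ob A i j))"
      "tri_fam n (\<lambda>i j. f i j \<cdot> g i j) = tri_fam n (\<lambda>i j. Ident C (ob B i j))"
    by (auto simp: hom_flag_category)
  have "g i j \<cdot> f i j = Ident C (ob A i j)" "f i j \<cdot> g i j = Ident C (ob B i j)"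
    if "i \<le> j" "j \<le> n" for i j
    using fun_cong[OF fun_cong[OF gf(1)], of i j] fun_cong[OF fun_cong[OF gf(2)], of i j] that
    by (simp_all add: tri_fam_apply)
  then show ?thesis using that fm g by blast
qed

lemma flag_iso_map: "is_iso (flag_category C z n) (A, B, f) \<Longrightarrow> flag_map n A B f"
  by (erule flag_isoE)

lemma flag_iso_component:
  assumes "is_iso (flag_category C z n) (A, B, f)" "i \<le> j" "j \<le> n"
  shows "is_iso C (f i j)"
  using assms(1)
proof (rule flag_isoE)
  fix g assume f: "flag_map n A B f" and g: "flag_map n B A g"
    "\<And>i j. i \<le> j \<Longrightarrow> j \<le> n \<Longrightarrow> g i j \<cdot> f i j = Ident C (ob A i j)"
    "\<And>i j. i \<le> j \<Longrightarrow> j \<le> n \<Longrightarrow> f i j \<cdot> g i j = Ident C (ob B i j)"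
  then show ?thesis
    using is_iso_iff[OF flag_mapD(3)[OF f assms(2,3)]] flag_mapD(3)[OF g(1) assms(2,3)]
      g(2,3)[OF assms(2,3)] by blast
qed

section \<open>Restriction functors and the simplicial identities\<close>

lemma flag_map_pull:
  assumes f: "flag_map n A B f" and a: "\<alpha> \<in> Delta m n"
  shows "flag_map m (tri_pull C m \<alpha> A) (tri_pull C m \<alpha> B) (tri_fam m (\<lambda>i j. f (\<alpha> i) (\<alpha> j)))"
  using Delta_mono[OF a] Delta_le[OF a] flag_mapD[OF f] tri_pull_in[OF _ a]
  by (intro flag_mapI) (simp_all add: ob_tri_pull tri_map_tri_pull[OF _ a])

lemma flag_pull_simps [simp]:
  "on_obj (flag_pull C m \<alpha>) = tri_pull C m \<alpha>"
  "on_arr (flag_pull C m \<alpha>) (A, B, f) =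
    (tri_pull C m \<alpha> A, tri_pull C m \<alpha> B, tri_fam m (\<lambda>i j. f (\<alpha> i) (\<alpha> j)))"
  by (simp_all add: flag_pull_def)

lemma flag_pull_functor:
  assumes a: "\<alpha> \<in> Delta m n"
  shows "is_functor (flag_category C z n) (flag_category C z m) (flag_pull C m \<alpha>)"
  unfolding is_functor_def
proof (intro conjI allI ballI)
  fix A B F assume "F \<in> hom (flag_category C z n) A B"
  then show "on_arr (flag_pull C m \<alpha>) F
      \<in> hom (flag_category C z m) (on_obj (flag_pull C m \<alpha>) A) (on_obj (flag_pull C m \<alpha>) B)"
    using flag_map_pull[OF _ a] by (auto simp: hom_flag_category)
qed (use Delta_mono[OF a] Delta_le[OF a] tri_pull_in[OF _ a]
    in \<open>auto simp: hom_flag_category ob_tri_pull tri_fam_def fun_eq_iff\<close>)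

lemma tri_pull_id:
  assumes A: "A \<in> flags C z n"
  shows "tri_pull C n (\<lambda>k\<in>{..n}. k) A = A"
proof -
  have "(\<lambda>k\<in>{..n}. k) \<in> Delta n n" by (auto simp: Delta_def mono_on_def)
  from tri_pull_in[OF A this] tri_map_tri_pull[OF A this] show ?thesis
    by (intro flag_eqI[OF _ A]) (simp_all add: ob_tri_pull)
qed

lemma DeltaI:
  assumes "\<And>i. i \<le> m \<Longrightarrow> \<alpha> i \<le> n" "\<And>i j. i \<le> j \<Longrightarrow> j \<le> m \<Longrightarrow> \<alpha> i \<le> \<alpha> j"
    and "\<alpha> \<in> extensional {..m}"
  shows "\<alpha> \<in> Delta m n"
  using assms by (auto simp: Delta_def mono_on_def PiE_iff)

lemma Delta_compose:
  assumes a: "\<alpha> \<in> Delta l m" and b: "\<beta> \<in> Delta m n"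
  shows "compose {..l} \<beta> \<alpha> \<in> Delta l n"
  using Delta_mono[OF a] Delta_le[OF a] Delta_mono[OF b] Delta_le[OF b]
  by (intro DeltaI compose_extensional) (simp_all add: compose_eq)

lemma tri_pull_compose:
  assumes A: "A \<in> flags C z n" and a: "\<alpha> \<in> Delta l m" and b: "\<beta> \<in> Delta m n"
  shows "tri_pull C l \<alpha> (tri_pull C m \<beta> A) = tri_pull C l (compose {..l} \<beta> \<alpha>) A"
  using tri_pull_in[OF A b] tri_pull_in[OF tri_pull_in[OF A b] a]
    tri_pull_in[OF A Delta_compose[OF a b]] Delta_mono[OF a] Delta_le[OF a]
  by (intro flag_eqI[where n = l])
    (simp_all add: ob_tri_pull tri_map_tri_pull[OF _ a] tri_map_tri_pull[OF A b]
      tri_map_tri_pull[OF A Delta_compose[OF a b]] compose_eq)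

lemma flag_arr_cases:
  assumes "F \<in> Arr (core (flag_category C z n))"
  obtains A B f where "F = (A, B, f)" "flag_map n A B f"
proof (cases F)
  case (fields A B f)
  then show ?thesis using that flag_iso_map assms by (auto simp: Arr_core)
qed

lemma flag_pull_id:
  "functor_eq (core (flag_category C z n)) (flag_pull C n (\<lambda>k\<in>{..n}. k)) id_functor"
  unfolding functor_eq_def
proof (intro conjI ballI)
  fix F assume "F \<in> Arr (core (flag_category C z n))"
  then obtain A B f where F: "F = (A, B, f)" and f: "flag_map n A B f" by (rule flag_arr_cases)
  have "tri_fam n (\<lambda>i j. f ((\<lambda>k\<in>{..n}. k) i) ((\<lambda>k\<in>{..n}. k) j)) = f"
    using flag_mapD(5)[OF f] by (auto simp: tri_fam_def fun_eq_iff)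
  then show "on_arr (flag_pull C n (\<lambda>k\<in>{..n}. k)) F = on_arr id_functor F"
    using tri_pull_id flag_mapD(1,2)[OF f] by (simp add: F id_functor_def)
qed (simp add: tri_pull_id id_functor_def)

lemma flag_pull_compose:
  assumes a: "\<alpha> \<in> Delta l m" and b: "\<beta> \<in> Delta m n"
  shows "functor_eq (core (flag_category C z n)) (flag_pull C l (compose {..l} \<beta> \<alpha>))
    (comp_functor (flag_pull C l \<alpha>) (flag_pull C m \<beta>))"
  unfolding functor_eq_def
proof (intro conjI ballI)
  fix F assume "F \<in> Arr (core (flag_category C z n))"
  then obtain A B f where F: "F = (A, B, f)" and f: "flag_map n A B f" by (rule flag_arr_cases)
  have "tri_fam l (\<lambda>i j. f (compose {..l} \<beta> \<alpha> i) (compose {..l} \<beta> \<alpha> j)) =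
      tri_fam l (\<lambda>i j. tri_fam m (\<lambda>i j. f (\<beta> i) (\<beta> j)) (\<alpha> i) (\<alpha> j))"
    using Delta_mono[OF a] Delta_le[OF a] by (auto simp: tri_fam_def fun_eq_iff compose_def)
  then show "on_arr (flag_pull C l (compose {..l} \<beta> \<alpha>)) F =
      on_arr (comp_functor (flag_pull C l \<alpha>) (flag_pull C m \<beta>)) F"
    using tri_pull_compose[OF _ a b] flag_mapD(1,2)[OF f] by (simp add: F comp_functor_def)
qed (simp add: tri_pull_compose[OF _ a b] comp_functor_def)

lemma flag_simplicial_simps [simp]:
  "cells (flag_simplicial C z) n = core (flag_category C z n)"
  "act (flag_simplicial C z) m n \<alpha> = flag_pull C m \<alpha>"
  by (simp_all add: flag_simplicial_def)

lemma flag_simplicial_groupoid: "simplicial_groupoid (flag_simplicial C z)"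
proof (rule simplicial_groupoid.intro)
  show "groupoid (cells (flag_simplicial C z) n)" for n
    using category.core_groupoid[OF category_flag_category] by simp
qed (simp_all add: functor_core[OF category_flag_category flag_pull_functor] flag_pull_id
    flag_pull_compose)

end

section \<open>Flags and filtrations\<close>

context pointed_proto_abelian
begin

text \<open>The components on the top row are determined because \<open>ob B 0 k\<close> embeds in
  \<open>ob B 0 n\<close>, and then all others because \<open>ob A 0 j\<close> maps onto
  \<open>ob A i j\<close> by an epimorphism.\<close>

lemma flag_map_eqI:
  assumes f: "flag_map n A B f" and g: "flag_map n A B g" and eq: "f 0 n = g 0 n"
  shows "f = g"
proof (rule flag_map_ext[OF f g])
  note DA = tri_diag_flag[OF flag_mapD(1)[OF f]] and DB = tri_diag_flag[OF flag_mapD(2)[OF f]]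
  have top: "f 0 k = g 0 k" if k: "k \<le> n" for k
  proof (rule mono_cancel)
    show "is_mono C (tri_map B 0 k 0 n)" using tri_diag_mono[OF DB] k by simp
    show "tri_map B 0 k 0 n \<in> hom C (ob B 0 k) (ob B 0 n)" using tri_diagD(4)[OF DB] k by simp
    show "f 0 k \<in> hom C (ob A 0 k) (ob B 0 k)" "g 0 k \<in> hom C (ob A 0 k) (ob B 0 k)"
      using flag_mapD(3)[OF f] flag_mapD(3)[OF g] k by simp_all
    show "tri_map B 0 k 0 n \<cdot> f 0 k = tri_map B 0 k 0 n \<cdot> g 0 k"
      using flag_mapD(4)[OF f, of 0 k 0 n] flag_mapD(4)[OF g, of 0 k 0 n] eq k by simp
  qed
  fix i j assume ij: "i \<le> j" "j \<le> n"
  show "f i j = g i j"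
  proof (rule epi_cancel)
    show "is_epi C (tri_map A 0 j i j)" using tri_diag_epi[OF DA] ij by simp
    show "tri_map A 0 j i j \<in> hom C (ob A 0 j) (ob A i j)" using tri_diagD(4)[OF DA] ij by simp
    show "f i j \<in> hom C (ob A i j) (ob B i j)" "g i j \<in> hom C (ob A i j) (ob B i j)"
      using flag_mapD(3)[OF f] flag_mapD(3)[OF g] ij by simp_all
    show "f i j \<cdot> tri_map A 0 j i j = g i j \<cdot> tri_map A 0 j i j"
      using flag_mapD(4)[OF f, of 0 j i j] flag_mapD(4)[OF g, of 0 j i j] top[of j] ij by simp
  qed
qed

text \<open>\<open>F\<close> is the candidate top row. The remaining components are induced on the
  quotients \<open>ob A i j\<close> of \<open>ob A 0 j\<close>, and their naturality is tested on
  the epimorphisms from the top row.\<close>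

lemma flag_map_extend:
  assumes A: "A \<in> flags C z n" and B: "B \<in> flags C z n"
    and F: "\<And>k. k \<le> n \<Longrightarrow> F k \<in> hom C (ob A 0 k) (ob B 0 k)"
    and comm: "\<And>k. k \<le> n \<Longrightarrow> tri_map B 0 k 0 n \<cdot> F k = F n \<cdot> tri_map A 0 k 0 n"
  obtains f where "flag_map n A B f" "\<And>k. k \<le> n \<Longrightarrow> f 0 k = F k"
proof -
  note DA = tri_diag_flag[OF A] and DB = tri_diag_flag[OF B]
  \<comment> \<open>Compatibility with the largest object forces compatibility between any two
    steps, since \<open>ob B 0 l\<close> embeds in \<open>ob B 0 n\<close>.\<close>
  have top: "tri_map B 0 k 0 l \<cdot> F k = F l \<cdot> tri_map A 0 k 0 l" if kl: "k \<le> l" "l \<le> n" for k l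
  proof (rule mono_cancel)
    have Fk: "F k \<in> hom C (ob A 0 k) (ob B 0 k)" and Fl: "F l \<in> hom C (ob A 0 l) (ob B 0 l)"
      and Fn: "F n \<in> hom C (ob A 0 n) (ob B 0 n)" using F kl by simp_all
    have a: "tri_map A 0 k 0 l \<in> hom C (ob A 0 k) (ob A 0 l)"
        "tri_map A 0 l 0 n \<in> hom C (ob A 0 l) (ob A 0 n)"
      and b: "tri_map B 0 k 0 l \<in> hom C (ob B 0 k) (ob B 0 l)"
        "tri_map B 0 l 0 n \<in> hom C (ob B 0 l) (ob B 0 n)"
      using tri_diagD(4)[OF DA] tri_diagD(4)[OF DB] kl by simp_all
    show "is_mono C (tri_map B 0 l 0 n)" using tri_diag_mono[OF DB] kl by simp
    show "tri_map B 0 l 0 n \<in> hom C (ob B 0 l) (ob B 0 n)" by fact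
    show "tri_map B 0 k 0 l \<cdot> F k \<in> hom C (ob A 0 k) (ob B 0 l)"
      "F l \<cdot> tri_map A 0 k 0 l \<in> hom C (ob A 0 k) (ob B 0 l)"
      using Comp_in[OF Fk b(1)] Comp_in[OF a(1) Fl] by auto
    have "tri_map B 0 l 0 n \<cdot> tri_map B 0 k 0 l \<cdot> F k = tri_map B 0 k 0 n \<cdot> F k"
      using Comp_assoc[OF Fk b] tri_diagD(5)[OF DB, of 0 k 0 l 0 n] kl by simp
    also have "\<dots> = F n \<cdot> tri_map A 0 l 0 n \<cdot> tri_map A 0 k 0 l"
      using tri_diagD(5)[OF DA, of 0 k 0 l 0 n] comm[of k] kl by simp
    also have "\<dots> = tri_map B 0 l 0 n \<cdot> F l \<cdot> tri_map A 0 k 0 l"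
      using Comp_assoc[OF a Fn] Comp_assoc[OF a(1) Fl b(2)] comm[of l] kl by simp
    finally show "tri_map B 0 l 0 n \<cdot> tri_map B 0 k 0 l \<cdot> F k =
      tri_map B 0 l 0 n \<cdot> F l \<cdot> tri_map A 0 k 0 l" .
  qed
  \<comment> \<open>Since \<open>ob A i j\<close> is the pushout of \<open>ob A 0 j\<close> and
    \<open>z\<close> under \<open>ob A 0 i\<close>, it suffices that the composite of
    \<open>F j\<close> with the map to \<open>ob B i j\<close> factors through \<open>z\<close> on
    \<open>ob A 0 i\<close>. It does, because \<open>F\<close> sends \<open>ob A 0 i\<close> to
    \<open>ob B 0 i\<close>.\<close>
  have "\<exists>g. g \<in> hom C (ob A i j) (ob B i j) \<and> g \<cdot> tri_map A 0 j i j = tri_map B 0 j i j \<cdot> F j"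
    if ij: "i \<le> j" "j \<le> n" for i j
  proof -
    have Fi: "F i \<in> hom C (ob A 0 i) (ob B 0 i)" and Fj: "F j \<in> hom C (ob A 0 j) (ob B 0 j)"
      using F ij by simp_all
    have a: "tri_map A 0 i 0 j \<in> hom C (ob A 0 i) (ob A 0 j)"
        "tri_map A 0 i i i \<in> hom C (ob A 0 i) z"
      and b: "tri_map B 0 i 0 j \<in> hom C (ob B 0 i) (ob B 0 j)"
        "tri_map B 0 j i j \<in> hom C (ob B 0 j) (ob B i j)"
        "tri_map B 0 i i i \<in> hom C (ob B 0 i) z"
        "tri_map B i i i j \<in> hom C z (ob B i j)"
      using tri_diagD(4)[OF DA, of 0 i 0 j] tri_diagD(4)[OF DA, of 0 i i i]
        tri_diagD(4)[OF DB, of 0 i 0 j] tri_diagD(4)[OF DB, of 0 i i i]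
        tri_diagD(4)[OF DB, of 0 j i j] tri_diagD(4)[OF DB, of i i i j]
        tri_diagD(1)[OF DA, of i] tri_diagD(1)[OF DB, of i] ij by simp_all
    have "(tri_map B 0 j i j \<cdot> F j) \<cdot> tri_map A 0 i 0 j = tri_map B 0 j i j \<cdot> tri_map B 0 i 0 j \<cdot> F i"
      using Comp_assoc[OF a(1) Fj b(2)] top[OF ij] by simp
    also have "\<dots> = tri_map B i i i j \<cdot> tri_map B 0 i i i \<cdot> F i"
      using Comp_assoc[OF Fi b(1) b(2)] Comp_assoc[OF Fi b(3) b(4)]
        tri_diagD(5)[OF DB, of 0 i 0 j i j] tri_diagD(5)[OF DB, of 0 i i i i j] ij by simp
    also have "tri_map B 0 i i i \<cdot> F i = tri_map A 0 i i i"
      using to_zero_unique Comp_in[OF Fi b(3)] a(2) by blast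
    finally have eq: "(tri_map B 0 j i j \<cdot> F j) \<cdot> tri_map A 0 i 0 j =
      tri_map B i i i j \<cdot> tri_map A 0 i i i" .
    have "bic (ob A 0 i) (ob A 0 j) z (ob A i j) (tri_map A 0 i 0 j) (tri_map A 0 i i i)
      (tri_map A 0 j i j) (tri_map A i i i j)"
      using tri_diagD(6)[OF DA, of 0 i i j] tri_diagD(1)[OF DA, of i] ij by simp
    from bic_push[OF this Comp_in[OF Fj b(2)] b(4) eq] show ?thesis by metis
  qed
  then obtain g where g: "\<And>i j. i \<le> j \<Longrightarrow> j \<le> n \<Longrightarrow> g i j \<in> hom C (ob A i j) (ob B i j)"
    and gF: "\<And>i j. i \<le> j \<Longrightarrow> j \<le> n \<Longrightarrow> g i j \<cdot> tri_map A 0 j i j = tri_map B 0 j i j \<cdot> F j"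
    by metis
  have g0: "g 0 k = F k" if k: "k \<le> n" for k
  proof -
    have "g 0 k \<cdot> Ident C (ob A 0 k) = Ident C (ob B 0 k) \<cdot> F k"
      using gF[of 0 k] tri_diagD(3)[OF DA, of 0 k] tri_diagD(3)[OF DB, of 0 k] k by simp
    then show ?thesis using Ident_right[OF g, of 0 k] Ident_left[OF F, of k] k by simp
  qed
  have "flag_map n A B (tri_fam n g)"
  proof (rule flag_mapI[OF A B g])
    fix i j k l assume ij: "i \<le> j" "k \<le> l" "i \<le> k" "j \<le> l" "l \<le> n"
    have Fj: "F j \<in> hom C (ob A 0 j) (ob B 0 j)" and Fl: "F l \<in> hom C (ob A 0 l) (ob B 0 l)"
      using F ij by simp_all
    have gij: "g i j \<in> hom C (ob A i j) (ob B i j)" and gkl: "g k l \<in> hom C (ob A k l) (ob B k l)"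
      using g ij by simp_all
    have a: "tri_map A 0 j i j \<in> hom C (ob A 0 j) (ob A i j)"
        "tri_map A i j k l \<in> hom C (ob A i j) (ob A k l)"
        "tri_map A 0 j 0 l \<in> hom C (ob A 0 j) (ob A 0 l)"
        "tri_map A 0 l k l \<in> hom C (ob A 0 l) (ob A k l)"
      and b: "tri_map B 0 j i j \<in> hom C (ob B 0 j) (ob B i j)"
        "tri_map B i j k l \<in> hom C (ob B i j) (ob B k l)"
        "tri_map B 0 j 0 l \<in> hom C (ob B 0 j) (ob B 0 l)"
        "tri_map B 0 l k l \<in> hom C (ob B 0 l) (ob B k l)"
      using tri_diagD(4)[OF DA] tri_diagD(4)[OF DB] ij by simp_all
    show "tri_map B i j k l \<cdot> g i j = g k l \<cdot> tri_map A i j k l"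
    proof (rule epi_cancel[OF _ a(1)])
      show "is_epi C (tri_map A 0 j i j)" using tri_diag_epi[OF DA] ij by simp
      show "tri_map B i j k l \<cdot> g i j \<in> hom C (ob A i j) (ob B k l)"
        "g k l \<cdot> tri_map A i j k l \<in> hom C (ob A i j) (ob B k l)"
        using Comp_in[OF gij b(2)] Comp_in[OF a(2) gkl] by auto
      have "(tri_map B i j k l \<cdot> g i j) \<cdot> tri_map A 0 j i j =
          (tri_map B i j k l \<cdot> tri_map B 0 j i j) \<cdot> F j"
        using Comp_assoc[OF a(1) gij b(2)] Comp_assoc[OF Fj b(1) b(2)] gF[of i j] ij by simp
      also have "\<dots> = (tri_map B 0 l k l \<cdot> tri_map B 0 j 0 l) \<cdot> F j"
        using tri_diagD(5)[OF DB, of 0 j i j k l] tri_diagD(5)[OF DB, of 0 j 0 l k l] ij by simp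
      also have "\<dots> = tri_map B 0 l k l \<cdot> F l \<cdot> tri_map A 0 j 0 l"
        using Comp_assoc[OF Fj b(3) b(4)] top[of j l] ij by simp
      also have "\<dots> = g k l \<cdot> tri_map A 0 l k l \<cdot> tri_map A 0 j 0 l"
        using Comp_assoc[OF a(3) Fl b(4)] Comp_assoc[OF a(3) a(4) gkl] gF[of k l] ij by simp
      also have "\<dots> = g k l \<cdot> tri_map A i j k l \<cdot> tri_map A 0 j i j"
        using tri_diagD(5)[OF DA, of 0 j i j k l] tri_diagD(5)[OF DA, of 0 j 0 l k l] ij by simp
      also have "\<dots> = (g k l \<cdot> tri_map A i j k l) \<cdot> tri_map A 0 j i j"
        using Comp_assoc[OF a(1) a(2) gkl] by simp
      finally show "(tri_map B i j k l \<cdot> g i j) \<cdot> tri_map A 0 j i j =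
        (g k l \<cdot> tri_map A i j k l) \<cdot> tri_map A 0 j i j" .
    qed
  qed
  then show ?thesis using that[of "tri_fam n g"] g0 by (simp add: tri_fam_apply)
qed

lemma flag_iso_of_inverse_top:
  assumes f: "flag_map n A B f" and g: "flag_map n B A g"
    and gf: "g 0 n \<cdot> f 0 n = Ident C (ob A 0 n)" and fg: "f 0 n \<cdot> g 0 n = Ident C (ob B 0 n)"
  shows "is_iso (flag_category C z n) (A, B, f)"
proof -
  have "tri_fam n (\<lambda>i j. g i j \<cdot> f i j) = tri_fam n (\<lambda>i j. Ident C (ob A i j))"
    by (rule flag_map_eqI[OF flag_map_comp[OF f g] flag_map_id[OF flag_mapD(1)[OF f]]])
      (simp add: tri_fam_apply gf)
  moreover have "tri_fam n (\<lambda>i j. f i j \<cdot> g i j) = tri_fam n (\<lambda>i j. Ident C (ob B i j))"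
    by (rule flag_map_eqI[OF flag_map_comp[OF g f] flag_map_id[OF flag_mapD(2)[OF f]]])
      (simp add: tri_fam_apply fg)
  ultimately have "g i j \<cdot> f i j = Ident C (ob A i j)" "f i j \<cdot> g i j = Ident C (ob B i j)"
    if "i \<le> j" "j \<le> n" for i j
    using that by (auto simp: tri_fam_def fun_eq_iff split: if_splits)
  then show ?thesis by (rule flag_isoI[OF f g])
qed

text \<open>The inverses of the \<open>F k\<close> again respect the filtrations, by conjugating
  \<open>comm\<close>, and so extend to a map of flags back. The two extensions are inverse to each
  other because this holds at the largest object.\<close>

lemma flag_iso_extend:
  assumes A: "A \<in> flags C z n" and B: "B \<in> flags C z n"
    and F: "\<And>k. k \<le> n \<Longrightarrow> F k \<in> hom C (ob A 0 k) (ob B 0 k)"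
    and iso: "\<And>k. k \<le> n \<Longrightarrow> is_iso C (F k)"
    and comm: "\<And>k. k \<le> n \<Longrightarrow> tri_map B 0 k 0 n \<cdot> F k = F n \<cdot> tri_map A 0 k 0 n"
  obtains f where "is_iso (flag_category C z n) (A, B, f)" "\<And>k. k \<le> n \<Longrightarrow> f 0 k = F k"
proof -
  note DA = tri_diag_flag[OF A] and DB = tri_diag_flag[OF B]
  have "\<exists>G. G \<in> hom C (ob B 0 k) (ob A 0 k) \<and> G \<cdot> F k = Ident C (ob A 0 k) \<and>
    F k \<cdot> G = Ident C (ob B 0 k)" if "k \<le> n" for k
    using is_iso_iff[OF F] iso that by blast
  then obtain G where G: "\<And>k. k \<le> n \<Longrightarrow> G k \<in> hom C (ob B 0 k) (ob A 0 k)"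
    and GF: "\<And>k. k \<le> n \<Longrightarrow> G k \<cdot> F k = Ident C (ob A 0 k)"
    and FG: "\<And>k. k \<le> n \<Longrightarrow> F k \<cdot> G k = Ident C (ob B 0 k)"
    by metis
  obtain f where f: "flag_map n A B f" "\<And>k. k \<le> n \<Longrightarrow> f 0 k = F k"
    using flag_map_extend[OF A B F comm] by blast
  have comm': "tri_map A 0 k 0 n \<cdot> G k = G n \<cdot> tri_map B 0 k 0 n" if k: "k \<le> n" for k
  proof -
    have a: "tri_map A 0 k 0 n \<in> hom C (ob A 0 k) (ob A 0 n)"
      and b: "tri_map B 0 k 0 n \<in> hom C (ob B 0 k) (ob B 0 n)"
      using tri_diagD(4)[OF DA] tri_diagD(4)[OF DB] k by simp_all
    note c = F[OF k] G[OF k] F[OF order_refl] G[OF order_refl]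
    have "tri_map A 0 k 0 n \<cdot> G k = ((G n \<cdot> F n) \<cdot> tri_map A 0 k 0 n) \<cdot> G k"
      using GF[OF order_refl] Ident_left[OF a] by simp
    also have "\<dots> = (G n \<cdot> tri_map B 0 k 0 n \<cdot> F k) \<cdot> G k"
      using Comp_assoc[OF a c(3) c(4)] comm[OF k] by simp
    also have "\<dots> = (G n \<cdot> tri_map B 0 k 0 n) \<cdot> F k \<cdot> G k"
      using Comp_assoc[OF c(1) b c(4)] Comp_assoc[OF c(2) c(1) Comp_in[OF b c(4)]] by simp
    also have "\<dots> = G n \<cdot> tri_map B 0 k 0 n"
      using FG[OF k] Ident_right[OF Comp_in[OF b c(4)]] by simp
    finally show ?thesis .
  qed
  obtain g where g: "flag_map n B A g" "\<And>k. k \<le> n \<Longrightarrow> g 0 k = G k"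
    using flag_map_extend[OF B A G comm'] by blast
  have "is_iso (flag_category C z n) (A, B, f)"
    using flag_iso_of_inverse_top[OF f(1) g(1)] f(2) g(2) GF FG by simp
  with f(2) show ?thesis using that by blast
qed

section \<open>The flag of a filtration\<close>

text \<open>\<open>W\<close> is an ambient object in which the steps are compared; the largest
  object of \<open>E\<close> is \<open>X n\<close>. The entry \<open>(k, l)\<close> of
  \<open>E\<close> is the quotient of \<open>X l\<close> by \<open>X k\<close>. The last conclusion
  pins down the maps of the top row, since \<open>s l\<close> is a monomorphism.\<close>

lemma filtration_flag:
  assumes s: "\<And>k. k \<le> n \<Longrightarrow> s k \<in> hom C (X k) W" and s_mono: "\<And>k. k \<le> n \<Longrightarrow> is_mono C (s k)"
    and step: "\<And>k. k < n \<Longrightarrow> \<exists>x \<in> hom C (X k) (X (Suc k)). s (Suc k) \<cdot> x = s k"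
    and X0: "X 0 = z"
  obtains E where "E \<in> flags C z n" "\<And>k. k \<le> n \<Longrightarrow> ob E 0 k = X k"
    "\<And>k l. k \<le> l \<Longrightarrow> l \<le> n \<Longrightarrow> s l \<cdot> tri_map E 0 k 0 l = s k"
proof -
  have X: "X k \<in> Obj C" if "k \<le> n" for k using hom_obj(1)[OF s[OF that]] .
  have "\<exists>x. x \<in> hom C (X k) (X l) \<and> s l \<cdot> x = s k" if "k \<le> l" "l \<le> n" for k l
    using that
  proof (induction l rule: dec_induct)
    case base
    then show ?case using Ident_in[OF X] Ident_right[OF s] by blast
  next
    case (step l)
    then obtain x where x: "x \<in> hom C (X k) (X l)" "s l \<cdot> x = s k" by auto
    obtain y where y: "y \<in> hom C (X l) (X (Suc l))" "s (Suc l) \<cdot> y = s l"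
      using assms(3)[of l] step by auto
    have "s (Suc l) \<cdot> y \<cdot> x = s k"
      using Comp_assoc[OF x(1) y(1) s[of "Suc l"]] x y step by simp
    then show ?case using Comp_in[OF x(1) y(1)] by blast
  qed
  then obtain x where x: "\<And>k l. k \<le> l \<Longrightarrow> l \<le> n \<Longrightarrow> x k l \<in> hom C (X k) (X l)"
    and sx: "\<And>k l. k \<le> l \<Longrightarrow> l \<le> n \<Longrightarrow> s l \<cdot> x k l = s k" by metis
  \<comment> \<open>All laws for the chosen inclusions \<open>x\<close> hold because they hold after
    the monomorphisms \<open>s\<close> into \<open>W\<close>.\<close>
  have x_mono: "is_mono C (x k l)" if "k \<le> l" "l \<le> n" for k l
    using mono_of_comp[OF _ x s] sx s_mono that by simp
  have x_id: "x k k = Ident C (X k)" if "k \<le> n" for k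
    using mono_cancel[OF s_mono s x Ident_in[OF X]] sx Ident_right[OF s] that by simp
  have x_comp: "x l p \<cdot> x k l = x k p" if kl: "k \<le> l" "l \<le> p" "p \<le> n" for k l p
  proof (rule mono_cancel[OF s_mono s])
    show "p \<le> n" "p \<le> n" by fact+
    have 1: "x k l \<in> hom C (X k) (X l)" and 2: "x l p \<in> hom C (X l) (X p)" using x kl by auto
    show "x l p \<cdot> x k l \<in> hom C (X k) (X p)" using Comp_in[OF 1 2] .
    show "x k p \<in> hom C (X k) (X p)" using x kl by simp
    show "s p \<cdot> x l p \<cdot> x k l = s p \<cdot> x k p"
      using Comp_assoc[OF 1 2 s[OF kl(3)]] sx kl by simp
  qed
  obtain a where a: "\<And>k. k \<le> n \<Longrightarrow> a k \<in> hom C (X k) z"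
    using to_zero_exists[OF X] by metis
  \<comment> \<open>The quotients are prescribed where strictness matters: \<open>z\<close> on the
    diagonal, as \<open>flags\<close> requires, and \<open>X l\<close> itself with the identity as
    projection in row \<open>0\<close>, so that the top row is the given filtration. At
    \<open>k = l = 0\<close> both prescriptions hold because \<open>X 0 = z\<close>.\<close>
  have "\<exists>Q p b. bic (X k) (X l) z Q (x k l) (a k) p b \<and> (k = l \<longrightarrow> Q = z) \<and>
    (k = 0 \<longrightarrow> Q = X l \<and> p = Ident C (X l))" if kl: "k \<le> l" "l \<le> n" for k l
  proof -
    consider "k = l" | "k = 0" "k \<noteq> l" | "k \<noteq> 0" "k \<noteq> l" by blast
    then show ?thesis
    proof cases
      case 1
      have "a 0 = Ident C z"
        using to_zero_unique[of "a 0" z "Ident C z"] a[of 0] Ident_in[of z] X[of 0] X0 by simp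
      moreover have "bic (X k) (X k) z z (Ident C (X k)) (a k) (a k) (Ident C z)"
        using bic_id_hor[OF a to_zero_epi[OF a]] kl by simp
      ultimately show ?thesis using 1 X0 x_id kl by auto
    next
      case 2
      have "a 0 = Ident C z"
        using to_zero_unique[of "a 0" z "Ident C z"] a[of 0] Ident_in[of z] X[of 0] X0 by simp
      then have "bic (X 0) (X l) z (X l) (x 0 l) (a 0) (Ident C (X l)) (x 0 l)"
        using bic_id_ver[OF x x_mono, of 0 l] X0 kl by simp
      then show ?thesis using 2 by auto
    next
      case 3
      have "k \<le> n" using kl by simp
      from bic_pushout_exists[OF x[OF kl] a[OF this] x_mono[OF kl] to_zero_epi[OF a[OF this]]]
      show ?thesis using 3 by metis
    qed
  qed
  then obtain Q p b
    where ses: "\<And>k l. k \<le> l \<Longrightarrow> l \<le> n \<Longrightarrow> bic (X k) (X l) z (Q k l) (x k l) (a k) (p k l) (b k l)"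
      and Q_diag: "\<And>k. k \<le> n \<Longrightarrow> Q k k = z"
      and Q0: "\<And>l. l \<le> n \<Longrightarrow> Q 0 l = X l" and p0: "\<And>l. l \<le> n \<Longrightarrow> p 0 l = Ident C (X l)"
    by (metis le0 order_refl)
  note p = bic_hom(3)[OF ses] and b = bic_hom(4)[OF ses] and p_epi = bic_hom(7)[OF ses]
  \<comment> \<open>The inclusion of \<open>X l\<close> in \<open>X l'\<close> descends to
    quotients: on \<open>X k\<close> its composite with the projection passes through
    \<open>X k'\<close>, hence through \<open>z\<close>.\<close>
  have "\<exists>m. m \<in> hom C (Q k l) (Q k' l') \<and> m \<cdot> p k l = p k' l' \<cdot> x l l'"
    if kl: "k \<le> l" "k' \<le> l'" "k \<le> k'" "l \<le> l'" "l' \<le> n" for k l k' l'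
  proof -
    have t: "x l l' \<in> hom C (X l) (X l')" "x k l \<in> hom C (X k) (X l)" "x k k' \<in> hom C (X k) (X k')"
      "x k' l' \<in> hom C (X k') (X l')" "p k' l' \<in> hom C (X l') (Q k' l')" "b k' l' \<in> hom C z (Q k' l')"
      "a k' \<in> hom C (X k') z" "a k \<in> hom C (X k) z"
      using x p b a kl by simp_all
    have "(p k' l' \<cdot> x l l') \<cdot> x k l = p k' l' \<cdot> x k' l' \<cdot> x k k'"
      using Comp_assoc[OF t(2) t(1) t(5)] x_comp kl by simp
    also have "\<dots> = (b k' l' \<cdot> a k') \<cdot> x k k'"
      using Comp_assoc[OF t(3) t(4) t(5)] bic_hom(9)[OF ses[of k' l']] kl by simp
    also have "\<dots> = b k' l' \<cdot> a k"
      using Comp_assoc[OF t(3) t(7) t(6)] to_zero_unique[OF Comp_in[OF t(3) t(7)] t(8)] by simp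
    finally have eq: "(p k' l' \<cdot> x l l') \<cdot> x k l = b k' l' \<cdot> a k" .
    have "l \<le> n" using kl by simp
    from bic_push[OF ses[OF kl(1) this] Comp_in[OF t(1) t(5)] t(6) eq] show ?thesis by metis
  qed
  then obtain M where M: "\<And>k l k' l'. k \<le> l \<Longrightarrow> k' \<le> l' \<Longrightarrow> k \<le> k' \<Longrightarrow> l \<le> l' \<Longrightarrow> l' \<le> n \<Longrightarrow>
      M k l k' l' \<in> hom C (Q k l) (Q k' l')"
    and Mp: "\<And>k l k' l'. k \<le> l \<Longrightarrow> k' \<le> l' \<Longrightarrow> k \<le> k' \<Longrightarrow> l \<le> l' \<Longrightarrow> l' \<le> n \<Longrightarrow>
      M k l k' l' \<cdot> p k l = p k' l' \<cdot> x l l'"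
    by metis
  have Q: "Q k l \<in> Obj C" if "k \<le> l" "l \<le> n" for k l using hom_obj(2)[OF p[OF that]] .
  have M_id: "M k l k l = Ident C (Q k l)" if kl: "k \<le> l" "l \<le> n" for k l
    using epi_cancel[OF p_epi[OF kl] p[OF kl] M Ident_in[OF Q[OF kl]]] Mp[of k l k l] kl
      x_id[of l] Ident_left[OF p[OF kl]] Ident_right[OF p[OF kl]] by simp
  have M_comp: "M k l p' q \<cdot> M i j k l = M i j p' q"
    if ij: "i \<le> j" "k \<le> l" "i \<le> k" "j \<le> l" "p' \<le> q" "k \<le> p'" "l \<le> q" "q \<le> n" for i j k l p' q
  proof -
    have t: "M k l p' q \<in> hom C (Q k l) (Q p' q)" "M i j k l \<in> hom C (Q i j) (Q k l)"
      "M i j p' q \<in> hom C (Q i j) (Q p' q)" "p i j \<in> hom C (X j) (Q i j)" "is_epi C (p i j)"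
      "p k l \<in> hom C (X l) (Q k l)" "p p' q \<in> hom C (X q) (Q p' q)"
      "x j l \<in> hom C (X j) (X l)" "x l q \<in> hom C (X l) (X q)"
      using M x p p_epi ij by simp_all
    have "M k l p' q \<cdot> M i j k l \<cdot> p i j = (p p' q \<cdot> x l q) \<cdot> x j l"
      using comm_paste[OF t(8) t(9) t(4) t(6) t(7) t(2) t(1) Mp[symmetric] Mp[symmetric]]
        Comp_assoc[OF t(8) t(9) t(7)] Comp_assoc[OF t(4) t(2) t(1)] ij by simp
    also have "\<dots> = M i j p' q \<cdot> p i j"
      using Comp_assoc[OF t(8) t(9) t(7)] x_comp[of j l q] Mp[of i j p' q] ij by simp
    finally have "(M k l p' q \<cdot> M i j k l) \<cdot> p i j = M i j p' q \<cdot> p i j"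
      using Comp_assoc[OF t(4) t(2) t(1)] by simp
    then show ?thesis using epi_cancel[OF t(5) t(4) Comp_in[OF t(2) t(1)] t(3)] by simp
  qed
  have M_epi: "is_epi C (M k l k' l)" if kl: "k \<le> k'" "k' \<le> l" "l \<le> n" for k l k'
  proof -
    have t: "p k l \<in> hom C (X l) (Q k l)" "p k' l \<in> hom C (X l) (Q k' l)" "is_epi C (p k' l)"
      "M k l k' l \<in> hom C (Q k l) (Q k' l)"
      using p p_epi M kl by simp_all
    have "M k l k' l \<cdot> p k l = p k' l"
      using Mp[of k l k' l] x_id[of l] Ident_right[OF t(2)] kl by simp
    with t show ?thesis using epi_of_comp[OF _ t(1) t(4)] by simp
  qed
  \<comment> \<open>Push \<open>X l \<rightarrow> X l'\<close> out along the projection of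
    \<open>X l\<close> to \<open>Q k l\<close>; the resulting \<open>m\<close> from
    \<open>Q k l\<close> to \<open>D\<close> is a monomorphism. Pasted with the square of
    \<open>Q k l\<close>, this makes \<open>D\<close> another quotient of \<open>X l'\<close> by
    \<open>X k\<close>, so there is \<open>w\<close> from \<open>Q k l'\<close> to \<open>D\<close>.
    Then \<open>m\<close> factors as \<open>w\<close> after the map in question, which is therefore
    a monomorphism.\<close>
  have M_mono: "is_mono C (M k l k l')" if kl: "k \<le> l" "l \<le> l'" "l' \<le> n" for k l l'
  proof -
    have t: "p k l \<in> hom C (X l) (Q k l)" "is_epi C (p k l)" "x l l' \<in> hom C (X l) (X l')"
      "is_mono C (x l l')" "M k l k l' \<in> hom C (Q k l) (Q k l')" "p k l' \<in> hom C (X l') (Q k l')"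
      using p p_epi M x x_mono kl by simp_all
    obtain D h m where D: "bic (X l) (X l') (Q k l) D (x l l') (p k l) h m"
      using bic_pushout_exists[OF t(3) t(1) t(4) t(2)] .
    note d = bic_hom[OF D]
    have "l \<le> n" using kl by simp
    note s1 = ses[OF kl(1) this]
    have "bic (X k) (X l') z D (x k l') (a k) h (m \<cdot> b k l)"
      using bic_paste_hor[OF s1 D] x_comp kl by simp
    note s2 = bic_hom[OF this]
    have "k \<le> l'" using kl by simp
    from bic_push[OF ses[OF this kl(3)] s2(3) s2(4) s2(9)]
    obtain w where w: "w \<in> hom C (Q k l') D" "w \<cdot> p k l' = h" by metis
    have "(w \<cdot> M k l k l') \<cdot> p k l = (w \<cdot> p k l') \<cdot> x l l'"
      using Comp_assoc[OF t(1) t(5) w(1)] Comp_assoc[OF t(3) t(6) w(1)] Mp[of k l k l'] kl by simp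
    also have "\<dots> = m \<cdot> p k l" using w d by simp
    finally have "w \<cdot> M k l k l' = m"
      using epi_cancel[OF t(2) t(1) Comp_in[OF t(5) w(1)] d(4)] by simp
    then show ?thesis using mono_of_comp[OF _ t(5) w(1)] d by simp
  qed
  \<comment> \<open>Dividing the inclusion of \<open>X j\<close> in \<open>X l\<close> by
    \<open>X k\<close>: the squares that define the two quotients are a left square and a rectangle,
    and cancelling the former leaves this one.\<close>
  have top: "bic (X j) (X l) (Q k j) (Q k l) (x j l) (p k j) (p k l) (M k j k l)"
    if kj: "k \<le> j" "j \<le> l" "l \<le> n" for k j l
  proof (rule bic_cancel_left)
    show s1: "bic (X k) (X j) z (Q k j) (x k j) (a k) (p k j) (b k j)" using ses kj by simp
    have s2: "bic (X k) (X l) z (Q k l) (x k l) (a k) (p k l) (b k l)" using ses kj by simp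
    show Mkj: "M k j k l \<in> hom C (Q k j) (Q k l)" using M kj by simp
    have "M k j k l \<cdot> b k j = b k l"
      using from_zero_unique[OF Comp_in[OF bic_hom(4)[OF s1] Mkj] bic_hom(4)[OF s2]] .
    with s2 show "bic (X k) (X l) z (Q k l) (x j l \<cdot> x k j) (a k) (p k l) (M k j k l \<cdot> b k j)"
      using x_comp kj by simp
    show "x j l \<in> hom C (X j) (X l)" "is_mono C (x j l)" using x x_mono kj by auto
    show "is_mono C (M k j k l)" using M_mono kj by simp
    show "p k l \<cdot> x j l = M k j k l \<cdot> p k j" using Mp kj by simp
  qed
  \<comment> \<open>Dividing by \<open>X k\<close> factors through dividing by \<open>X i\<close>,
    so the rectangle is the lower part of a \<open>top\<close> square for \<open>k\<close> whose
    upper part is the one for \<open>i\<close>.\<close>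
  have rect: "bic (Q i j) (Q i l) (Q k j) (Q k l) (M i j i l) (M i j k j) (M i l k l) (M k j k l)"
    if ij: "i \<le> k" "k \<le> j" "j \<le> l" "l \<le> n" for i j k l
  proof (rule bic_cancel_top)
    show "bic (X j) (X l) (Q i j) (Q i l) (x j l) (p i j) (p i l) (M i j i l)"
      using top ij by simp
    have "M i j k j \<cdot> p i j = p k j" "M i l k l \<cdot> p i l = p k l"
      using Mp[of i j k j] Mp[of i l k l] x_id Ident_right[OF p[of k j]] Ident_right[OF p[of k l]] ij
      by simp_all
    then show "bic (X j) (X l) (Q k j) (Q k l) (x j l) (M i j k j \<cdot> p i j) (M i l k l \<cdot> p i l)
      (M k j k l)" using top[of k j l] ij by simp
    show "M i j k j \<in> hom C (Q i j) (Q k j)" "M i l k l \<in> hom C (Q i l) (Q k l)" using M ij by simp_all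
    show "is_epi C (M i j k j)" "is_epi C (M i l k l)" using M_epi ij by simp_all
    show "M i l k l \<cdot> M i j i l = M k j k l \<cdot> M i j k j" using M_comp ij by simp
  qed
  have D: "tri_diag n Q M"
    unfolding tri_diag_def using Q_diag Q M_id M M_comp rect by simp
  have M0: "M 0 k 0 l = x k l" if kl: "k \<le> l" "l \<le> n" for k l
    using Mp[of 0 k 0 l] p0[of k] p0[of l] Ident_left[OF x[OF kl]] kl
      Ident_right[OF M[of 0 k 0 l]] Q0[of k] by simp
  show ?thesis
  proof (rule that[OF mk_flag_in[OF D]])
    show "ob (mk_flag n Q M) 0 k = X k" if "k \<le> n" for k
      using Q0 that by (simp add: ob_mk_flag)
    show "s l \<cdot> tri_map (mk_flag n Q M) 0 k 0 l = s k" if "k \<le> l" "l \<le> n" for k l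
      using tri_map_mk_flag[OF D] M0 sx that by simp
  qed
qed

end

section \<open>Equivalences and 2-pullback squares\<close>

text \<open>The quasi-inverse is chosen: \<open>G0\<close> picks an object of \<open>X\<close> up to
  the isomorphism \<open>e\<close>, and \<open>G1\<close> lifts an arrow of \<open>Y\<close>
  conjugated by \<open>e\<close>. An equation in \<open>X\<close> is checked in \<open>Y\<close> by
  faithfulness, after composing with \<open>e\<close>. The arrows provided by \<open>surj\<close>
  are isomorphisms since \<open>Y\<close> is a groupoid.\<close>

lemma equivalence_of_full_faithful:
  assumes "groupoid X" "groupoid Y" and H: "is_functor X Y H"
    and full: "\<And>x y h. x \<in> Obj X \<Longrightarrow> y \<in> Obj X \<Longrightarrow> h \<in> hom Y (on_obj H x) (on_obj H y) \<Longrightarrow>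
      \<exists>f \<in> hom X x y. on_arr H f = h"
    and faithful: "\<And>x y f g. f \<in> hom X x y \<Longrightarrow> g \<in> hom X x y \<Longrightarrow> on_arr H f = on_arr H g \<Longrightarrow> f = g"
    and surj: "\<And>y. y \<in> Obj Y \<Longrightarrow> \<exists>x \<in> Obj X. \<exists>h. h \<in> hom Y (on_obj H x) y"
  shows "is_equivalence X Y H"
proof -
  interpret X: groupoid X by fact
  interpret Y: groupoid Y by fact
  have Hob: "\<And>x. x \<in> Obj X \<Longrightarrow> on_obj H x \<in> Obj Y"
    and Harr: "\<And>x y f. f \<in> hom X x y \<Longrightarrow> on_arr H f \<in> hom Y (on_obj H x) (on_obj H y)"
    and Hid: "\<And>x. x \<in> Obj X \<Longrightarrow> on_arr H (Ident X x) = Ident Y (on_obj H x)"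
    and Hcomp: "\<And>x y w f g. f \<in> hom X x y \<Longrightarrow> g \<in> hom X y w \<Longrightarrow>
      on_arr H (g \<cdot>\<^bsub>X\<^esub> f) = on_arr H g \<cdot>\<^bsub>Y\<^esub> on_arr H f"
    using H unfolding is_functor_def by blast+
  have "\<exists>x e e'. x \<in> Obj X \<and> e \<in> hom Y (on_obj H x) y \<and> e' \<in> hom Y y (on_obj H x) \<and>
    e' \<cdot>\<^bsub>Y\<^esub> e = Ident Y (on_obj H x) \<and> e \<cdot>\<^bsub>Y\<^esub> e' = Ident Y y" if y: "y \<in> Obj Y" for y
  proof -
    obtain x e where xe: "x \<in> Obj X" "e \<in> hom Y (on_obj H x) y" using surj[OF y] by blast
    then have "is_iso Y e" using Y.all_iso by (simp add: hom_def)
    with xe show ?thesis using Y.is_iso_iff by blast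
  qed
  then obtain G0 e e' where G0: "\<And>y. y \<in> Obj Y \<Longrightarrow> G0 y \<in> Obj X"
    and e: "\<And>y. y \<in> Obj Y \<Longrightarrow> e y \<in> hom Y (on_obj H (G0 y)) y"
    and e': "\<And>y. y \<in> Obj Y \<Longrightarrow> e' y \<in> hom Y y (on_obj H (G0 y))"
    and e'e: "\<And>y. y \<in> Obj Y \<Longrightarrow> e' y \<cdot>\<^bsub>Y\<^esub> e y = Ident Y (on_obj H (G0 y))"
    and ee': "\<And>y. y \<in> Obj Y \<Longrightarrow> e y \<cdot>\<^bsub>Y\<^esub> e' y = Ident Y y"
    by metis
  have "\<exists>f. f \<in> hom X (G0 (Dom Y g)) (G0 (Cod Y g)) \<and>
    on_arr H f = e' (Cod Y g) \<cdot>\<^bsub>Y\<^esub> g \<cdot>\<^bsub>Y\<^esub> e (Dom Y g)" if "g \<in> Arr Y" for g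
  proof -
    have "g \<in> hom Y (Dom Y g) (Cod Y g)" "Dom Y g \<in> Obj Y" "Cod Y g \<in> Obj Y"
      using that by (auto simp: hom_def)
    then show ?thesis
      using full[OF G0 G0] Y.Comp_in[OF Y.Comp_in[OF e] e'] by meson
  qed
  then obtain G1 where "\<And>g. g \<in> Arr Y \<Longrightarrow> G1 g \<in> hom X (G0 (Dom Y g)) (G0 (Cod Y g))"
    and "\<And>g. g \<in> Arr Y \<Longrightarrow> on_arr H (G1 g) = e' (Cod Y g) \<cdot>\<^bsub>Y\<^esub> g \<cdot>\<^bsub>Y\<^esub> e (Dom Y g)"
    by metis
  then have G1: "\<And>g x y. g \<in> hom Y x y \<Longrightarrow> G1 g \<in> hom X (G0 x) (G0 y)"
    and HG1: "\<And>g x y. g \<in> hom Y x y \<Longrightarrow> on_arr H (G1 g) = e' y \<cdot>\<^bsub>Y\<^esub> g \<cdot>\<^bsub>Y\<^esub> e x"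
    by (auto simp: hom_def)
  have eHG1: "e y \<cdot>\<^bsub>Y\<^esub> on_arr H (G1 g) = g \<cdot>\<^bsub>Y\<^esub> e x" if g: "g \<in> hom Y x y" for g x y
  proof -
    have o: "x \<in> Obj Y" "y \<in> Obj Y" using Y.hom_obj[OF g] by auto
    note ge = Y.Comp_in[OF e[OF o(1)] g]
    have "e y \<cdot>\<^bsub>Y\<^esub> e' y \<cdot>\<^bsub>Y\<^esub> g \<cdot>\<^bsub>Y\<^esub> e x = g \<cdot>\<^bsub>Y\<^esub> e x"
      using Y.Comp_assoc[OF ge e'[OF o(2)] e[OF o(2)]] ee'[OF o(2)] Y.Ident_left[OF ge] by simp
    then show ?thesis using HG1[OF g] by simp
  qed
  have e_mono: "u = v" if "y \<in> Obj Y" "u \<in> hom Y w (on_obj H (G0 y))" "v \<in> hom Y w (on_obj H (G0 y))"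
    "e y \<cdot>\<^bsub>Y\<^esub> u = e y \<cdot>\<^bsub>Y\<^esub> v" for y u v w
    using Y.mono_cancel[OF Y.iso_mono[OF Y.all_iso e] e] e[OF that(1)] that by (auto simp: hom_def)
  define G where "G = \<lparr>on_obj = G0, on_arr = G1\<rparr>"
  have "is_functor Y X G"
    unfolding is_functor_def G_def funct.simps
  proof (intro conjI ballI allI)
    fix y assume y: "y \<in> Obj Y"
    show "G0 y \<in> Obj X" by (rule G0[OF y])
    show "G1 (Ident Y y) = Ident X (G0 y)"
    proof (rule faithful[OF G1[OF Y.Ident_in[OF y]] X.Ident_in[OF G0[OF y]]])
      show "on_arr H (G1 (Ident Y y)) = on_arr H (Ident X (G0 y))"
        using HG1[OF Y.Ident_in[OF y]] Y.Ident_left[OF e[OF y]] e'e[OF y] Hid[OF G0[OF y]] by simp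
    qed
  next
    fix x y f assume "f \<in> hom Y x y" then show "G1 f \<in> hom X (G0 x) (G0 y)" by (rule G1)
  next
    fix x y w f g assume f: "f \<in> hom Y x y" and g: "g \<in> hom Y y w"
    have o: "x \<in> Obj Y" "y \<in> Obj Y" "w \<in> Obj Y" using Y.hom_obj[OF f] Y.hom_obj[OF g] by auto
    note fg = Y.Comp_in[OF f g]
    show "G1 (g \<cdot>\<^bsub>Y\<^esub> f) = G1 g \<cdot>\<^bsub>X\<^esub> G1 f"
    proof (rule faithful[OF G1[OF fg] X.Comp_in[OF G1[OF f] G1[OF g]]], rule e_mono[OF o(3)])
      note h = Harr[OF G1[OF f]] Harr[OF G1[OF g]]
      show "on_arr H (G1 (g \<cdot>\<^bsub>Y\<^esub> f)) \<in> hom Y (on_obj H (G0 x)) (on_obj H (G0 w))"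
        "on_arr H (G1 g \<cdot>\<^bsub>X\<^esub> G1 f) \<in> hom Y (on_obj H (G0 x)) (on_obj H (G0 w))"
        using Harr[OF G1[OF fg]] Harr[OF X.Comp_in[OF G1[OF f] G1[OF g]]] by auto
      have "e w \<cdot>\<^bsub>Y\<^esub> on_arr H (G1 g) \<cdot>\<^bsub>Y\<^esub> on_arr H (G1 f) = (g \<cdot>\<^bsub>Y\<^esub> f) \<cdot>\<^bsub>Y\<^esub> e x"
        by (rule Y.comm_paste[OF h(1) h(2) e[OF o(1)] e[OF o(2)] e[OF o(3)] f g eHG1[OF f] eHG1[OF g]])
      then show "e w \<cdot>\<^bsub>Y\<^esub> on_arr H (G1 (g \<cdot>\<^bsub>Y\<^esub> f)) = e w \<cdot>\<^bsub>Y\<^esub> on_arr H (G1 g \<cdot>\<^bsub>X\<^esub> G1 f)"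
        using eHG1[OF fg] Hcomp[OF G1[OF f] G1[OF g]] by simp
    qed
  qed
  moreover have "nat_iso Y Y (comp_functor H G) id_functor e"
    unfolding nat_iso_def
    using e eHG1 Y.all_iso by (auto simp: comp_functor_def id_functor_def G_def hom_def)
  moreover have "\<exists>\<eta>. nat_iso X X id_functor (comp_functor G H) \<eta>"
  proof -
    have "\<exists>h. h \<in> hom X x (G0 (on_obj H x)) \<and> on_arr H h = e' (on_obj H x)" if "x \<in> Obj X" for x
      using full[OF that G0[OF Hob[OF that]] e'[OF Hob[OF that]]] by blast
    then obtain \<eta> where \<eta>: "\<And>x. x \<in> Obj X \<Longrightarrow> \<eta> x \<in> hom X x (G0 (on_obj H x))"
      and H\<eta>: "\<And>x. x \<in> Obj X \<Longrightarrow> on_arr H (\<eta> x) = e' (on_obj H x)" by metis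
    have "\<eta> y \<cdot>\<^bsub>X\<^esub> f = G1 (on_arr H f) \<cdot>\<^bsub>X\<^esub> \<eta> x" if f: "f \<in> hom X x y" for f x y
    proof -
      have o: "x \<in> Obj X" "y \<in> Obj X" using X.hom_obj[OF f] by auto
      note Hf = Harr[OF f] and ho = Hob[OF o(1)] Hob[OF o(2)]
      note l = X.Comp_in[OF f \<eta>[OF o(2)]] and r = X.Comp_in[OF \<eta>[OF o(1)] G1[OF Hf]]
      have "e (on_obj H y) \<cdot>\<^bsub>Y\<^esub> on_arr H (\<eta> y \<cdot>\<^bsub>X\<^esub> f) = on_arr H f"
        using Hcomp[OF f \<eta>[OF o(2)]] H\<eta>[OF o(2)] ee'[OF ho(2)] Y.Ident_left[OF Hf]
          Y.Comp_assoc[OF Hf e'[OF ho(2)] e[OF ho(2)]] by simp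
      moreover have "e (on_obj H y) \<cdot>\<^bsub>Y\<^esub> on_arr H (G1 (on_arr H f) \<cdot>\<^bsub>X\<^esub> \<eta> x) = on_arr H f"
        using Hcomp[OF \<eta>[OF o(1)] G1[OF Hf]] H\<eta>[OF o(1)] eHG1[OF Hf] ee'[OF ho(1)]
          Y.Ident_right[OF Hf] Y.Comp_assoc[OF e'[OF ho(1)] Harr[OF G1[OF Hf]] e[OF ho(2)]]
          Y.Comp_assoc[OF e'[OF ho(1)] e[OF ho(1)] Hf] by simp
      ultimately have "on_arr H (\<eta> y \<cdot>\<^bsub>X\<^esub> f) = on_arr H (G1 (on_arr H f) \<cdot>\<^bsub>X\<^esub> \<eta> x)"
        using e_mono[OF ho(2) Harr[OF l] Harr[OF r]] by simp
      then show ?thesis by (rule faithful[OF l r])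
    qed
    then have "nat_iso X X id_functor (comp_functor G H) \<eta>"
      unfolding nat_iso_def
      using \<eta> X.all_iso by (auto simp: comp_functor_def id_functor_def G_def hom_def)
    then show ?thesis by blast
  qed
  ultimately show ?thesis using H unfolding is_equivalence_def by blast
qed

section \<open>2-pullbacks of groupoids\<close>

lemma two_pullback_simps:
  "x \<in> Obj (two_pullback A B C F G) \<longleftrightarrow> (\<exists>a b \<phi>. x = (a, b, \<phi>) \<and> a \<in> Obj A \<and> b \<in> Obj B \<and>
    \<phi> \<in> hom C (on_obj F a) (on_obj G b) \<and> is_iso C \<phi>)"
  "h \<in> hom (two_pullback A B C F G) (a, b, \<phi>) (a', b', \<phi>') \<longleftrightarrow>
    (a, b, \<phi>) \<in> Obj (two_pullback A B C F G) \<and> (a', b', \<phi>') \<in> Obj (two_pullback A B C F G) \<and>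
    (\<exists>f g. h = ((a, b, \<phi>), (a', b', \<phi>'), (f, g)) \<and> f \<in> hom A a a' \<and> g \<in> hom B b b' \<and>
      \<phi>' \<cdot>\<^bsub>C\<^esub> on_arr F f = on_arr G g \<cdot>\<^bsub>C\<^esub> \<phi>)"
  "Ident (two_pullback A B C F G) (a, b, \<phi>) =
    ((a, b, \<phi>), (a, b, \<phi>), (Ident A a, Ident B b))"
  "(y', w, f', g') \<cdot>\<^bsub>two_pullback A B C F G\<^esub> (x, y, f, g) = (x, w, (f' \<cdot>\<^bsub>A\<^esub> f, g' \<cdot>\<^bsub>B\<^esub> g))"
  by (auto simp: two_pullback_def Let_def hom_def)

lemma two_pullback_arr:
  "h \<in> Arr (two_pullback A B C F G) \<Longrightarrow>
    h \<in> hom (two_pullback A B C F G) (Dom (two_pullback A B C F G) h) (Cod (two_pullback A B C F G) h) \<and>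
    Dom (two_pullback A B C F G) h \<in> Obj (two_pullback A B C F G) \<and>
    Cod (two_pullback A B C F G) h \<in> Obj (two_pullback A B C F G)"
  by (auto simp: two_pullback_def Let_def hom_def)

lemma two_pullback_groupoid:
  assumes "groupoid A" "groupoid B" "groupoid C" and F: "is_functor A C F" and G: "is_functor B C G"
  shows "groupoid (two_pullback A B C F G)"
proof -
  interpret A: groupoid A by fact
  interpret B: groupoid B by fact
  interpret C: groupoid C by fact
  let ?T = "two_pullback A B C F G"
  have Farr: "\<And>x y f. f \<in> hom A x y \<Longrightarrow> on_arr F f \<in> hom C (on_obj F x) (on_obj F y)"
    and Fid: "\<And>x. x \<in> Obj A \<Longrightarrow> on_arr F (Ident A x) = Ident C (on_obj F x)"
    and Fcomp: "\<And>x y w f g. f \<in> hom A x y \<Longrightarrow> g \<in> hom A y w \<Longrightarrow>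
      on_arr F (g \<cdot>\<^bsub>A\<^esub> f) = on_arr F g \<cdot>\<^bsub>C\<^esub> on_arr F f"
    using F unfolding is_functor_def by blast+
  have Garr: "\<And>x y f. f \<in> hom B x y \<Longrightarrow> on_arr G f \<in> hom C (on_obj G x) (on_obj G y)"
    and Gid: "\<And>x. x \<in> Obj B \<Longrightarrow> on_arr G (Ident B x) = Ident C (on_obj G x)"
    and Gcomp: "\<And>x y w f g. f \<in> hom B x y \<Longrightarrow> g \<in> hom B y w \<Longrightarrow>
      on_arr G (g \<cdot>\<^bsub>B\<^esub> f) = on_arr G g \<cdot>\<^bsub>C\<^esub> on_arr G f"
    using G unfolding is_functor_def by blast+
  interpret T: category ?T
  proof
    fix h assume "h \<in> Arr ?T"
    then show "Dom ?T h \<in> Obj ?T" "Cod ?T h \<in> Obj ?T" using two_pullback_arr by blast+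
  next
    fix x assume x: "x \<in> Obj ?T"
    then obtain a b \<phi> where xe: "x = (a, b, \<phi>)" and ab: "a \<in> Obj A" "b \<in> Obj B"
      "\<phi> \<in> hom C (on_obj F a) (on_obj G b)"
      by (auto simp: two_pullback_simps(1))
    have "\<phi> \<cdot>\<^bsub>C\<^esub> on_arr F (Ident A a) = on_arr G (Ident B b) \<cdot>\<^bsub>C\<^esub> \<phi>"
      using ab by (simp add: Fid Gid C.Ident_left C.Ident_right)
    then show "Ident ?T x \<in> hom ?T x x"
      using x ab A.Ident_in B.Ident_in unfolding xe by (simp add: two_pullback_simps(2,3))
  next
    fix h k x y w assume h: "h \<in> hom ?T x y" and k: "k \<in> hom ?T y w"
    obtain a b \<phi> where x: "x = (a, b, \<phi>)" by (cases x)
    obtain a' b' \<phi>' where y: "y = (a', b', \<phi>')" by (cases y)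
    obtain a'' b'' \<phi>'' where w: "w = (a'', b'', \<phi>'')" by (cases w)
    obtain f g where h': "h = (x, y, (f, g))" and f: "f \<in> hom A a a'" and g: "g \<in> hom B b b'"
      and fg: "\<phi>' \<cdot>\<^bsub>C\<^esub> on_arr F f = on_arr G g \<cdot>\<^bsub>C\<^esub> \<phi>"
      using h unfolding x y two_pullback_simps(2) by blast
    obtain f' g' where k': "k = (y, w, (f', g'))" and f': "f' \<in> hom A a' a''" and g': "g' \<in> hom B b' b''"
      and fg': "\<phi>'' \<cdot>\<^bsub>C\<^esub> on_arr F f' = on_arr G g' \<cdot>\<^bsub>C\<^esub> \<phi>'"
      using k unfolding w y two_pullback_simps(2) by blast
    have o: "x \<in> Obj ?T" "y \<in> Obj ?T" "w \<in> Obj ?T"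
      using h k unfolding x y w two_pullback_simps(2) by auto
    then have p: "\<phi> \<in> hom C (on_obj F a) (on_obj G b)" "\<phi>' \<in> hom C (on_obj F a') (on_obj G b')"
      "\<phi>'' \<in> hom C (on_obj F a'') (on_obj G b'')"
      unfolding x y w two_pullback_simps(1) by auto
    have "\<phi>'' \<cdot>\<^bsub>C\<^esub> on_arr F f' \<cdot>\<^bsub>C\<^esub> on_arr F f = (on_arr G g' \<cdot>\<^bsub>C\<^esub> on_arr G g) \<cdot>\<^bsub>C\<^esub> \<phi>"
      by (rule C.comm_paste[OF Farr[OF f] Farr[OF f'] p Garr[OF g] Garr[OF g'] fg fg'])
    then have "\<phi>'' \<cdot>\<^bsub>C\<^esub> on_arr F (f' \<cdot>\<^bsub>A\<^esub> f) = on_arr G (g' \<cdot>\<^bsub>B\<^esub> g) \<cdot>\<^bsub>C\<^esub> \<phi>"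
      by (simp add: Fcomp[OF f f'] Gcomp[OF g g'])
    then show "k \<cdot>\<^bsub>?T\<^esub> h \<in> hom ?T x w"
      using o A.Comp_in[OF f f'] B.Comp_in[OF g g'] unfolding h' k' x w y
      by (simp add: two_pullback_simps(2,4))
  next
    fix h x y assume h: "h \<in> hom ?T x y"
    obtain a b \<phi> a' b' \<phi>' where xy: "x = (a, b, \<phi>)" "y = (a', b', \<phi>')" by (cases x, cases y)
    obtain f g where "h = (x, y, (f, g))" "f \<in> hom A a a'" "g \<in> hom B b b'"
      using h unfolding xy two_pullback_simps(2) by blast
    then show "Ident ?T y \<cdot>\<^bsub>?T\<^esub> h = h" "h \<cdot>\<^bsub>?T\<^esub> Ident ?T x = h"
      by (simp_all add: xy two_pullback_simps(3,4) A.Ident_left A.Ident_right B.Ident_left B.Ident_right)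
  next
    fix h k l w x y v assume h: "h \<in> hom ?T w x" "k \<in> hom ?T x y" "l \<in> hom ?T y v"
    obtain a b \<phi> a' b' \<phi>' where wx: "w = (a, b, \<phi>)" "x = (a', b', \<phi>')" by (cases w, cases x)
    obtain c d \<psi> c' d' \<psi>' where yv: "y = (c, d, \<psi>)" "v = (c', d', \<psi>')" by (cases y, cases v)
    obtain f1 g1 where 1: "h = (w, x, (f1, g1))" "f1 \<in> hom A a a'" "g1 \<in> hom B b b'"
      using h(1) unfolding wx two_pullback_simps(2) by blast
    obtain f2 g2 where 2: "k = (x, y, (f2, g2))" "f2 \<in> hom A a' c" "g2 \<in> hom B b' d"
      using h(2) unfolding wx yv two_pullback_simps(2) by blast
    obtain f3 g3 where 3: "l = (y, v, (f3, g3))" "f3 \<in> hom A c c'" "g3 \<in> hom B d d'"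
      using h(3) unfolding yv two_pullback_simps(2) by blast
    show "(l \<cdot>\<^bsub>?T\<^esub> k) \<cdot>\<^bsub>?T\<^esub> h = l \<cdot>\<^bsub>?T\<^esub> k \<cdot>\<^bsub>?T\<^esub> h"
      unfolding 1(1) 2(1) 3(1) two_pullback_simps(4)
      using A.Comp_assoc[OF 1(2) 2(2) 3(2)] B.Comp_assoc[OF 1(3) 2(3) 3(3)] by simp
  qed
  show ?thesis
  proof
    fix h assume "h \<in> Arr ?T"
    then obtain x y where h: "h \<in> hom ?T x y" using two_pullback_arr by blast
    obtain a b \<phi> a' b' \<phi>' where xy: "x = (a, b, \<phi>)" "y = (a', b', \<phi>')" by (cases x, cases y)
    obtain f g where h': "h = (x, y, (f, g))" and f: "f \<in> hom A a a'" and g: "g \<in> hom B b b'"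
      and fg: "\<phi>' \<cdot>\<^bsub>C\<^esub> on_arr F f = on_arr G g \<cdot>\<^bsub>C\<^esub> \<phi>"
      using h unfolding xy two_pullback_simps(2) by blast
    have o: "x \<in> Obj ?T" "y \<in> Obj ?T"
      using h unfolding xy two_pullback_simps(2) by auto
    then have p: "\<phi> \<in> hom C (on_obj F a) (on_obj G b)" "\<phi>' \<in> hom C (on_obj F a') (on_obj G b')"
      unfolding xy two_pullback_simps(1) by auto
    obtain f' where f': "f' \<in> hom A a' a" "f' \<cdot>\<^bsub>A\<^esub> f = Ident A a" "f \<cdot>\<^bsub>A\<^esub> f' = Ident A a'"
      using A.all_iso[of f] f A.is_iso_iff[OF f] by (auto simp: hom_def)
    obtain g' where g': "g' \<in> hom B b' b" "g' \<cdot>\<^bsub>B\<^esub> g = Ident B b" "g \<cdot>\<^bsub>B\<^esub> g' = Ident B b'"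
      using B.all_iso[of g] g B.is_iso_iff[OF g] by (auto simp: hom_def)
    note ab = A.hom_obj[OF f] B.hom_obj[OF g]
    have gg: "on_arr G g' \<cdot>\<^bsub>C\<^esub> on_arr G g = Ident C (on_obj G b)"
      using Gcomp[OF g g'(1)] g'(2) Gid ab by simp
    have ff: "on_arr F f \<cdot>\<^bsub>C\<^esub> on_arr F f' = Ident C (on_obj F a')"
      using Fcomp[OF f'(1) f] f'(3) Fid ab by simp
    note t = Farr[OF f] Farr[OF f'(1)] Garr[OF g] Garr[OF g'(1)]
    \<comment> \<open>Compatibility of the componentwise inverse: insert
      \<open>on_arr G g' \<cdot> on_arr G g\<close>, an identity, exchange by \<open>fg\<close>, and
      cancel \<open>on_arr F f\<close> against \<open>on_arr F f'\<close>.\<close>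
    have "\<phi> \<cdot>\<^bsub>C\<^esub> on_arr F f' = on_arr G g' \<cdot>\<^bsub>C\<^esub> (on_arr G g \<cdot>\<^bsub>C\<^esub> \<phi>) \<cdot>\<^bsub>C\<^esub> on_arr F f'"
      using C.Comp_assoc[OF C.Comp_in[OF t(2) p(1)] t(3) t(4)] C.Comp_assoc[OF t(2) p(1) t(3)]
        gg C.Ident_left[OF C.Comp_in[OF t(2) p(1)]] by simp
    also have "\<dots> = on_arr G g' \<cdot>\<^bsub>C\<^esub> \<phi>'"
      using fg[symmetric] C.Comp_assoc[OF t(2) t(1) p(2)] ff C.Ident_right[OF p(2)] by simp
    finally have "(y, x, (f', g')) \<in> hom ?T y x"
      using o f'(1) g'(1) unfolding xy two_pullback_simps(2) by blast
    moreover have "(y, x, (f', g')) \<cdot>\<^bsub>?T\<^esub> h = Ident ?T x" "h \<cdot>\<^bsub>?T\<^esub> (y, x, (f', g')) = Ident ?T y"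
      unfolding h' two_pullback_simps(4) using f' g' by (simp_all add: xy two_pullback_simps(3))
    ultimately show "is_iso ?T h" using T.is_iso_iff[OF h] by blast
  qed
qed

text \<open>The objects in the image of the comparison functor carry identities as gluing data. So
  the compatibility of a pair of arrows between two of them is
  \<open>on_arr F f = on_arr G g\<close>, and that of an arrow from one of them to
  \<open>(a, b, \<phi>)\<close> is the equation in \<open>surj\<close>.\<close>

lemma two_pullback_squareI:
  assumes X: "groupoid X" and A: "groupoid A" and B: "groupoid B" and C: "groupoid C"
    and P: "is_functor X A P" and Q: "is_functor X B Q"
    and F: "is_functor A C F" and G: "is_functor B C G"
    and comm: "functor_eq X (comp_functor F P) (comp_functor G Q)"
    and full: "\<And>x y f g. x \<in> Obj X \<Longrightarrow> y \<in> Obj X \<Longrightarrow> f \<in> hom A (on_obj P x) (on_obj P y) \<Longrightarrow>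
      g \<in> hom B (on_obj Q x) (on_obj Q y) \<Longrightarrow> on_arr F f = on_arr G g \<Longrightarrow>
      \<exists>h \<in> hom X x y. on_arr P h = f \<and> on_arr Q h = g"
    and faithful: "\<And>x y h h'. h \<in> hom X x y \<Longrightarrow> h' \<in> hom X x y \<Longrightarrow> on_arr P h = on_arr P h' \<Longrightarrow>
      on_arr Q h = on_arr Q h' \<Longrightarrow> h = h'"
    and surj: "\<And>a b \<phi>. a \<in> Obj A \<Longrightarrow> b \<in> Obj B \<Longrightarrow> \<phi> \<in> hom C (on_obj F a) (on_obj G b) \<Longrightarrow>
      \<exists>x \<in> Obj X. \<exists>f \<in> hom A (on_obj P x) a. \<exists>g \<in> hom B (on_obj Q x) b.
        \<phi> \<cdot>\<^bsub>C\<^esub> on_arr F f = on_arr G g"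
  shows "two_pullback_square X A B C P Q F G"
proof -
  interpret X: groupoid X by fact
  interpret C: groupoid C by fact
  let ?T = "two_pullback A B C F G" and ?H = "comparison X C P Q F"
  have Pob: "\<And>x. x \<in> Obj X \<Longrightarrow> on_obj P x \<in> Obj A"
    and Parr: "\<And>x y f. f \<in> hom X x y \<Longrightarrow> on_arr P f \<in> hom A (on_obj P x) (on_obj P y)"
    and Pid: "\<And>x. x \<in> Obj X \<Longrightarrow> on_arr P (Ident X x) = Ident A (on_obj P x)"
    and Pcomp: "\<And>x y w f g. f \<in> hom X x y \<Longrightarrow> g \<in> hom X y w \<Longrightarrow>
      on_arr P (g \<cdot>\<^bsub>X\<^esub> f) = on_arr P g \<cdot>\<^bsub>A\<^esub> on_arr P f"
    using P unfolding is_functor_def by blast+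
  have Qob: "\<And>x. x \<in> Obj X \<Longrightarrow> on_obj Q x \<in> Obj B"
    and Qarr: "\<And>x y f. f \<in> hom X x y \<Longrightarrow> on_arr Q f \<in> hom B (on_obj Q x) (on_obj Q y)"
    and Qid: "\<And>x. x \<in> Obj X \<Longrightarrow> on_arr Q (Ident X x) = Ident B (on_obj Q x)"
    and Qcomp: "\<And>x y w f g. f \<in> hom X x y \<Longrightarrow> g \<in> hom X y w \<Longrightarrow>
      on_arr Q (g \<cdot>\<^bsub>X\<^esub> f) = on_arr Q g \<cdot>\<^bsub>B\<^esub> on_arr Q f"
    using Q unfolding is_functor_def by blast+
  have Fob: "\<And>x. x \<in> Obj A \<Longrightarrow> on_obj F x \<in> Obj C"
    and Farr: "\<And>x y f. f \<in> hom A x y \<Longrightarrow> on_arr F f \<in> hom C (on_obj F x) (on_obj F y)"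
    using F unfolding is_functor_def by blast+
  have Garr: "\<And>x y f. f \<in> hom B x y \<Longrightarrow> on_arr G f \<in> hom C (on_obj G x) (on_obj G y)"
    using G unfolding is_functor_def by blast
  have FP: "\<And>x. x \<in> Obj X \<Longrightarrow> on_obj F (on_obj P x) = on_obj G (on_obj Q x)"
    and FP1: "\<And>x y f. f \<in> hom X x y \<Longrightarrow> on_arr F (on_arr P f) = on_arr G (on_arr Q f)"
    using comm by (auto simp: functor_eq_def comp_functor_def hom_def)
  define \<iota> where "\<iota> x = (on_obj P x, on_obj Q x, Ident C (on_obj F (on_obj P x)))" for x
  have H_simps: "on_obj ?H = \<iota>" "\<And>f x y. f \<in> hom X x y \<Longrightarrow> on_arr ?H f = (\<iota> x, \<iota> y, (on_arr P f, on_arr Q f))"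
    by (auto simp: comparison_def Let_def \<iota>_def hom_def fun_eq_iff)
  have \<iota>_obj: "\<iota> x \<in> Obj ?T" if "x \<in> Obj X" for x
    using that Pob Qob C.Ident_in[OF Fob[OF Pob]] C.iso_Ident[OF Fob[OF Pob]] FP
    by (simp add: \<iota>_def two_pullback_simps(1))
  have hom\<iota>: "h \<in> hom ?T (\<iota> x) (\<iota> y) \<longleftrightarrow> (\<exists>f g. h = (\<iota> x, \<iota> y, (f, g)) \<and>
      f \<in> hom A (on_obj P x) (on_obj P y) \<and> g \<in> hom B (on_obj Q x) (on_obj Q y) \<and>
      on_arr F f = on_arr G g)" if xy: "x \<in> Obj X" "y \<in> Obj X" for h x y
  proof -
    have "Ident C (on_obj F (on_obj P y)) \<cdot>\<^bsub>C\<^esub> on_arr F f =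
        on_arr G g \<cdot>\<^bsub>C\<^esub> Ident C (on_obj F (on_obj P x)) \<longleftrightarrow> on_arr F f = on_arr G g"
      if "f \<in> hom A (on_obj P x) (on_obj P y)" "g \<in> hom B (on_obj Q x) (on_obj Q y)" for f g
      using C.Ident_left[OF Farr[OF that(1)]] C.Ident_right[OF Garr[OF that(2)]] FP xy by simp
    then show ?thesis
      using \<iota>_obj[OF xy(1)] \<iota>_obj[OF xy(2)] unfolding \<iota>_def two_pullback_simps(2) by blast
  qed
  have "is_functor X ?T ?H"
    unfolding is_functor_def
  proof (intro conjI ballI allI)
    fix x assume x: "x \<in> Obj X"
    show "on_obj ?H x \<in> Obj ?T" using \<iota>_obj[OF x] by (simp add: H_simps)
    show "on_arr ?H (Ident X x) = Ident ?T (on_obj ?H x)"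
      using H_simps(2)[OF X.Ident_in[OF x]] Pid[OF x] Qid[OF x]
      by (simp add: H_simps(1) \<iota>_def two_pullback_simps(3))
  next
    fix x y f assume f: "f \<in> hom X x y"
    show "on_arr ?H f \<in> hom ?T (on_obj ?H x) (on_obj ?H y)"
      unfolding H_simps(1) H_simps(2)[OF f] hom\<iota>[OF X.hom_obj[OF f]]
      using Parr[OF f] Qarr[OF f] FP1[OF f] by blast
  next
    fix x y w f g assume f: "f \<in> hom X x y" and g: "g \<in> hom X y w"
    show "on_arr ?H (g \<cdot>\<^bsub>X\<^esub> f) = on_arr ?H g \<cdot>\<^bsub>?T\<^esub> on_arr ?H f"
      unfolding H_simps(2)[OF f] H_simps(2)[OF g] H_simps(2)[OF X.Comp_in[OF f g]] two_pullback_simps(4)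
      using Pcomp[OF f g] Qcomp[OF f g] by simp
  qed
  then have "is_equivalence X ?T ?H"
  proof (rule equivalence_of_full_faithful[OF X two_pullback_groupoid[OF A B C F G]])
    fix x y h assume xy: "x \<in> Obj X" "y \<in> Obj X" and "h \<in> hom ?T (on_obj ?H x) (on_obj ?H y)"
    then obtain f g where h: "h = (\<iota> x, \<iota> y, (f, g))" and "f \<in> hom A (on_obj P x) (on_obj P y)"
      "g \<in> hom B (on_obj Q x) (on_obj Q y)" "on_arr F f = on_arr G g"
      using hom\<iota> by (auto simp: H_simps(1))
    then obtain k where "k \<in> hom X x y" "on_arr P k = f" "on_arr Q k = g" using full xy by blast
    then show "\<exists>f \<in> hom X x y. on_arr ?H f = h" using H_simps(2) h by blast
  next
    fix x y f g assume "f \<in> hom X x y" "g \<in> hom X x y" "on_arr ?H f = on_arr ?H g"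
    then show "f = g" using faithful H_simps(2) by simp
  next
    fix y assume y: "y \<in> Obj ?T"
    then obtain a b \<phi> where ye: "y = (a, b, \<phi>)" and ab: "a \<in> Obj A" "b \<in> Obj B"
      "\<phi> \<in> hom C (on_obj F a) (on_obj G b)"
      by (auto simp: two_pullback_simps(1))
    obtain x f g where x: "x \<in> Obj X" and f: "f \<in> hom A (on_obj P x) a"
      and g: "g \<in> hom B (on_obj Q x) b" and fg: "\<phi> \<cdot>\<^bsub>C\<^esub> on_arr F f = on_arr G g"
      using surj[OF ab] by blast
    have "on_arr G g \<cdot>\<^bsub>C\<^esub> Ident C (on_obj F (on_obj P x)) = on_arr G g"
      using C.Ident_right[OF Garr[OF g]] FP x by simp
    then have "(\<iota> x, y, (f, g)) \<in> hom ?T (\<iota> x) y"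
      using \<iota>_obj[OF x] y f g fg unfolding ye \<iota>_def two_pullback_simps(2) by simp
    then show "\<exists>x \<in> Obj X. \<exists>h. h \<in> hom ?T (on_obj ?H x) y"
      unfolding H_simps(1) using x by blast
  qed
  then show ?thesis using P Q F G comm by (simp add: two_pullback_square_def)
qed

section \<open>Inclusions of vertex sets as explicit index maps\<close>

lemma enum_set_strict_mono:
  fixes e :: "nat \<Rightarrow> nat"
  assumes "strict_mono_on {..m} e"
  shows "card (e ` {..m}) = Suc m" and "k \<le> m \<Longrightarrow> enum_set (e ` {..m}) k = e k"
proof -
  have inj: "inj_on e {..m}" using assms by (rule strict_mono_on_imp_inj_on)
  then show "card (e ` {..m}) = Suc m" by (simp add: card_image)
  have "sorted (map e [0..<Suc m])"
    using strict_mono_on_leD[OF assms] by (auto simp: sorted_iff_nth_mono simp del: upt_Suc)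
  moreover have "distinct (map e [0..<Suc m])"
    using inj by (simp add: distinct_map atLeast0LessThan lessThan_Suc_atMost del: upt_Suc)
  ultimately have "sorted_list_of_set (set (map e [0..<Suc m])) = map e [0..<Suc m]"
    by (rule sorted_list_of_set.idem_if_sorted_distinct)
  moreover have "set (map e [0..<Suc m]) = e ` {..m}"
    by (simp add: atLeast0LessThan lessThan_Suc_atMost del: upt_Suc)
  ultimately show "enum_set (e ` {..m}) k = e k" if "k \<le> m"
    using that by (simp add: enum_set_def del: upt_Suc)
qed

text \<open>Given explicit increasing enumerations \<open>e\<close> and \<open>e'\<close> of the two
  sets, \<open>incl\<close> is the map \<iota> of positions. This replaces sorted lists and
  \<open>inv_into\<close> by arithmetic on indices.\<close>

lemma incl_eq:
  fixes e e' :: "nat \<Rightarrow> nat"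
  assumes e: "strict_mono_on {..m} e" and e': "strict_mono_on {..n} e'"
    and i: "\<And>k. k \<le> m \<Longrightarrow> \<iota> k \<le> n \<and> e' (\<iota> k) = e k"
  shows "incl (e ` {..m}) (e' ` {..n}) = (\<lambda>k\<in>{..m}. \<iota> k)"
proof -
  have inj: "inj_on (enum_set (e' ` {..n})) {..n}"
    using strict_mono_on_imp_inj_on[OF e'] enum_set_strict_mono(2)[OF e'] by (simp add: inj_on_def)
  have "inv_into {..n} (enum_set (e' ` {..n})) (enum_set (e ` {..m}) k) = \<iota> k" if "k \<le> m" for k
    using i[OF that] enum_set_strict_mono(2)[OF e that] enum_set_strict_mono(2)[OF e', of "\<iota> k"]
      inv_into_f_eq[OF inj] by simp
  then show ?thesis
    unfolding incl_def enum_set_strict_mono(1)[OF e] enum_set_strict_mono(1)[OF e']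
    by (auto simp: fun_eq_iff)
qed

section \<open>A criterion for squares of flag groupoids\<close>

context pointed_proto_abelian
begin

text \<open>A flag map is determined by its component at the largest object, so for the corner
  \<open>S\<^sub>1\<close> of the square all compatibilities reduce to the component \<open>(0, 1)\<close>.\<close>

lemma flag_two_pullback_squareI:
  assumes a: "\<alpha> \<in> Delta m n" and b: "\<beta> \<in> Delta p n" and c: "\<gamma> \<in> Delta 1 m" and d: "\<delta> \<in> Delta 1 p"
    and comm: "\<And>k. k \<le> 1 \<Longrightarrow> \<alpha> (\<gamma> k) = \<beta> (\<delta> k)"
    and full: "\<And>A B f g. A \<in> flags C z n \<Longrightarrow> B \<in> flags C z n \<Longrightarrow>
      flag_map m (tri_pull C m \<alpha> A) (tri_pull C m \<alpha> B) f \<Longrightarrow>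
      flag_map p (tri_pull C p \<beta> A) (tri_pull C p \<beta> B) g \<Longrightarrow>
      f (\<gamma> 0) (\<gamma> 1) = g (\<delta> 0) (\<delta> 1) \<Longrightarrow>
      \<exists>h. flag_map n A B h \<and> tri_fam m (\<lambda>i j. h (\<alpha> i) (\<alpha> j)) = f \<and> tri_fam p (\<lambda>i j. h (\<beta> i) (\<beta> j)) = g"
    and faithful: "\<And>A B h h'. flag_map n A B h \<Longrightarrow> flag_map n A B h' \<Longrightarrow>
      tri_fam m (\<lambda>i j. h (\<alpha> i) (\<alpha> j)) = tri_fam m (\<lambda>i j. h' (\<alpha> i) (\<alpha> j)) \<Longrightarrow> h = h'"
    and surj: "\<And>A B \<phi>. A \<in> flags C z m \<Longrightarrow> B \<in> flags C z p \<Longrightarrow>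
      is_iso (flag_category C z 1) (tri_pull C 1 \<gamma> A, tri_pull C 1 \<delta> B, \<phi>) \<Longrightarrow>
      \<exists>E f g. E \<in> flags C z n \<and> is_iso (flag_category C z m) (tri_pull C m \<alpha> E, A, f) \<and>
        is_iso (flag_category C z p) (tri_pull C p \<beta> E, B, g) \<and>
        \<phi> 0 1 \<cdot> f (\<gamma> 0) (\<gamma> 1) = g (\<delta> 0) (\<delta> 1)"
  shows "two_pullback_square (core (flag_category C z n)) (core (flag_category C z m))
    (core (flag_category C z p)) (core (flag_category C z 1))
    (flag_pull C m \<alpha>) (flag_pull C p \<beta>) (flag_pull C 1 \<gamma>) (flag_pull C 1 \<delta>)"
proof -
  have comp: "compose {..1} \<alpha> \<gamma> = compose {..1} \<beta> \<delta>"
    using comm by (auto simp: compose_def fun_eq_iff)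
  have pull_comm: "tri_pull C 1 \<gamma> (tri_pull C m \<alpha> A) = tri_pull C 1 \<delta> (tri_pull C p \<beta> A)"
    if "A \<in> flags C z n" for A
    using tri_pull_compose[OF that c a] tri_pull_compose[OF that d b] comp by simp
  \<comment> \<open>\<open>full\<close> concerns all flag maps, so the lift of an isomorphism has to
    be shown invertible. To lift the inverses as well, they must agree on the common edge; there
    they are a right and a left inverse of the same map.\<close>
  have inv_agree: "f' (\<gamma> 0) (\<gamma> 1) = g' (\<delta> 0) (\<delta> 1)"
    if A: "A \<in> flags C z n" and B: "B \<in> flags C z n"
      and f: "flag_map m (tri_pull C m \<alpha> A) (tri_pull C m \<alpha> B) f"
      and f': "flag_map m (tri_pull C m \<alpha> B) (tri_pull C m \<alpha> A) f'"
      and g': "flag_map p (tri_pull C p \<beta> B) (tri_pull C p \<beta> A) g'"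
      and ff: "\<And>i j. i \<le> j \<Longrightarrow> j \<le> m \<Longrightarrow> f i j \<cdot> f' i j = Ident C (ob (tri_pull C m \<alpha> B) i j)"
      and gg: "\<And>i j. i \<le> j \<Longrightarrow> j \<le> p \<Longrightarrow> g' i j \<cdot> g i j = Ident C (ob (tri_pull C p \<beta> A) i j)"
      and eq: "f (\<gamma> 0) (\<gamma> 1) = g (\<delta> 0) (\<delta> 1)" for A B f f' g g'
  proof -
    have le: "\<gamma> 0 \<le> \<gamma> 1" "\<gamma> 1 \<le> m" "\<delta> 0 \<le> \<delta> 1" "\<delta> 1 \<le> p"
      using Delta_mono[OF c] Delta_le[OF c] Delta_mono[OF d] Delta_le[OF d] by simp_all
    have \<alpha>\<beta>: "\<alpha> (\<gamma> 0) = \<beta> (\<delta> 0)" "\<alpha> (\<gamma> 1) = \<beta> (\<delta> 1)" using comm by simp_all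
    have t: "f' (\<gamma> 0) (\<gamma> 1) \<in> hom C (ob B (\<alpha> (\<gamma> 0)) (\<alpha> (\<gamma> 1))) (ob A (\<alpha> (\<gamma> 0)) (\<alpha> (\<gamma> 1)))"
      "f (\<gamma> 0) (\<gamma> 1) \<in> hom C (ob A (\<alpha> (\<gamma> 0)) (\<alpha> (\<gamma> 1))) (ob B (\<alpha> (\<gamma> 0)) (\<alpha> (\<gamma> 1)))"
      "g' (\<delta> 0) (\<delta> 1) \<in> hom C (ob B (\<alpha> (\<gamma> 0)) (\<alpha> (\<gamma> 1))) (ob A (\<alpha> (\<gamma> 0)) (\<alpha> (\<gamma> 1)))"
      using flag_mapD(3)[OF f' le(1,2)] flag_mapD(3)[OF f le(1,2)] flag_mapD(3)[OF g' le(3,4)] le \<alpha>\<beta>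
      by (simp_all add: ob_tri_pull)
    have "g' (\<delta> 0) (\<delta> 1) = (g' (\<delta> 0) (\<delta> 1)) \<cdot> f (\<gamma> 0) (\<gamma> 1) \<cdot> f' (\<gamma> 0) (\<gamma> 1)"
      using ff[OF le(1,2)] Ident_right[OF t(3)] le by (simp add: ob_tri_pull)
    also have "\<dots> = f' (\<gamma> 0) (\<gamma> 1)"
      using Comp_assoc[OF t(1,2,3)] gg[OF le(3,4)] Ident_left[OF t(1)] le \<alpha>\<beta> eq
      by (simp add: ob_tri_pull)
    finally show ?thesis by simp
  qed
  show ?thesis
  proof (rule two_pullback_squareI)
    show "functor_eq (core (flag_category C z n)) (comp_functor (flag_pull C 1 \<gamma>) (flag_pull C m \<alpha>))
      (comp_functor (flag_pull C 1 \<delta>) (flag_pull C p \<beta>))"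
      using flag_pull_compose[OF c a] flag_pull_compose[OF d b] comp by (simp add: functor_eq_def)
  next
    fix A B F G
    assume AB: "A \<in> Obj (core (flag_category C z n))" "B \<in> Obj (core (flag_category C z n))"
      and F: "F \<in> hom (core (flag_category C z m)) (on_obj (flag_pull C m \<alpha>) A) (on_obj (flag_pull C m \<alpha>) B)"
      and G: "G \<in> hom (core (flag_category C z p)) (on_obj (flag_pull C p \<beta>) A) (on_obj (flag_pull C p \<beta>) B)"
      and eq: "on_arr (flag_pull C 1 \<gamma>) F = on_arr (flag_pull C 1 \<delta>) G"
    have A: "A \<in> flags C z n" and B: "B \<in> flags C z n" using AB by simp_all
    obtain f where F_eq: "F = (tri_pull C m \<alpha> A, tri_pull C m \<alpha> B, f)"
      and Fi: "is_iso (flag_category C z m) (tri_pull C m \<alpha> A, tri_pull C m \<alpha> B, f)"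
      using F by (auto simp: hom_core hom_flag_category)
    obtain g where G_eq: "G = (tri_pull C p \<beta> A, tri_pull C p \<beta> B, g)"
      and Gi: "is_iso (flag_category C z p) (tri_pull C p \<beta> A, tri_pull C p \<beta> B, g)"
      using G by (auto simp: hom_core hom_flag_category)
    have "tri_fam 1 (\<lambda>i j. f (\<gamma> i) (\<gamma> j)) 0 1 = tri_fam 1 (\<lambda>i j. g (\<delta> i) (\<delta> j)) 0 1"
      using eq by (simp add: F_eq G_eq)
    then have fg: "f (\<gamma> 0) (\<gamma> 1) = g (\<delta> 0) (\<delta> 1)" by (simp add: tri_fam_def)
    from Fi obtain f' where f: "flag_map m (tri_pull C m \<alpha> A) (tri_pull C m \<alpha> B) f"
      and f': "flag_map m (tri_pull C m \<alpha> B) (tri_pull C m \<alpha> A) f'"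
      and f'f: "\<And>i j. i \<le> j \<Longrightarrow> j \<le> m \<Longrightarrow> f' i j \<cdot> f i j = Ident C (ob (tri_pull C m \<alpha> A) i j)"
      and ff': "\<And>i j. i \<le> j \<Longrightarrow> j \<le> m \<Longrightarrow> f i j \<cdot> f' i j = Ident C (ob (tri_pull C m \<alpha> B) i j)"
      by (rule flag_isoE) blast
    from Gi obtain g' where g: "flag_map p (tri_pull C p \<beta> A) (tri_pull C p \<beta> B) g"
      and g': "flag_map p (tri_pull C p \<beta> B) (tri_pull C p \<beta> A) g'"
      and g'g: "\<And>i j. i \<le> j \<Longrightarrow> j \<le> p \<Longrightarrow> g' i j \<cdot> g i j = Ident C (ob (tri_pull C p \<beta> A) i j)"
      by (rule flag_isoE) blast
    obtain h where h: "flag_map n A B h" and hf: "tri_fam m (\<lambda>i j. h (\<alpha> i) (\<alpha> j)) = f"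
      and hg: "tri_fam p (\<lambda>i j. h (\<beta> i) (\<beta> j)) = g"
      using full[OF A B f g fg] by blast
    obtain h' where h': "flag_map n B A h'" and hf': "tri_fam m (\<lambda>i j. h' (\<alpha> i) (\<alpha> j)) = f'"
      using full[OF B A f' g' inv_agree[OF A B f f' g' ff' g'g fg]] by blast
    \<comment> \<open>By \<open>faithful\<close> the two composites of the lifts may be compared
      with identities after restriction along \<alpha>, where they are the composites of
      \<open>f\<close> and \<open>f'\<close>.\<close>
    have id1: "tri_fam n (\<lambda>i j. h' i j \<cdot> h i j) = tri_fam n (\<lambda>i j. Ident C (ob A i j))"
      and id2: "tri_fam n (\<lambda>i j. h i j \<cdot> h' i j) = tri_fam n (\<lambda>i j. Ident C (ob B i j))"
    proof -
      have *: "h (\<alpha> i) (\<alpha> j) = f i j" "h' (\<alpha> i) (\<alpha> j) = f' i j" if "i \<le> j" "j \<le> m" for i j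
        using fun_cong[OF fun_cong[OF hf], of i j] fun_cong[OF fun_cong[OF hf'], of i j] that
        by (simp_all add: tri_fam_apply)
      show "tri_fam n (\<lambda>i j. h' i j \<cdot> h i j) = tri_fam n (\<lambda>i j. Ident C (ob A i j))"
        by (rule faithful[OF flag_map_comp[OF h h'] flag_map_id[OF A]])
          (use f'f Delta_mono[OF a] Delta_le[OF a] in
            \<open>auto simp: tri_fam_def fun_eq_iff * ob_tri_pull\<close>)
      show "tri_fam n (\<lambda>i j. h i j \<cdot> h' i j) = tri_fam n (\<lambda>i j. Ident C (ob B i j))"
        by (rule faithful[OF flag_map_comp[OF h' h] flag_map_id[OF B]])
          (use ff' Delta_mono[OF a] Delta_le[OF a] in
            \<open>auto simp: tri_fam_def fun_eq_iff * ob_tri_pull\<close>)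
    qed
    have "h' 0 n \<cdot> h 0 n = Ident C (ob A 0 n)" "h 0 n \<cdot> h' 0 n = Ident C (ob B 0 n)"
      using fun_cong[OF fun_cong[OF id1], of 0 n] fun_cong[OF fun_cong[OF id2], of 0 n]
      by (simp_all add: tri_fam_apply)
    then have "is_iso (flag_category C z n) (A, B, h)" by (rule flag_iso_of_inverse_top[OF h h'])
    then have "(A, B, h) \<in> hom (core (flag_category C z n)) A B"
      using h by (simp add: hom_core hom_flag_category)
    moreover have "on_arr (flag_pull C m \<alpha>) (A, B, h) = F" "on_arr (flag_pull C p \<beta>) (A, B, h) = G"
      using hf hg by (simp_all add: F_eq G_eq)
    ultimately show "\<exists>h \<in> hom (core (flag_category C z n)) A B.
        on_arr (flag_pull C m \<alpha>) h = F \<and> on_arr (flag_pull C p \<beta>) h = G" by blast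
  next
    fix A B H H'
    assume "H \<in> hom (core (flag_category C z n)) A B" "H' \<in> hom (core (flag_category C z n)) A B"
      and eq: "on_arr (flag_pull C m \<alpha>) H = on_arr (flag_pull C m \<alpha>) H'"
    then obtain h h' where "H = (A, B, h)" "H' = (A, B, h')" "flag_map n A B h" "flag_map n A B h'"
      by (auto simp: hom_core hom_flag_category)
    with eq show "H = H'" using faithful by simp
  next
    fix A B \<Phi>
    assume A: "A \<in> Obj (core (flag_category C z m))" and B: "B \<in> Obj (core (flag_category C z p))"
      and "\<Phi> \<in> hom (core (flag_category C z 1)) (on_obj (flag_pull C 1 \<gamma>) A) (on_obj (flag_pull C 1 \<delta>) B)"
    then obtain \<phi> where \<Phi>: "\<Phi> = (tri_pull C 1 \<gamma> A, tri_pull C 1 \<delta> B, \<phi>)"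
      and \<phi>: "is_iso (flag_category C z 1) (tri_pull C 1 \<gamma> A, tri_pull C 1 \<delta> B, \<phi>)"
      by (auto simp: hom_core hom_flag_category)
    from A B have AB: "A \<in> flags C z m" "B \<in> flags C z p" by simp_all
    obtain E f g where E: "E \<in> flags C z n"
      and f: "is_iso (flag_category C z m) (tri_pull C m \<alpha> E, A, f)"
      and g: "is_iso (flag_category C z p) (tri_pull C p \<beta> E, B, g)"
      and eq: "\<phi> 0 1 \<cdot> f (\<gamma> 0) (\<gamma> 1) = g (\<delta> 0) (\<delta> 1)"
      using surj[OF AB \<phi>] by blast
    note fm = flag_iso_map[OF f] and gm = flag_iso_map[OF g]
    have l: "flag_map 1 (tri_pull C 1 \<gamma> (tri_pull C m \<alpha> E)) (tri_pull C 1 \<delta> B)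
        (tri_fam 1 (\<lambda>i j. \<phi> i j \<cdot> tri_fam 1 (\<lambda>i j. f (\<gamma> i) (\<gamma> j)) i j))"
      by (rule flag_map_comp[OF flag_map_pull[OF fm c] flag_iso_map[OF \<phi>]])
    have r: "flag_map 1 (tri_pull C 1 \<gamma> (tri_pull C m \<alpha> E)) (tri_pull C 1 \<delta> B)
        (tri_fam 1 (\<lambda>i j. g (\<delta> i) (\<delta> j)))"
      using flag_map_pull[OF gm d] pull_comm[OF E] by simp
    \<comment> \<open>The square of arrows over the edge commutes once it does at the largest
      component \<open>(0, 1)\<close>, which is the equation from \<open>surj\<close>.\<close>
    have "tri_fam 1 (\<lambda>i j. \<phi> i j \<cdot> tri_fam 1 (\<lambda>i j. f (\<gamma> i) (\<gamma> j)) i j) = tri_fam 1 (\<lambda>i j. g (\<delta> i) (\<delta> j))"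
      by (rule flag_map_eqI[OF l r]) (use eq in \<open>simp add: tri_fam_apply\<close>)
    then have "\<Phi> \<cdot>\<^bsub>core (flag_category C z 1)\<^esub> on_arr (flag_pull C 1 \<gamma>) (tri_pull C m \<alpha> E, A, f) =
        on_arr (flag_pull C 1 \<delta>) (tri_pull C p \<beta> E, B, g)"
      using pull_comm[OF E] by (simp add: \<Phi>)
    moreover have "(tri_pull C m \<alpha> E, A, f) \<in> hom (core (flag_category C z m)) (on_obj (flag_pull C m \<alpha>) E) A"
      "(tri_pull C p \<beta> E, B, g) \<in> hom (core (flag_category C z p)) (on_obj (flag_pull C p \<beta>) E) B"
      using f g fm gm by (simp_all add: hom_core hom_flag_category)
    ultimately show "\<exists>x \<in> Obj (core (flag_category C z n)).
        \<exists>f \<in> hom (core (flag_category C z m)) (on_obj (flag_pull C m \<alpha>) x) A.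
        \<exists>g \<in> hom (core (flag_category C z p)) (on_obj (flag_pull C p \<beta>) x) B.
        \<Phi> \<cdot>\<^bsub>core (flag_category C z 1)\<^esub> on_arr (flag_pull C 1 \<gamma>) f = on_arr (flag_pull C 1 \<delta>) g"
      using E by (intro bexI[of _ E] bexI[of _ "(tri_pull C m \<alpha> E, A, f)"]
          bexI[of _ "(tri_pull C p \<beta> E, B, g)"]) simp_all
  qed (use category.core_groupoid[OF category_flag_category]
      functor_core[OF category_flag_category flag_pull_functor] a b c d in auto)
qed

end

section \<open>The 2-Segal squares\<close>

context pointed_proto_abelian
begin

section \<open>The unital squares\<close>

lemma codegen_Delta: "i \<le> n \<Longrightarrow> codegen n i \<in> Delta (Suc n) n"
  by (rule DeltaI) (auto simp: codegen_def)

lemma const_Delta: "i \<le> n \<Longrightarrow> (\<lambda>k\<in>{..0}. i + k) \<in> Delta 0 n"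
  by (rule DeltaI) auto

lemma edge_Delta: "i < n \<Longrightarrow> (\<lambda>k\<in>{..1}. i + k) \<in> Delta 1 n"
  by (rule DeltaI) auto

text \<open>\<open>\<epsilon>\<close> leaves out the vertex \<open>i + 1\<close>, one of the two
  that \<open>codegen n i\<close> sends to \<open>i\<close>.\<close>

lemma codegen_section:
  assumes i: "i \<le> n"
  defines "\<epsilon> \<equiv> \<lambda>k\<in>{..n}. if k \<le> i then k else k + 1"
  shows "\<epsilon> \<in> Delta n (Suc n)" and "compose {..n} (codegen n i) \<epsilon> = (\<lambda>k\<in>{..n}. k)"
proof -
  show "\<epsilon> \<in> Delta n (Suc n)" unfolding \<epsilon>_def by (rule DeltaI) auto
  show "compose {..n} (codegen n i) \<epsilon> = (\<lambda>k\<in>{..n}. k)"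
    unfolding \<epsilon>_def codegen_def compose_def using i by (auto simp: fun_eq_iff)
qed

text \<open>A flag on one vertex consists of the chosen zero object, so equality is strict and no
  isomorphism is required.\<close>

lemma vertex_flag_eq:
  assumes A: "A \<in> flags C z 0" and B: "B \<in> flags C z 0"
  shows "A = B"
  by (rule flag_eqI[OF A B])
    (use tri_diagD(1,3)[OF tri_diag_flag[OF A]] tri_diagD(1,3)[OF tri_diag_flag[OF B]] in simp_all)

text \<open>Restriction along the section \<open>\<epsilon>\<close> undoes the degeneracy, which
  lifts maps and gives the candidate \<open>E\<close> for a flag \<open>A\<close>. Going back by the
  degeneracy replaces \<open>ob A 0 (Suc i)\<close> by \<open>ob A 0 i\<close>; the result is
  isomorphic to \<open>A\<close> when \<open>ob A i (Suc i)\<close> vanishes.\<close>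

lemma unital_square:
  assumes i: "i \<le> n"
  shows "two_pullback_square (core (flag_category C z n)) (core (flag_category C z (Suc n)))
    (core (flag_category C z 0)) (core (flag_category C z 1))
    (flag_pull C (Suc n) (codegen n i)) (flag_pull C 0 (\<lambda>k\<in>{..0}. i + k))
    (flag_pull C 1 (\<lambda>k\<in>{..1}. i + k)) (flag_pull C 1 (codegen 0 0))"
proof -
  define \<alpha> where "\<alpha> = codegen n i"
  define \<beta> :: "nat \<Rightarrow> nat" where "\<beta> = (\<lambda>k\<in>{..0}. i + k)"
  define \<gamma> :: "nat \<Rightarrow> nat" where "\<gamma> = (\<lambda>k\<in>{..1}. i + k)"
  define \<delta> where "\<delta> = codegen 0 0"
  define \<epsilon> :: "nat \<Rightarrow> nat" where "\<epsilon> = (\<lambda>k\<in>{..n}. if k \<le> i then k else k + 1)"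
  have a: "\<alpha> \<in> Delta (Suc n) n" unfolding \<alpha>_def using codegen_Delta[OF i] .
  have b: "\<beta> \<in> Delta 0 n" unfolding \<beta>_def using const_Delta[OF i] .
  have c: "\<gamma> \<in> Delta 1 (Suc n)" unfolding \<gamma>_def using edge_Delta i by simp
  have d: "\<delta> \<in> Delta 1 0" unfolding \<delta>_def using codegen_Delta[of 0 0] by simp
  have e: "\<epsilon> \<in> Delta n (Suc n)" and ea: "compose {..n} \<alpha> \<epsilon> = (\<lambda>k\<in>{..n}. k)"
    unfolding \<epsilon>_def \<alpha>_def using codegen_section[OF i] by auto
  have \<alpha>\<epsilon>: "\<alpha> (\<epsilon> k) = k" if "k \<le> n" for k
    using fun_cong[OF ea, of k] that by (simp add: compose_def)
  have \<alpha>v: "\<alpha> 0 = 0" "\<alpha> (Suc n) = n" "\<alpha> i = i" "\<alpha> (Suc i) = i" using i by (auto simp: \<alpha>_def codegen_def)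
  have \<epsilon>\<alpha>: "\<epsilon> (\<alpha> k) = (if k = Suc i then i else k)" if "k \<le> Suc n" for k
    using that i by (auto simp: \<epsilon>_def \<alpha>_def codegen_def)
  have \<gamma>v: "\<gamma> 0 = i" "\<gamma> 1 = Suc i" and \<delta>v: "\<delta> 0 = 0" "\<delta> 1 = 0" and \<beta>v: "\<beta> 0 = i"
    by (auto simp: \<gamma>_def \<delta>_def \<beta>_def codegen_def)
  have retract: "tri_pull C n \<epsilon> (tri_pull C (Suc n) \<alpha> A) = A" if "A \<in> flags C z n" for A
    using tri_pull_compose[OF that e a] ea tri_pull_id[OF that] by simp
  have "two_pullback_square (core (flag_category C z n)) (core (flag_category C z (Suc n)))
    (core (flag_category C z 0)) (core (flag_category C z 1))
    (flag_pull C (Suc n) \<alpha>) (flag_pull C 0 \<beta>) (flag_pull C 1 \<gamma>) (flag_pull C 1 \<delta>)"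
  proof (rule flag_two_pullback_squareI[OF a b c d])
    fix k :: nat assume "k \<le> 1"
    then have "k = 0 \<or> k = 1" by auto
    then show "\<alpha> (\<gamma> k) = \<beta> (\<delta> k)" using \<alpha>v \<gamma>v \<delta>v \<beta>v by auto
  next
    fix A B f g
    assume A: "A \<in> flags C z n" and B: "B \<in> flags C z n"
      and f: "flag_map (Suc n) (tri_pull C (Suc n) \<alpha> A) (tri_pull C (Suc n) \<alpha> B) f"
      and g: "flag_map 0 (tri_pull C 0 \<beta> A) (tri_pull C 0 \<beta> B) g"
    let ?h = "tri_fam n (\<lambda>i j. f (\<epsilon> i) (\<epsilon> j))"
    have h: "flag_map n A B ?h"
      using flag_map_pull[OF f e] retract A B by simp
    \<comment> \<open>If \<open>i = n\<close>, then \<open>\<epsilon>\<close> ends at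
      \<open>n\<close> and misses the largest object of the degenerate flag. The last two steps of
      that flag are joined by an identity, so the components of \<open>f\<close> there agree by
      naturality.\<close>
    have "f 0 (\<epsilon> n) = f 0 (Suc n)"
    proof (cases "i = n")
      case False
      then show ?thesis using i by (simp add: \<epsilon>_def)
    next
      case True
      have D: "tri_diag n (ob A) (tri_map A)" "tri_diag n (ob B) (tri_map B)"
        using tri_diag_flag A B by auto
      have "f 0 n \<in> hom C (ob A 0 n) (ob B 0 n)" "f 0 (Suc n) \<in> hom C (ob A 0 n) (ob B 0 n)"
        using flag_mapD(3)[OF f, of 0 n] flag_mapD(3)[OF f, of 0 "Suc n"] True \<alpha>v
        by (simp_all add: ob_tri_pull)
      moreover have "tri_map (tri_pull C (Suc n) \<alpha> B) 0 n 0 (Suc n) \<cdot> f 0 n =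
          f 0 (Suc n) \<cdot> tri_map (tri_pull C (Suc n) \<alpha> A) 0 n 0 (Suc n)"
        using flag_mapD(4)[OF f] by simp
      moreover have "tri_map (tri_pull C (Suc n) \<alpha> A) 0 n 0 (Suc n) = Ident C (ob A 0 n)"
        "tri_map (tri_pull C (Suc n) \<alpha> B) 0 n 0 (Suc n) = Ident C (ob B 0 n)"
        using tri_map_tri_pull[OF A a] tri_map_tri_pull[OF B a] True \<alpha>v tri_diagD(3)[OF D(1)]
          tri_diagD(3)[OF D(2)] by simp_all
      ultimately have "f 0 n = f 0 (Suc n)" using Ident_left Ident_right by metis
      then show ?thesis using True by (simp add: \<epsilon>_def)
    qed
    then have "?h 0 n = f 0 (Suc n)" by (simp add: tri_fam_apply) (simp add: \<epsilon>_def)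
    then have "tri_fam (Suc n) (\<lambda>i j. ?h (\<alpha> i) (\<alpha> j)) = f"
      by (intro flag_map_eqI[OF flag_map_pull[OF h a] f]) (simp add: tri_fam_apply[of _ "Suc n"] \<alpha>v)
    \<comment> \<open>Maps of flags on one vertex have the zero object as target, so there is just
      one.\<close>
    moreover have "tri_fam 0 (\<lambda>i j. ?h (\<beta> i) (\<beta> j)) = g"
    proof (rule flag_map_eqI[OF flag_map_pull[OF h b] g])
      note gh = flag_mapD(3)[OF g, of 0 0] flag_mapD(3)[OF flag_map_pull[OF h b], of 0 0]
      have "ob B i i = z" using flagsD(2)[OF B i] .
      then show "tri_fam 0 (\<lambda>i j. ?h (\<beta> i) (\<beta> j)) 0 0 = g 0 0"
        using to_zero_unique gh by (simp add: ob_tri_pull \<beta>v)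
    qed
    ultimately show "\<exists>h. flag_map n A B h \<and> tri_fam (Suc n) (\<lambda>i j. h (\<alpha> i) (\<alpha> j)) = f \<and>
        tri_fam 0 (\<lambda>i j. h (\<beta> i) (\<beta> j)) = g" using h by blast
  next
    fix A B h h' assume h: "flag_map n A B h" and h': "flag_map n A B h'"
      and "tri_fam (Suc n) (\<lambda>i j. h (\<alpha> i) (\<alpha> j)) = tri_fam (Suc n) (\<lambda>i j. h' (\<alpha> i) (\<alpha> j))"
    from fun_cong[OF fun_cong[OF this(3)], of 0 "Suc n"] show "h = h'"
      by (intro flag_map_eqI[OF h h']) (simp add: tri_fam_apply \<alpha>v)
  next
    fix A B \<phi>
    assume A: "A \<in> flags C z (Suc n)" and B: "B \<in> flags C z 0"
      and \<phi>: "is_iso (flag_category C z 1) (tri_pull C 1 \<gamma> A, tri_pull C 1 \<delta> B, \<phi>)"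
    note D = tri_diag_flag[OF A]
    have \<phi>01: "\<phi> 0 1 \<in> hom C (ob A i (Suc i)) z" "is_iso C (\<phi> 0 1)"
      using flag_mapD(3)[OF flag_iso_map[OF \<phi>], of 0 1] flag_iso_component[OF \<phi>, of 0 1] \<gamma>v \<delta>v
        flagsD(2)[OF B, of 0] by (simp_all add: ob_tri_pull)
    obtain \<psi> where \<psi>: "\<psi> \<in> hom C z (ob A i (Suc i))" "\<phi> 0 1 \<cdot> \<psi> = Ident C z"
      "\<psi> \<cdot> \<phi> 0 1 = Ident C (ob A i (Suc i))"
      using is_iso_iff[OF \<phi>01(1)] \<phi>01(2) by blast
    \<comment> \<open>\<open>\<psi>\<close> inverts the isomorphism of \<open>ob A i (Suc i)\<close>
      with zero. It is the bottom of a bicartesian square with top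
      \<open>ob A 0 i \<rightarrow> ob A 0 (Suc i)\<close>, so this top is invertible too.\<close>
    have "tri_map A i i i (Suc i) = \<psi>"
      using from_zero_unique[OF _ \<psi>(1)] tri_diagD(4)[OF D, of i i i "Suc i"] tri_diagD(1)[OF D, of i] i
      by simp
    moreover have "is_iso C \<psi>" using is_iso_iff[OF \<psi>(1)] \<psi>(2,3) \<phi>01(1) by blast
    ultimately have iso: "is_iso C (tri_map A 0 i 0 (Suc i))"
      using bic_iso_top[OF tri_diagD(6)[OF D, of 0 i i "Suc i"]] i by simp
    define E where "E = tri_pull C n \<epsilon> A"
    have E: "E \<in> flags C z n" unfolding E_def using tri_pull_in[OF A e] .
    define A' where "A' = tri_pull C (Suc n) \<alpha> E"
    have A': "A' \<in> flags C z (Suc n)" unfolding A'_def using tri_pull_in[OF E a] .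
    have A'_ob: "ob A' 0 k = ob A 0 (\<epsilon> (\<alpha> k))" if "k \<le> Suc n" for k
      using that Delta_le[OF a that] \<epsilon>\<alpha>[of 0] \<alpha>v by (simp add: A'_def E_def ob_tri_pull)
    have A'_map: "tri_map A' 0 k 0 l = tri_map A 0 (\<epsilon> (\<alpha> k)) 0 (\<epsilon> (\<alpha> l))"
      if "k \<le> l" "l \<le> Suc n" for k l
      using tri_map_tri_pull[OF E a, of 0 k 0 l] that Delta_le[OF a that(2)] Delta_mono[OF a that]
        tri_map_tri_pull[OF A e, of 0 "\<alpha> k" 0 "\<alpha> l"] \<epsilon>\<alpha>[of 0] \<alpha>v by (simp add: A'_def E_def)
    \<comment> \<open>An identity for every \<open>k\<close> except \<open>Suc i\<close>, where it
      is the inclusion of \<open>ob A 0 i\<close> just shown to be invertible.\<close>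
    define F where "F k = tri_map A 0 (\<epsilon> (\<alpha> k)) 0 k" for k
    have \<epsilon>\<alpha>_le: "\<epsilon> (\<alpha> k) \<le> k" if "k \<le> Suc n" for k using \<epsilon>\<alpha>[OF that] by simp
    have "is_iso C (F k)" if k: "k \<le> Suc n" for k
      using \<epsilon>\<alpha>[OF k] iso iso_Ident tri_diagD(2,3)[OF D, of 0 k] k by (auto simp: F_def)
    moreover have "F k \<in> hom C (ob A' 0 k) (ob A 0 k)" if k: "k \<le> Suc n" for k
      using tri_diagD(4)[OF D, of 0 "\<epsilon> (\<alpha> k)" 0 k] \<epsilon>\<alpha>_le[OF k] k by (simp add: F_def A'_ob)
    moreover have "tri_map A 0 k 0 (Suc n) \<cdot> F k = F (Suc n) \<cdot> tri_map A' 0 k 0 (Suc n)"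
      if k: "k \<le> Suc n" for k
    proof -
      have "\<epsilon> (\<alpha> k) \<le> \<epsilon> (\<alpha> (Suc n))"
        using Delta_mono[OF a, of k "Suc n"] Delta_le[OF a, of "Suc n"] Delta_mono[OF e] k by simp
      then show ?thesis
        using tri_diagD(5)[OF D, of 0 "\<epsilon> (\<alpha> k)" 0 k 0 "Suc n"] \<epsilon>\<alpha>_le[OF k] k
          tri_diagD(5)[OF D, of 0 "\<epsilon> (\<alpha> k)" 0 "\<epsilon> (\<alpha> (Suc n))" 0 "Suc n"] \<epsilon>\<alpha>_le[of "Suc n"]
        by (simp add: F_def A'_map)
    qed
    ultimately obtain f where f: "is_iso (flag_category C z (Suc n)) (A', A, f)"
      using flag_iso_extend[OF A' A] by metis
    have B0: "tri_pull C 0 \<beta> E = B" using vertex_flag_eq[OF tri_pull_in[OF E b] B] .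
    define g where "g = tri_fam 0 (\<lambda>i j. Ident C (ob B i j))"
    have g: "is_iso (flag_category C z 0) (tri_pull C 0 \<beta> E, B, g)"
      using category.iso_Ident[OF category_flag_category, of B 0] B unfolding B0 g_def by simp
    have "ob A' i (Suc i) = z"
      using flagsD(2)[OF E i] i \<alpha>v by (simp add: A'_def ob_tri_pull)
    then have "f i (Suc i) \<in> hom C z (ob A i (Suc i))"
      using flag_mapD(3)[OF flag_iso_map[OF f], of i "Suc i"] i by simp
    moreover have "g 0 0 \<in> hom C z z"
      using flag_mapD(3)[OF flag_iso_map[OF g], of 0 0] flagsD(2)[OF B, of 0] by (simp add: B0)
    \<comment> \<open>The degenerate flag has \<open>z\<close> at \<open>(i, i + 1)\<close>, so both
      sides are endomorphisms of the zero object.\<close>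
    ultimately have "\<phi> 0 1 \<cdot> f (\<gamma> 0) (\<gamma> 1) = g (\<delta> 0) (\<delta> 1)"
      using to_zero_unique[OF Comp_in[OF _ \<phi>01(1)]] unfolding \<gamma>v \<delta>v by blast
    with E f g show "\<exists>E f g. E \<in> flags C z n \<and>
        is_iso (flag_category C z (Suc n)) (tri_pull C (Suc n) \<alpha> E, A, f) \<and>
        is_iso (flag_category C z 0) (tri_pull C 0 \<beta> E, B, g) \<and>
        \<phi> 0 1 \<cdot> f (\<gamma> 0) (\<gamma> 1) = g (\<delta> 0) (\<delta> 1)"
      unfolding A'_def by blast
  qed
  then show ?thesis by (simp add: \<alpha>_def \<beta>_def \<gamma>_def \<delta>_def)
qed

section \<open>The polygon squares\<close>

text \<open>\<open>j - i - 1\<close> counts the vertices cut off between \<open>i\<close> and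
  \<open>j\<close>. The first two maps enumerate \<open>{0..i} \<union> {j..n}\<close> and
  \<open>{i..j}\<close>; the last two give the positions of \<open>i\<close> and \<open>j\<close> in
  these sets, namely \<open>i\<close>, \<open>i + 1\<close> and \<open>0\<close>,
  \<open>j - i\<close>.\<close>

lemma polygon_Delta:
  assumes "i + 2 \<le> j" "j \<le> n"
  shows "(\<lambda>k\<in>{..n - (j - i - 1)}. if k \<le> i then k else k + (j - i - 1)) \<in> Delta (n - (j - i - 1)) n"
    and "(\<lambda>k\<in>{..j - i}. i + k) \<in> Delta (j - i) n"
    and "(\<lambda>k\<in>{..1}. i + k) \<in> Delta 1 (n - (j - i - 1))"
    and "(\<lambda>k\<in>{..1}. k * (j - i)) \<in> Delta 1 (j - i)"
  by (rule DeltaI; use assms in auto)+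

text \<open>The polygon is glued from a flag \<open>A\<close> on \<open>{0..i} \<union> {j..n}\<close> and a flag \<open>B\<close> on \<open>{i..j}\<close>:
  for \<open>i \<le> k \<le> j\<close> the \<open>k\<close>-th step \<open>P k\<close> of its top row is the preimage of
  \<open>B\<^sub>0\<^sub>,\<^sub>k\<^sub>-\<^sub>i \<hookrightarrow> B\<^sub>0\<^sub>,\<^sub>j\<^sub>-\<^sub>i\<close> under the epimorphism \<open>A\<^sub>0\<^sub>,\<^sub>i\<^sub>+\<^sub>1 \<twoheadrightarrow> A\<^sub>i\<^sub>,\<^sub>i\<^sub>+\<^sub>1 \<cong> B\<^sub>0\<^sub>,\<^sub>j\<^sub>-\<^sub>i\<close>.\<close>

lemma preimage_steps:
  assumes A: "A \<in> flags C z m" and B: "B \<in> flags C z p" and i: "i < m" and p: "0 < p"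
    and \<theta>: "\<theta> \<in> hom C (ob A i (Suc i)) (ob B 0 p)" "is_iso C \<theta>"
  defines "e \<equiv> \<theta> \<cdot> tri_map A 0 (Suc i) i (Suc i)"
  obtains P u v where
    "\<And>k. k \<le> p \<Longrightarrow> bic (P k) (ob A 0 (Suc i)) (ob B 0 k) (ob B 0 p)
      (u k) (v k) e (tri_map B 0 k 0 p)"
    "P 0 = ob A 0 i" "u 0 = tri_map A 0 i 0 (Suc i)"
    "P p = ob A 0 (Suc i)" "u p = Ident C (ob A 0 (Suc i))" "v p = e"
proof -
  note DA = tri_diag_flag[OF A] and DB = tri_diag_flag[OF B]
  have q: "tri_map A 0 (Suc i) i (Suc i) \<in> hom C (ob A 0 (Suc i)) (ob A i (Suc i))"
    "is_epi C (tri_map A 0 (Suc i) i (Suc i))"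
    using tri_diagD(4)[OF DA] tri_diag_epi[OF DA] i by simp_all
  have e: "e \<in> hom C (ob A 0 (Suc i)) (ob B 0 p)" "is_epi C e"
    unfolding e_def using Comp_in[OF q(1) \<theta>(1)] epi_comp[OF q(2) iso_epi[OF \<theta>(2,1)] q(1) \<theta>(1)] by auto
  have B00: "ob B 0 0 = z" using tri_diagD(1)[OF DB] by simp
  \<comment> \<open>The preimages of zero and of everything are prescribed, so that the new steps
    fit without a seam between \<open>ob A 0 i\<close> and \<open>ob A 0 (Suc i)\<close>. For
    \<open>k = 0\<close> the square defining \<open>ob A i (Suc i)\<close>, with its last corner
    moved along \<open>\<theta>\<close>, is the required pullback.\<close>
  have "\<exists>P u v. bic P (ob A 0 (Suc i)) (ob B 0 k) (ob B 0 p) u v e (tri_map B 0 k 0 p) \<and>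
    (k = 0 \<longrightarrow> P = ob A 0 i \<and> u = tri_map A 0 i 0 (Suc i)) \<and>
    (k = p \<longrightarrow> P = ob A 0 (Suc i) \<and> u = Ident C (ob A 0 (Suc i)) \<and> v = e)" if k: "k \<le> p" for k
  proof -
    have b: "tri_map B 0 k 0 p \<in> hom C (ob B 0 k) (ob B 0 p)" "is_mono C (tri_map B 0 k 0 p)"
      using tri_diagD(4)[OF DB] tri_diag_mono[OF DB] k by simp_all
    consider "k = 0" | "k = p" | "k \<noteq> 0" "k \<noteq> p" by blast
    then show ?thesis
    proof cases
      case 1
      have s: "bic (ob A 0 i) (ob A 0 (Suc i)) z (ob A i (Suc i)) (tri_map A 0 i 0 (Suc i))
        (tri_map A 0 i i i) (tri_map A 0 (Suc i) i (Suc i)) (tri_map A i i i (Suc i))"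
        using tri_diagD(6)[OF DA, of 0 i i "Suc i"] tri_diagD(1)[OF DA, of i] i by simp
      have "\<theta> \<cdot> tri_map A i i i (Suc i) = tri_map B 0 0 0 p"
        using from_zero_unique[OF Comp_in[OF bic_hom(4)[OF s] \<theta>(1)]] b(1) 1 B00 by simp
      then show ?thesis
        using bic_iso_corner[OF s \<theta>] 1 p B00 unfolding e_def by auto
    next
      case 2
      then show ?thesis
        using bic_id_hor[OF e] tri_diagD(3)[OF DB, of 0 p] p by auto
    next
      case 3
      then show ?thesis using bic_pullback_exists[OF e(1) b(1) e(2) b(2)] by metis
    qed
  qed
  then obtain P u v where P: "\<And>k. k \<le> p \<Longrightarrow>
      bic (P k) (ob A 0 (Suc i)) (ob B 0 k) (ob B 0 p) (u k) (v k) e (tri_map B 0 k 0 p) \<and>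
      (k = 0 \<longrightarrow> P k = ob A 0 i \<and> u k = tri_map A 0 i 0 (Suc i)) \<and>
      (k = p \<longrightarrow> P k = ob A 0 (Suc i) \<and> u k = Ident C (ob A 0 (Suc i)) \<and> v k = e)"
    by metis
  show ?thesis
    using that[of P u v] P P[of 0] P[of p] by simp
qed

text \<open>\<open>E\<close> is the flag of the filtration of \<open>ob A 0 m\<close> by the steps
  of \<open>A\<close> and the preimages \<open>P k\<close>. Restricted along \<alpha> it has the
  filtration of \<open>A\<close> itself. Restricted along \<beta> it has the entries
  \<open>P k / P 0\<close>, and the square of \<open>P 0\<close>, \<open>P k\<close>, zero and
  \<open>ob B 0 k\<close> shows that \<open>ob B 0 k\<close> is the same quotient.\<close>

lemma polygon_glue:
  assumes ij: "i + 2 \<le> j" "j \<le> n"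
  defines "m \<equiv> n - (j - i - 1)"
    and "\<alpha> \<equiv> \<lambda>k\<in>{..n - (j - i - 1)}. if k \<le> i then k else k + (j - i - 1)"
    and "\<beta> \<equiv> \<lambda>k\<in>{..j - i}. i + k"
  assumes A: "A \<in> flags C z m" and B: "B \<in> flags C z (j - i)"
    and \<theta>: "\<theta> \<in> hom C (ob A i (Suc i)) (ob B 0 (j - i))" "is_iso C \<theta>"
  obtains E f g where "E \<in> flags C z n" "is_iso (flag_category C z m) (tri_pull C m \<alpha> E, A, f)"
    "is_iso (flag_category C z (j - i)) (tri_pull C (j - i) \<beta> E, B, g)"
    "\<theta> \<cdot> f i (Suc i) = g 0 (j - i)"
proof -
  note DA = tri_diag_flag[OF A] and DB = tri_diag_flag[OF B]
  define d where "d = j - i - 1"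
  have md: "m = n - d" "i < m" "m + d = n" "Suc i + d = j" using ij by (auto simp: m_def d_def)
  have a: "\<alpha> \<in> Delta m n" and b: "\<beta> \<in> Delta (j - i) n"
    using polygon_Delta(1,2)[OF ij] by (auto simp: \<alpha>_def \<beta>_def m_def)
  have \<alpha>_eq: "\<alpha> k = (if k \<le> i then k else k + d)" if "k \<le> m" for k
    using that by (simp add: \<alpha>_def m_def d_def)
  have \<beta>_eq: "\<beta> k = i + k" if "k \<le> j - i" for k using that by (simp add: \<beta>_def)
  define p where "p = j - i"
  have pij: "i + p = j" "0 < p" using ij by (auto simp: p_def)
  define e where "e = \<theta> \<cdot> tri_map A 0 (Suc i) i (Suc i)"
  obtain P u v where
    P: "\<And>k. k \<le> p \<Longrightarrow> bic (P k) (ob A 0 (Suc i)) (ob B 0 k) (ob B 0 p)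
      (u k) (v k) e (tri_map B 0 k 0 p)"
    and P0: "P 0 = ob A 0 i" "u 0 = tri_map A 0 i 0 (Suc i)"
    and Pp: "P p = ob A 0 (Suc i)" "u p = Ident C (ob A 0 (Suc i))" "v p = e"
    using preimage_steps[OF A B md(2) _ \<theta>] pij(2) unfolding p_def e_def by blast
  note Ph = bic_hom[OF P]
  \<comment> \<open>The filtration of the glued flag with its inclusions \<open>s k\<close> into the
    largest object of \<open>A\<close>. From \<open>j\<close> on the steps of \<open>A\<close>
    reappear, shifted by the \<open>d\<close> inserted vertices.\<close>
  define X where "X k = (if k \<le> i then ob A 0 k else if k < j then P (k - i) else ob A 0 (k - d))" for k
  define s where "s k = (if k \<le> i then tri_map A 0 k 0 m
    else if k < j then tri_map A 0 (Suc i) 0 m \<cdot> u (k - i) else tri_map A 0 (k - d) 0 m)" for k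
  have t: "tri_map A 0 k 0 l \<in> hom C (ob A 0 k) (ob A 0 l)" "is_mono C (tri_map A 0 k 0 l)"
    if "k \<le> l" "l \<le> m" for k l
    using tri_diagD(4)[OF DA] tri_diag_mono[OF DA] that by simp_all
  have t': "tri_map A 0 (Suc i) 0 m \<in> hom C (ob A 0 (Suc i)) (ob A 0 m)"
    "is_mono C (tri_map A 0 (Suc i) 0 m)" using t md(2) by simp_all
  have low: "X k = ob A 0 k \<and> s k = tri_map A 0 k 0 m" if "k \<le> i" for k
    using that by (simp add: X_def s_def)
  have high: "X (k + d) = ob A 0 k \<and> s (k + d) = tri_map A 0 k 0 m" if "i < k" for k
    using that md(4) by (simp add: X_def s_def)
  \<comment> \<open>The description by preimages extends to both ends \<open>k = 0\<close> and
    \<open>k = p\<close>, thanks to the prescribed values there. So it covers all of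
    \<open>{i..j}\<close> and overlaps with the description by \<open>A\<close> at \<open>i\<close>
    and \<open>j\<close>.\<close>
  have mid: "X (i + k) = P k" "s (i + k) = tri_map A 0 (Suc i) 0 m \<cdot> u k" if k: "k \<le> p" for k
  proof -
    consider "k = 0" | "k = p" | "0 < k" "k < p" using k by linarith
    then have "X (i + k) = P k \<and> s (i + k) = tri_map A 0 (Suc i) 0 m \<cdot> u k"
    proof cases
      case 1
      then show ?thesis
        using low[of i] P0 tri_diagD(5)[OF DA, of 0 i 0 "Suc i" 0 m] md(2) by simp
    next
      case 2
      have "i + k = Suc i + d" using 2 md(4) pij by simp
      then show ?thesis
        using high[of "Suc i"] Pp Ident_right[OF t'(1)] 2 by simp
    next
      case 3
      then show ?thesis using pij by (simp add: X_def s_def)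
    qed
    then show "X (i + k) = P k" "s (i + k) = tri_map A 0 (Suc i) 0 m \<cdot> u k" by auto
  qed
  have cases: "\<exists>l. k = \<alpha> l \<and> l \<le> m \<or> k = i + l \<and> l \<le> p" if "k \<le> n" for k
  proof -
    consider "k \<le> i" | "i < k" "k \<le> j" | "j < k" by linarith
    then show ?thesis
    proof cases
      case 1
      then show ?thesis using \<alpha>_eq[of k] md(2) by (intro exI[of _ k]) simp
    next
      case 2
      then show ?thesis using pij by (intro exI[of _ "k - i"]) auto
    next
      case 3
      then show ?thesis using \<alpha>_eq[of "k - d"] md that by (intro exI[of _ "k - d"]) auto
    qed
  qed
  have X\<alpha>: "X (\<alpha> k) = ob A 0 k" "s (\<alpha> k) = tri_map A 0 k 0 m" if "k \<le> m" for k
    using \<alpha>_eq[OF that] low[of k] high[of k] by auto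
  have s_hom: "s k \<in> hom C (X k) (ob A 0 m) \<and> is_mono C (s k)" if k: "k \<le> n" for k
  proof -
    from cases[OF k] obtain l where "k = \<alpha> l \<and> l \<le> m \<or> k = i + l \<and> l \<le> p" ..
    then show ?thesis
    proof (elim disjE conjE)
      assume "k = \<alpha> l" "l \<le> m"
      then show ?thesis using X\<alpha> t by simp
    next
      assume l: "k = i + l" "l \<le> p"
      then show ?thesis
        using mid[OF l(2)] Comp_in[OF Ph(1)[OF l(2)] t'(1)]
          mono_comp[OF Ph(5)[OF l(2)] t'(2) Ph(1)[OF l(2)] t'(1)] by simp
    qed
  qed
  have "\<exists>x \<in> hom C (X k) (X (Suc k)). s (Suc k) \<cdot> x = s k" if k: "k < n" for k
  proof -
    consider "k < i" | "i \<le> k" "k < j" | "j \<le> k" by linarith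
    then show ?thesis
    proof cases
      case 1
      then show ?thesis
        using low[of k] low[of "Suc k"] t(1)[of k "Suc k"] tri_diagD(5)[OF DA, of 0 k 0 "Suc k" 0 m] md(2)
        by (intro bexI[of _ "tri_map A 0 k 0 (Suc k)"]) simp_all
    next
      case 2
      define l where "l = k - i"
      have l: "k = i + l" "l \<le> p" "Suc l \<le> p" using 2 pij by (auto simp: l_def)
      have bl: "tri_map B 0 l 0 (Suc l) \<in> hom C (ob B 0 l) (ob B 0 (Suc l))"
        using tri_diagD(4)[OF DB] l by (simp add: p_def)
      \<comment> \<open>\<open>P l\<close> lies over \<open>ob B 0 l\<close>, hence over
        \<open>ob B 0 (Suc l)\<close>, and therefore maps to the preimage \<open>P (Suc l)\<close>
        of the latter.\<close>
      have "e \<cdot> u l = tri_map B 0 (Suc l) 0 p \<cdot> tri_map B 0 l 0 (Suc l) \<cdot> v l"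
        using Ph(9)[OF l(2)] Comp_assoc[OF Ph(2)[OF l(2)] bl Ph(4)[OF l(3)]]
          tri_diagD(5)[OF DB, of 0 l 0 "Suc l" 0 p] l by (simp add: p_def)
      from bic_pull[OF P[OF l(3)] Ph(1)[OF l(2)] Comp_in[OF Ph(2)[OF l(2)] bl] this]
      obtain x where x: "x \<in> hom C (P l) (P (Suc l))" "u (Suc l) \<cdot> x = u l" by metis
      then have "s (i + Suc l) \<cdot> x = s (i + l)"
        using mid[OF l(2)] mid[OF l(3)] Comp_assoc[OF x(1) Ph(1)[OF l(3)] t'(1)] by simp
      then show ?thesis using x(1) mid(1)[OF l(2)] mid(1)[OF l(3)] l(1) by auto
    next
      case 3
      define l where "l = k - d"
      have l: "k = l + d" "i < l" "Suc l \<le> m" using 3 md k by (auto simp: l_def)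
      then show ?thesis
        using high[of l] high[of "Suc l"] t(1)[of l "Suc l"] tri_diagD(5)[OF DA, of 0 l 0 "Suc l" 0 m]
        by (intro bexI[of _ "tri_map A 0 l 0 (Suc l)"]) simp_all
    qed
  qed
  moreover have "X 0 = z" using low[of 0] tri_diagD(1)[OF DA, of 0] by simp
  ultimately obtain E where E: "E \<in> flags C z n" and E_ob: "\<And>k. k \<le> n \<Longrightarrow> ob E 0 k = X k"
    and E_map: "\<And>k l. k \<le> l \<Longrightarrow> l \<le> n \<Longrightarrow> s l \<cdot> tri_map E 0 k 0 l = s k"
    using filtration_flag[of n s X "ob A 0 m"] s_hom by metis
  note DE = tri_diag_flag[OF E]
  have E_in: "tri_map E 0 k 0 l \<in> hom C (X k) (X l)" if "k \<le> l" "l \<le> n" for k l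
    using tri_diagD(4)[OF DE, of 0 k 0 l] E_ob that by simp
  note Ea = tri_pull_in[OF E a] and Eb = tri_pull_in[OF E b, folded p_def]
  have \<alpha>0: "\<alpha> 0 = 0" "\<alpha> m = n" using \<alpha>_eq[of 0] \<alpha>_eq[of m] md by simp_all

  \<comment> \<open>On the top row, \<open>E\<close> restricted along \<alpha> has the objects and
    inclusions of \<open>A\<close>, so identities extend to an isomorphism of flags.\<close>
  obtain f where f: "is_iso (flag_category C z m) (tri_pull C m \<alpha> E, A, f)"
    and f0: "\<And>k. k \<le> m \<Longrightarrow> f 0 k = Ident C (ob A 0 k)"
  proof (rule flag_iso_extend[OF Ea A, of "\<lambda>k. Ident C (ob A 0 k)"])
    fix k assume k: "k \<le> m"
    have Ak: "ob A 0 k \<in> Obj C" using tri_diagD(2)[OF DA] k by simp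
    have "ob (tri_pull C m \<alpha> E) 0 k = ob A 0 k"
      using E_ob[OF Delta_le[OF a k]] X\<alpha>[OF k] \<alpha>0 k by (simp add: ob_tri_pull)
    then show "Ident C (ob A 0 k) \<in> hom C (ob (tri_pull C m \<alpha> E) 0 k) (ob A 0 k)"
      using Ident_in[OF Ak] by simp
    show "is_iso C (Ident C (ob A 0 k))" using iso_Ident[OF Ak] .
    have "Ident C (ob A 0 m) \<cdot> tri_map E 0 (\<alpha> k) 0 n = tri_map A 0 k 0 m"
      using E_map[OF Delta_le[OF a k]] X\<alpha>[of m] X\<alpha>[OF k] \<alpha>0 tri_diagD(3)[OF DA, of 0 m] by simp
    then show "tri_map A 0 k 0 m \<cdot> Ident C (ob A 0 k) =
        Ident C (ob A 0 m) \<cdot> tri_map (tri_pull C m \<alpha> E) 0 k 0 m"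
      using Ident_right[OF t(1)[OF k]] tri_map_tri_pull[OF E a, of 0 k 0 m] \<alpha>0 k by simp
  qed blast

  \<comment> \<open>The inclusions in \<open>E\<close> are compatible with both legs of the preimage
    squares: with \<open>u\<close> because \<open>ob A 0 (Suc i)\<close> embeds in
    \<open>ob A 0 m\<close>, and then with \<open>v\<close> because \<open>ob B 0 l\<close> embeds
    in \<open>ob B 0 p\<close>.\<close>
  have uE: "u l \<cdot> tri_map E 0 (i + k) 0 (i + l) = u k"
    and vE: "v l \<cdot> tri_map E 0 (i + k) 0 (i + l) = tri_map B 0 k 0 l \<cdot> v k"
    if kl: "k \<le> l" "l \<le> p" for k l
  proof -
    have kp: "k \<le> p" using kl by simp
    have Ekl: "tri_map E 0 (i + k) 0 (i + l) \<in> hom C (P k) (P l)"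
      using E_in[of "i + k" "i + l"] mid(1)[OF kp] mid(1)[OF kl(2)] kl pij ij by simp
    have "(tri_map A 0 (Suc i) 0 m \<cdot> u l) \<cdot> tri_map E 0 (i + k) 0 (i + l) =
        tri_map A 0 (Suc i) 0 m \<cdot> u k"
      using E_map[of "i + k" "i + l"] mid(2)[OF kp] mid(2)[OF kl(2)] kl pij ij by simp
    then have "tri_map A 0 (Suc i) 0 m \<cdot> u l \<cdot> tri_map E 0 (i + k) 0 (i + l) =
        tri_map A 0 (Suc i) 0 m \<cdot> u k"
      using Comp_assoc[OF Ekl Ph(1)[OF kl(2)] t'(1)] by simp
    then show ue: "u l \<cdot> tri_map E 0 (i + k) 0 (i + l) = u k"
      using mono_cancel[OF t'(2,1) Comp_in[OF Ekl Ph(1)[OF kl(2)]] Ph(1)[OF kp]] by simp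
    have bkl: "tri_map B 0 k 0 l \<in> hom C (ob B 0 k) (ob B 0 l)"
      using tri_diagD(4)[OF DB] kl by (simp add: p_def)
    have "tri_map B 0 l 0 p \<cdot> v l \<cdot> tri_map E 0 (i + k) 0 (i + l) =
        (tri_map B 0 l 0 p \<cdot> v l) \<cdot> tri_map E 0 (i + k) 0 (i + l)"
      using Comp_assoc[OF Ekl Ph(2)[OF kl(2)] Ph(4)[OF kl(2)]] by simp
    also have "\<dots> = e \<cdot> u k"
      using Ph(9)[OF kl(2)] Comp_assoc[OF Ekl Ph(1)[OF kl(2)] Ph(3)[OF kl(2)]] ue by simp
    also have "\<dots> = tri_map B 0 l 0 p \<cdot> tri_map B 0 k 0 l \<cdot> v k"
      using Ph(9)[OF kp] Comp_assoc[OF Ph(2)[OF kp] bkl Ph(4)[OF kl(2)]]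
        tri_diagD(5)[OF DB, of 0 k 0 l 0 p] kl by (simp add: p_def)
    finally show "v l \<cdot> tri_map E 0 (i + k) 0 (i + l) = tri_map B 0 k 0 l \<cdot> v k"
      using mono_cancel[OF Ph(8)[OF kl(2)] Ph(4)[OF kl(2)] Comp_in[OF Ekl Ph(2)[OF kl(2)]]
          Comp_in[OF Ph(2)[OF kp] bkl]] by simp
  qed

  have "\<exists>w. w \<in> hom C (ob E i (i + k)) (ob B 0 k) \<and> is_iso C w \<and>
      w \<cdot> tri_map E 0 (i + k) i (i + k) = v k" if k: "k \<le> p" for k
  proof -
    have B0: "ob B 0 0 = z" using tri_diagD(1)[OF DB] by simp
    have le: "i + k \<le> n" "i \<le> n" using k pij ij by simp_all
    have b0: "tri_map B 0 0 0 k \<in> hom C z (ob B 0 k)"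
      using tri_diagD(4)[OF DB, of 0 0 0 k] B0 k by (simp add: p_def)
    have Ek: "tri_map E 0 i 0 (i + k) \<in> hom C (P 0) (P k)"
      using E_in[of i "i + k"] mid(1)[of 0] mid(1)[OF k] le by simp
    \<comment> \<open>The preimage square for \<open>0\<close> is a rectangle whose right part is
      the preimage square for \<open>k\<close>. Cancelling the latter exhibits
      \<open>ob B 0 k\<close> as the quotient of \<open>P k\<close> by \<open>P 0\<close>.\<close>
    have "bic (P 0) (P k) z (ob B 0 k) (tri_map E 0 i 0 (i + k)) (v 0) (v k) (tri_map B 0 0 0 k)"
    proof (rule bic_cancel_right[OF P[OF k] _ Ek b0])
      have "bic (P 0) (ob A 0 (Suc i)) z (ob B 0 p) (u 0) (v 0) e (tri_map B 0 0 0 p)"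
        using P[of 0] B0 by simp
      then show "bic (P 0) (ob A 0 (Suc i)) z (ob B 0 p) (u k \<cdot> tri_map E 0 i 0 (i + k)) (v 0) e
          (tri_map B 0 k 0 p \<cdot> tri_map B 0 0 0 k)"
        using uE[of 0 k] tri_diagD(5)[OF DB, of 0 0 0 k 0 p] k by (simp add: p_def)
      show "v k \<cdot> tri_map E 0 i 0 (i + k) = tri_map B 0 0 0 k \<cdot> v 0" using vE[of 0 k] k by simp
    qed
    moreover have s: "bic (P 0) (P k) z (ob E i (i + k)) (tri_map E 0 i 0 (i + k)) (tri_map E 0 i i i)
        (tri_map E 0 (i + k) i (i + k)) (tri_map E i i i (i + k))"
      using tri_diagD(6)[OF DE, of 0 i i "i + k"] tri_diagD(1)[OF DE, of i] E_ob[of i] E_ob[of "i + k"]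
        mid(1)[of 0] mid(1)[OF k] le by simp
    \<comment> \<open>Both are maps to zero, so the two squares are pushouts of the same span and
      \<open>bic_same_corner_iso\<close> applies.\<close>
    moreover have "tri_map E 0 i i i = v 0"
      using to_zero_unique[OF bic_hom(2)[OF s]] Ph(2)[of 0] B0 by simp
    ultimately have r: "bic (P 0) (P k) z (ob B 0 k) (tri_map E 0 i 0 (i + k)) (tri_map E 0 i i i)
        (v k) (tri_map B 0 0 0 k)" by simp
    obtain w where w: "w \<in> hom C (ob E i (i + k)) (ob B 0 k)"
      "w \<cdot> tri_map E 0 (i + k) i (i + k) = v k"
      using bic_push[OF s bic_hom(3,4,9)[OF r]] by metis
    with bic_same_corner_iso[OF s r w] show ?thesis by blast
  qed
  then obtain w where w: "\<And>k. k \<le> p \<Longrightarrow> w k \<in> hom C (ob E i (i + k)) (ob B 0 k)"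
    and w_iso: "\<And>k. k \<le> p \<Longrightarrow> is_iso C (w k)"
    and wv: "\<And>k. k \<le> p \<Longrightarrow> w k \<cdot> tri_map E 0 (i + k) i (i + k) = v k"
    by metis
  have Eik: "tri_map E 0 (i + k) i (i + k) \<in> hom C (P k) (ob E i (i + k))"
    "is_epi C (tri_map E 0 (i + k) i (i + k))"
    if k: "k \<le> p" for k
    using tri_diagD(4)[OF DE, of 0 "i + k" i "i + k"] tri_diag_epi[OF DE, of 0 i "i + k"]
      E_ob[of "i + k"] mid(1)[OF k] k pij ij by simp_all

  obtain g where g: "is_iso (flag_category C z p) (tri_pull C p \<beta> E, B, g)"
    and g0: "\<And>k. k \<le> p \<Longrightarrow> g 0 k = w k"
  proof (rule flag_iso_extend[OF Eb B[folded p_def], of w])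
    fix k assume k: "k \<le> p"
    show "w k \<in> hom C (ob (tri_pull C p \<beta> E) 0 k) (ob B 0 k)"
      using w[OF k] \<beta>_eq[of 0] \<beta>_eq[of k] k by (simp add: ob_tri_pull p_def)
    show "is_iso C (w k)" using w_iso[OF k] .
    have bk: "tri_map B 0 k 0 p \<in> hom C (ob B 0 k) (ob B 0 p)" using Ph(4)[OF k] .
    have le: "i + k \<le> i + p" "i + p \<le> n" using k pij ij by simp_all
    have Ekp: "tri_map E i (i + k) i (i + p) \<in> hom C (ob E i (i + k)) (ob E i (i + p))"
      using tri_diagD(4)[OF DE] le by simp
    have E0kp: "tri_map E 0 (i + k) 0 (i + p) \<in> hom C (P k) (P p)"
      using E_in[OF le] mid(1)[OF k] mid(1)[of p] by simp
    have "tri_map B 0 k 0 p \<cdot> w k = w p \<cdot> tri_map E i (i + k) i (i + p)"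
    proof (rule epi_cancel[OF Eik(2)[OF k] Eik(1)[OF k] Comp_in[OF w[OF k] bk] Comp_in[OF Ekp w[OF order_refl]]])
      have "(tri_map B 0 k 0 p \<cdot> w k) \<cdot> tri_map E 0 (i + k) i (i + k) = tri_map B 0 k 0 p \<cdot> v k"
        using Comp_assoc[OF Eik(1)[OF k] w[OF k] bk] wv[OF k] by simp
      also have "\<dots> = (w p \<cdot> tri_map E 0 (i + p) i (i + p)) \<cdot> tri_map E 0 (i + k) 0 (i + p)"
        using vE[OF k order_refl] wv[of p] by simp
      also have "\<dots> = w p \<cdot> tri_map E i (i + k) i (i + p) \<cdot> tri_map E 0 (i + k) i (i + k)"
        using Comp_assoc[OF E0kp Eik(1)[OF order_refl] w[OF order_refl]] le
          tri_diagD(5)[OF DE, of 0 "i + k" 0 "i + p" i "i + p"]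
          tri_diagD(5)[OF DE, of 0 "i + k" i "i + k" i "i + p"] by simp
      finally show "(tri_map B 0 k 0 p \<cdot> w k) \<cdot> tri_map E 0 (i + k) i (i + k) =
          (w p \<cdot> tri_map E i (i + k) i (i + p)) \<cdot> tri_map E 0 (i + k) i (i + k)"
        using Comp_assoc[OF Eik(1)[OF k] Ekp w[OF order_refl]] by simp
    qed
    then show "tri_map B 0 k 0 p \<cdot> w k = w p \<cdot> tri_map (tri_pull C p \<beta> E) 0 k 0 p"
      using tri_map_tri_pull[OF E b[folded p_def], of 0 k 0 p] \<beta>_eq k by (simp add: p_def)
  qed blast

  note fm = flag_iso_map[OF f]
  have Aq: "tri_map A 0 (Suc i) i (Suc i) \<in> hom C (ob A 0 (Suc i)) (ob A i (Suc i))"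
    using tri_diagD(4)[OF DA] md(2) by simp
  have \<alpha>i: "\<alpha> i = i" "\<alpha> (Suc i) = i + p" using \<alpha>_eq[of i] \<alpha>_eq[of "Suc i"] md pij by simp_all
  have fi: "f i (Suc i) \<in> hom C (ob E i (i + p)) (ob A i (Suc i))"
    using flag_mapD(3)[OF fm, of i "Suc i"] md(2) \<alpha>i by (simp add: ob_tri_pull)
  \<comment> \<open>Tested on the epimorphism from \<open>P p\<close>, that is from
    \<open>ob A 0 (Suc i)\<close>: there \<open>f\<close> is an identity, and both sides become
    \<open>e\<close>.\<close>
  have "\<theta> \<cdot> f i (Suc i) = w p"
  proof (rule epi_cancel[OF Eik(2)[OF order_refl] Eik(1)[OF order_refl] Comp_in[OF fi \<theta>(1)]])
    show "w p \<in> hom C (ob E i (i + p)) (ob B 0 (j - i))" using w[of p] by (simp add: p_def)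
    have "tri_map A 0 (Suc i) i (Suc i) \<cdot> f 0 (Suc i) =
        f i (Suc i) \<cdot> tri_map (tri_pull C m \<alpha> E) 0 (Suc i) i (Suc i)"
      using flag_mapD(4)[OF fm] md(2) by simp
    then have "f i (Suc i) \<cdot> tri_map E 0 (i + p) i (i + p) = tri_map A 0 (Suc i) i (Suc i)"
      using f0[of "Suc i"] Ident_right[OF Aq] tri_map_tri_pull[OF E a] \<alpha>i \<alpha>0 md(2) by simp
    then show "(\<theta> \<cdot> f i (Suc i)) \<cdot> tri_map E 0 (i + p) i (i + p) =
        w p \<cdot> tri_map E 0 (i + p) i (i + p)"
      using Comp_assoc[OF Eik(1)[OF order_refl] fi \<theta>(1)] wv[of p] Pp(3) by (simp add: e_def)
  qed
  then show ?thesis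
    using that[OF E f] g g0[of p] by (simp add: p_def)
qed

text \<open>\<alpha> keeps the vertices \<open>0\<close> and \<open>n\<close>, so a map of flags is
  determined by its restriction along \<alpha>. For fullness the top components at
  \<open>i < k < j\<close> have to be found: \<open>ob B 0 k\<close> is the pullback of
  \<open>ob B 0 j\<close> and \<open>ob B i k\<close> over \<open>ob B i j\<close>, and
  \<open>f\<close> and \<open>g\<close> provide the two legs. Essential surjectivity is
  \<open>polygon_glue\<close>.\<close>

lemma polygon_square:
  assumes ij: "i + 2 \<le> j" "j \<le> n"
  shows "two_pullback_square (core (flag_category C z n))
    (core (flag_category C z (n - (j - i - 1)))) (core (flag_category C z (j - i)))
    (core (flag_category C z 1))
    (flag_pull C (n - (j - i - 1)) (\<lambda>k\<in>{..n - (j - i - 1)}. if k \<le> i then k else k + (j - i - 1)))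
    (flag_pull C (j - i) (\<lambda>k\<in>{..j - i}. i + k))
    (flag_pull C 1 (\<lambda>k\<in>{..1}. i + k)) (flag_pull C 1 (\<lambda>k\<in>{..1}. k * (j - i)))"
proof -
  define m where "m = n - (j - i - 1)"
  define p where "p = j - i"
  define d where "d = j - i - 1"
  define \<alpha> where "\<alpha> = (\<lambda>k\<in>{..m}. if k \<le> i then k else k + d)"
  define \<beta> where "\<beta> = (\<lambda>k\<in>{..p}. i + k)"
  define \<gamma> :: "nat \<Rightarrow> nat" where "\<gamma> = (\<lambda>k\<in>{..1}. i + k)"
  define \<delta> where "\<delta> = (\<lambda>k\<in>{..1}. k * p)"
  note defs = m_def p_def d_def \<alpha>_def \<beta>_def \<gamma>_def \<delta>_def
  have a: "\<alpha> \<in> Delta m n" and b: "\<beta> \<in> Delta p n" and c: "\<gamma> \<in> Delta 1 m" and d: "\<delta> \<in> Delta 1 p"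
    using polygon_Delta[OF ij] unfolding defs by blast+
  have md: "i < m" "m + d = n" "Suc i + d = j" and pij: "i + p = j" "0 < p" using ij by (auto simp: defs)
  have \<alpha>_eq: "\<alpha> k = (if k \<le> i then k else k + d)" if "k \<le> m" for k
    using that by (simp add: \<alpha>_def)
  have \<beta>_eq: "\<beta> k = i + k" if "k \<le> p" for k using that by (simp add: \<beta>_def)
  have \<gamma>v: "\<gamma> 0 = i" "\<gamma> 1 = Suc i" and \<delta>v: "\<delta> 0 = 0" "\<delta> 1 = p" by (auto simp: \<gamma>_def \<delta>_def)
  have \<alpha>v: "\<alpha> 0 = 0" "\<alpha> m = n" "\<alpha> i = i" "\<alpha> (Suc i) = j"
    using \<alpha>_eq[of 0] \<alpha>_eq[of m] \<alpha>_eq[of i] \<alpha>_eq[of "Suc i"] md by simp_all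
  have \<beta>v: "\<beta> 0 = i" "\<beta> p = j" using \<beta>_eq[of 0] \<beta>_eq[of p] pij by simp_all
  have "two_pullback_square (core (flag_category C z n)) (core (flag_category C z m))
    (core (flag_category C z p)) (core (flag_category C z 1))
    (flag_pull C m \<alpha>) (flag_pull C p \<beta>) (flag_pull C 1 \<gamma>) (flag_pull C 1 \<delta>)"
  proof (rule flag_two_pullback_squareI[OF a b c d])
    fix k :: nat assume "k \<le> 1"
    then have "k = 0 \<or> k = 1" by auto
    then show "\<alpha> (\<gamma> k) = \<beta> (\<delta> k)" using \<alpha>v \<gamma>v \<delta>v \<beta>v by auto
  next
    fix A B f g
    assume A: "A \<in> flags C z n" and B: "B \<in> flags C z n"
      and f: "flag_map m (tri_pull C m \<alpha> A) (tri_pull C m \<alpha> B) f"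
      and g: "flag_map p (tri_pull C p \<beta> A) (tri_pull C p \<beta> B) g"
      and fg: "f (\<gamma> 0) (\<gamma> 1) = g (\<delta> 0) (\<delta> 1)"
    note DA = tri_diag_flag[OF A] and DB = tri_diag_flag[OF B]
    have f_in: "f k l \<in> hom C (ob A (\<alpha> k) (\<alpha> l)) (ob B (\<alpha> k) (\<alpha> l))" if "k \<le> l" "l \<le> m" for k l
      using flag_mapD(3)[OF f that] that by (simp add: ob_tri_pull)
    have f_nat: "tri_map B (\<alpha> k) (\<alpha> l) (\<alpha> k') (\<alpha> l') \<cdot> f k l =
        f k' l' \<cdot> tri_map A (\<alpha> k) (\<alpha> l) (\<alpha> k') (\<alpha> l')"
      if "k \<le> l" "k' \<le> l'" "k \<le> k'" "l \<le> l'" "l' \<le> m" for k l k' l'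
      using flag_mapD(4)[OF f that] tri_map_tri_pull[OF A a that] tri_map_tri_pull[OF B a that] by simp
    have f0m: "f 0 m \<in> hom C (ob A 0 n) (ob B 0 n)" using f_in[of 0 m] \<alpha>v by simp
    \<comment> \<open>At the vertices kept by \<alpha> the component of \<open>f\<close> is the
      required map of steps.\<close>
    have \<alpha>_step: "\<exists>x. x \<in> hom C (ob A 0 (\<alpha> l)) (ob B 0 (\<alpha> l)) \<and>
        tri_map B 0 (\<alpha> l) 0 n \<cdot> x = f 0 m \<cdot> tri_map A 0 (\<alpha> l) 0 n" if "l \<le> m" for l
      using f_in[of 0 l] f_nat[of 0 l 0 m] \<alpha>v that by auto
    have "\<exists>x. x \<in> hom C (ob A 0 k) (ob B 0 k) \<and>
        tri_map B 0 k 0 n \<cdot> x = f 0 m \<cdot> tri_map A 0 k 0 n" if k: "k \<le> n" for k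
    proof -
      consider "k \<le> i" | "j \<le> k" | "i < k" "k < j" by linarith
      then show ?thesis
      proof cases
        case 1
        then show ?thesis using \<alpha>_step[of k] \<alpha>_eq[of k] md by simp
      next
        case 2
        then have "\<alpha> (k - d) = k" "k - d \<le> m" using \<alpha>_eq[of "k - d"] md k by auto
        then show ?thesis using \<alpha>_step[of "k - d"] by simp
      next
        case 3
        define l where "l = k - i"
        have l: "k = i + l" "l \<le> p" using 3 pij by (auto simp: l_def)
        have A_in: "tri_map A 0 k 0 j \<in> hom C (ob A 0 k) (ob A 0 j)"
          "tri_map A 0 k i k \<in> hom C (ob A 0 k) (ob A i k)"
          "tri_map A 0 j i j \<in> hom C (ob A 0 j) (ob A i j)"
          "tri_map A i k i j \<in> hom C (ob A i k) (ob A i j)"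
          "tri_map A 0 j 0 n \<in> hom C (ob A 0 j) (ob A 0 n)"
          using tri_diagD(4)[OF DA] 3 ij by simp_all
        have B_in: "tri_map B 0 k 0 j \<in> hom C (ob B 0 k) (ob B 0 j)"
          "tri_map B 0 j i j \<in> hom C (ob B 0 j) (ob B i j)"
          "tri_map B i k i j \<in> hom C (ob B i k) (ob B i j)"
          "tri_map B 0 j 0 n \<in> hom C (ob B 0 j) (ob B 0 n)"
          using tri_diagD(4)[OF DB] 3 ij by simp_all
        have f_j: "f 0 (Suc i) \<in> hom C (ob A 0 j) (ob B 0 j)"
          "f i (Suc i) \<in> hom C (ob A i j) (ob B i j)"
          using f_in[of 0 "Suc i"] f_in[of i "Suc i"] \<alpha>v md by simp_all
        have g_k: "g 0 l \<in> hom C (ob A i k) (ob B i k)"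
          using flag_mapD(3)[OF g, of 0 l] \<beta>_eq[of 0] \<beta>_eq[of l] l by (simp add: ob_tri_pull)
        have fn: "tri_map B 0 j i j \<cdot> f 0 (Suc i) = f i (Suc i) \<cdot> tri_map A 0 j i j"
          using f_nat[of 0 "Suc i" i "Suc i"] \<alpha>v md by simp
        have gn: "tri_map B i k i j \<cdot> g 0 l = g 0 p \<cdot> tri_map A i k i j"
          using flag_mapD(4)[OF g, of 0 l 0 p] tri_map_tri_pull[OF A b, of 0 l 0 p]
            tri_map_tri_pull[OF B b, of 0 l 0 p] \<beta>v \<beta>_eq[of l] l by simp
        \<comment> \<open>The two legs agree over \<open>ob B i j\<close>: naturality of
          \<open>f\<close> and of \<open>g\<close> moves both composites to the component at
          \<open>(i, j)\<close>, where \<open>f\<close> and \<open>g\<close> coincide by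
          \<open>fg\<close>.\<close>
        have "tri_map B 0 j i j \<cdot> f 0 (Suc i) \<cdot> tri_map A 0 k 0 j =
            f i (Suc i) \<cdot> tri_map A 0 j i j \<cdot> tri_map A 0 k 0 j"
          using fn Comp_assoc[OF A_in(1) f_j(1) B_in(2)] Comp_assoc[OF A_in(1) A_in(3) f_j(2)] by simp
        also have "\<dots> = g 0 p \<cdot> tri_map A i k i j \<cdot> tri_map A 0 k i k"
          using fg[unfolded \<gamma>v \<delta>v] tri_diagD(5)[OF DA, of 0 k 0 j i j]
            tri_diagD(5)[OF DA, of 0 k i k i j] 3 ij by simp
        also have "\<dots> = tri_map B i k i j \<cdot> g 0 l \<cdot> tri_map A 0 k i k"
          using gn Comp_assoc[OF A_in(2) g_k B_in(3)] Comp_assoc[OF A_in(2) A_in(4)]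
            f_j(2)[unfolded fg[unfolded \<gamma>v \<delta>v]] by simp
        finally have eq: "tri_map B 0 j i j \<cdot> f 0 (Suc i) \<cdot> tri_map A 0 k 0 j =
          tri_map B i k i j \<cdot> g 0 l \<cdot> tri_map A 0 k i k" .
        have "bic (ob B 0 k) (ob B 0 j) (ob B i k) (ob B i j) (tri_map B 0 k 0 j)
          (tri_map B 0 k i k) (tri_map B 0 j i j) (tri_map B i k i j)"
          using tri_diagD(6)[OF DB, of 0 i k j] 3 ij by simp
        from bic_pull[OF this Comp_in[OF A_in(1) f_j(1)] Comp_in[OF A_in(2) g_k] eq]
        obtain x where x: "x \<in> hom C (ob A 0 k) (ob B 0 k)"
          "tri_map B 0 k 0 j \<cdot> x = f 0 (Suc i) \<cdot> tri_map A 0 k 0 j" by metis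
        have "tri_map B 0 k 0 n \<cdot> x = tri_map B 0 j 0 n \<cdot> f 0 (Suc i) \<cdot> tri_map A 0 k 0 j"
          using x(2) Comp_assoc[OF x(1) B_in(1) B_in(4)] tri_diagD(5)[OF DB, of 0 k 0 j 0 n] 3 ij
          by simp
        also have "\<dots> = (f 0 m \<cdot> tri_map A 0 j 0 n) \<cdot> tri_map A 0 k 0 j"
          using f_nat[of 0 "Suc i" 0 m] Comp_assoc[OF A_in(1) f_j(1) B_in(4)] \<alpha>v md by simp
        also have "\<dots> = f 0 m \<cdot> tri_map A 0 k 0 n"
          using Comp_assoc[OF A_in(1) A_in(5) f0m] tri_diagD(5)[OF DA, of 0 k 0 j 0 n] 3 ij by simp
        finally show ?thesis using x(1) by blast
      qed
    qed
    then obtain F where F: "\<And>k. k \<le> n \<Longrightarrow> F k \<in> hom C (ob A 0 k) (ob B 0 k)"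
      and FB: "\<And>k. k \<le> n \<Longrightarrow> tri_map B 0 k 0 n \<cdot> F k = f 0 m \<cdot> tri_map A 0 k 0 n" by metis
    have Fn: "F n = f 0 m"
      using FB[of n] Ident_left[OF F[OF order_refl]] Ident_right[OF f0m]
        tri_diagD(3)[OF DA, of 0 n] tri_diagD(3)[OF DB, of 0 n] by simp
    obtain h where h: "flag_map n A B h" and h0: "\<And>k. k \<le> n \<Longrightarrow> h 0 k = F k"
      using flag_map_extend[OF A B F] FB Fn by metis
    have hf: "tri_fam m (\<lambda>i j. h (\<alpha> i) (\<alpha> j)) = f"
      by (rule flag_map_eqI[OF flag_map_pull[OF h a] f]) (simp add: tri_fam_apply \<alpha>v h0 Fn)
    \<comment> \<open>The largest object of the flag restricted along \<beta> is the entry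
      \<open>(i, j)\<close>, which \<alpha> also sees. There \<open>h\<close> equals
      \<open>f\<close>, hence \<open>g\<close>, and this decides equality on the whole
      restriction.\<close>
    have "h i j = f i (Suc i)"
      using fun_cong[OF fun_cong[OF hf], of i "Suc i"] \<alpha>v md by (simp add: tri_fam_apply)
    then have "tri_fam p (\<lambda>i j. h (\<beta> i) (\<beta> j)) = g"
      using fg[unfolded \<gamma>v \<delta>v]
      by (intro flag_map_eqI[OF flag_map_pull[OF h b] g]) (simp add: tri_fam_apply \<beta>v)
    with h hf show "\<exists>h. flag_map n A B h \<and> tri_fam m (\<lambda>i j. h (\<alpha> i) (\<alpha> j)) = f \<and>
        tri_fam p (\<lambda>i j. h (\<beta> i) (\<beta> j)) = g" by blast
  next
    fix A B h h' assume h: "flag_map n A B h" and h': "flag_map n A B h'"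
      and "tri_fam m (\<lambda>i j. h (\<alpha> i) (\<alpha> j)) = tri_fam m (\<lambda>i j. h' (\<alpha> i) (\<alpha> j))"
    from fun_cong[OF fun_cong[OF this(3)], of 0 m] show "h = h'"
      by (intro flag_map_eqI[OF h h']) (simp add: tri_fam_apply \<alpha>v)
  next
    fix A B \<phi>
    assume A: "A \<in> flags C z m" and B: "B \<in> flags C z p"
      and \<phi>: "is_iso (flag_category C z 1) (tri_pull C 1 \<gamma> A, tri_pull C 1 \<delta> B, \<phi>)"
    have "\<phi> 0 1 \<in> hom C (ob A i (Suc i)) (ob B 0 p)" "is_iso C (\<phi> 0 1)"
      using flag_mapD(3)[OF flag_iso_map[OF \<phi>], of 0 1] flag_iso_component[OF \<phi>, of 0 1] \<gamma>v \<delta>v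
      by (simp_all add: ob_tri_pull)
    from polygon_glue[OF ij A[unfolded m_def] B[unfolded p_def] this[unfolded p_def]]
    obtain E f g where "E \<in> flags C z n" "is_iso (flag_category C z m) (tri_pull C m \<alpha> E, A, f)"
      "is_iso (flag_category C z p) (tri_pull C p \<beta> E, B, g)" "\<phi> 0 1 \<cdot> f i (Suc i) = g 0 p"
      unfolding m_def p_def d_def \<alpha>_def \<beta>_def .
    then show "\<exists>E f g. E \<in> flags C z n \<and> is_iso (flag_category C z m) (tri_pull C m \<alpha> E, A, f) \<and>
        is_iso (flag_category C z p) (tri_pull C p \<beta> E, B, g) \<and>
        \<phi> 0 1 \<cdot> f (\<gamma> 0) (\<gamma> 1) = g (\<delta> 0) (\<delta> 1)"
      unfolding \<gamma>v \<delta>v by blast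
  qed
  then show ?thesis by (simp only: defs)
qed

section \<open>From index maps to vertex sets\<close>

lemma flag_simplicial_two_segal: "two_segal (flag_simplicial C z)"
proof (rule two_segal.intro[OF flag_simplicial_groupoid two_segal_axioms.intro])
  fix i j n :: nat
  assume ij: "i + 2 \<le> j" "j \<le> n"
  define m where "m = n - (j - i - 1)"
  \<comment> \<open>Increasing enumerations of \<open>{0..i} \<union> {j..n}\<close>,
    \<open>{i..j}\<close> and \<open>{i, j}\<close>, from which \<open>incl_eq\<close> computes the
    four index maps of \<open>polygon_square\<close>.\<close>
  define e1 :: "nat \<Rightarrow> nat" where "e1 k = (if k \<le> i then k else k + (j - i - 1))" for k
  define e2 :: "nat \<Rightarrow> nat" where "e2 k = i + k" for k
  define e3 :: "nat \<Rightarrow> nat" where "e3 k = (if k = 0 then i else j)" for k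
  have e0: "strict_mono_on {..n} (\<lambda>k. k)" by (simp add: strict_mono_on_def)
  have e1: "strict_mono_on {..m} e1" by (auto simp: strict_mono_on_def e1_def)
  have e2: "strict_mono_on {..j - i} e2" by (auto simp: strict_mono_on_def e2_def)
  have e3: "strict_mono_on {..1} e3" using ij by (auto simp: strict_mono_on_def e3_def)
  have I0: "(\<lambda>k. k) ` {..n} = {0..n}" by auto
  have I1: "e1 ` {..m} = {0..i} \<union> {j..n}"
  proof (intro equalityI subsetI)
    fix k assume "k \<in> {0..i} \<union> {j..n}"
    then show "k \<in> e1 ` {..m}"
      using ij by (intro image_eqI[of _ _ "if k \<le> i then k else k - (j - i - 1)"])
        (auto simp: e1_def m_def)
  qed (use ij in \<open>auto simp: e1_def m_def split: if_splits\<close>)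
  have I2: "e2 ` {..j - i} = {i..j}"
  proof (intro equalityI subsetI)
    fix k assume "k \<in> {i..j}"
    then show "k \<in> e2 ` {..j - i}" by (intro image_eqI[of _ _ "k - i"]) (auto simp: e2_def)
  qed (use ij in \<open>auto simp: e2_def\<close>)
  have "{..1} = {0, 1 :: nat}" by auto
  then have I3: "e3 ` {..1} = {i, j}" by (auto simp: e3_def)
  have card: "card {0..n} - 1 = n" "card ({0..i} \<union> {j..n}) - 1 = m" "card {i..j} - 1 = j - i"
    "card {i, j} - 1 = 1"
    using enum_set_strict_mono(1)[OF e1] ij unfolding I1 by auto
  have "incl ({0..i} \<union> {j..n}) {0..n} = (\<lambda>k\<in>{..m}. e1 k)"
    by (rule incl_eq[OF e1 e0, unfolded I0 I1]) (use ij in \<open>auto simp: e1_def m_def\<close>)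
  moreover have "incl {i..j} {0..n} = (\<lambda>k\<in>{..j - i}. e2 k)"
    by (rule incl_eq[OF e2 e0, unfolded I0 I2]) (use ij in \<open>auto simp: e2_def\<close>)
  moreover have "incl {i, j} ({0..i} \<union> {j..n}) = (\<lambda>k\<in>{..1}. i + k)"
    by (rule incl_eq[OF e3 e1, unfolded I1 I3]) (use ij in \<open>auto simp: e1_def e3_def m_def le_Suc_eq\<close>)
  moreover have "incl {i, j} {i..j} = (\<lambda>k\<in>{..1}. k * (j - i))"
    by (rule incl_eq[OF e3 e2, unfolded I2 I3]) (use ij in \<open>auto simp: e2_def e3_def le_Suc_eq\<close>)
  ultimately show "two_pullback_square (cells_on (flag_simplicial C z) {0..n})
    (cells_on (flag_simplicial C z) ({0..i} \<union> {j..n})) (cells_on (flag_simplicial C z) {i..j})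
    (cells_on (flag_simplicial C z) {i, j})
    (res (flag_simplicial C z) {0..n} ({0..i} \<union> {j..n})) (res (flag_simplicial C z) {0..n} {i..j})
    (res (flag_simplicial C z) ({0..i} \<union> {j..n}) {i, j}) (res (flag_simplicial C z) {i..j} {i, j})"
    using polygon_square[OF ij]
    unfolding cells_on_def res_def card flag_simplicial_simps m_def e1_def e2_def by simp
next
  fix i n :: nat
  assume i: "i < n"
  have e0: "strict_mono_on {..N} (\<lambda>k. k)" for N :: nat by (simp add: strict_mono_on_def)
  have e1: "strict_mono_on {..N} (\<lambda>k. i + k)" for N by (simp add: strict_mono_on_def)
  have I0: "(\<lambda>k. k) ` {..N} = {0..N}" for N :: nat by auto
  have I1: "(\<lambda>k. i + k) ` {..0} = {i}" by auto
  have "{..1} = {0, 1 :: nat}" by auto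
  then have I2: "(\<lambda>k. i + k) ` {..1} = {i, i + 1}" by auto
  have card: "card {0..N} - 1 = N" "card {i} - 1 = 0" "card {i, i + 1} - 1 = 1" for N by auto
  have incl: "incl {i} {0..n - 1} = (\<lambda>k\<in>{..0}. i + k)" "incl {i, i + 1} {0..n} = (\<lambda>k\<in>{..1}. i + k)"
    using incl_eq[OF e1 e0, of 0 "\<lambda>k. i + k" "n - 1", unfolded I0 I1]
      incl_eq[OF e1 e0, of 1 "\<lambda>k. i + k" n, unfolded I0 I2] i by auto
  \<comment> \<open>The unital square for \<open>n\<close> starts from flags on
    \<open>{0..n - 1}\<close>, while \<open>unital_square\<close> is indexed by the size of that
    smaller flag.\<close>
  have n: "Suc (n - 1) = n" using i by simp
  show "two_pullback_square (cells_on (flag_simplicial C z) {0..n - 1})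
    (cells_on (flag_simplicial C z) {0..n}) (cells_on (flag_simplicial C z) {i})
    (cells_on (flag_simplicial C z) {i, i + 1})
    (degeneracy (flag_simplicial C z) (n - 1) i) (res (flag_simplicial C z) {0..n - 1} {i})
    (res (flag_simplicial C z) {0..n} {i, i + 1}) (degeneracy (flag_simplicial C z) 0 0)"
    using unital_square[of i "n - 1"] i
    unfolding cells_on_def res_def degeneracy_def card incl flag_simplicial_simps n by simp
qed

end

theorem theorem2p10:
  fixes C :: "('o, 'm) category" and z :: 'o
  assumes "proto_abelian C"
    and "zero_object C z"
  shows "two_segal (flag_simplicial C z)"
proof -
  interpret pointed_proto_abelian C z
    using assms by (simp add: pointed_proto_abelian_def pointed_proto_abelian_axioms_def)
  show ?thesis by (rule flag_simplicial_two_segal)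
qed

end
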